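(* Let $m,n,\alpha,\beta,\gamma$ be nonnegative integers with $2\alpha+2\gamma+2\geq \beta$, and put $N=m+n+\alpha+\gamma$. Let $L_1,R_1,B\subseteq\{-N-\frac12,-N+\frac12,\dots,N+\frac12\}$. Let $F_L\subseteq L_1\setminus R_1$ with $F_L=-F_L$ and $|F_L|=2m$, and let $F_R\subseteq R_1\setminus L_1$ with $F_R=-F_R$ and $|F_R|=2n$. Put $L_2=(L_1\setminus F_L)\cup F_R$ and $R_2=(R_1\setminus F_R)\cup F_L$ (i.e. the removed left-pointing triangles labeled by $F_L$ and the removed right-pointing triangles labeled by $F_R$ are flipped across the vertical diagonal). If $\operatorname{M}_q(H'_{m,n,\alpha,\beta,\gamma}(L_1,R_1,B))\neq 0$, then \[ \frac{\operatorname{M}_{q}(H'_{n,m,\alpha,\beta,\gamma}(L_2, R_2, B))}{\operatorname{M}_{q}(H'_{m,n,\alpha,\beta,\gamma}(L_1, R_1, B))}=\frac{\Big[\prod_{i=1}^{m+\alpha+1}\langle 2i-2\rangle_q!\Big]^2}{\Big[\prod_{i=1}^{n+\alpha+1}\langle 2i-2\rangle_q!\Big]^2}\cdot\frac{\prod_{i=1}^{2n+\beta-1}\langle i\rangle_{q}!}{\prod_{i=1}^{2m+\beta-1}\langle i\rangle_{q}!}\cdot\sqrt{\frac{\prod_{s\in L_{1}}\langle 2|s|\rangle_q}{\prod_{s\in L_{2}}\langle 2|s|\rangle_q}}\cdot\frac{\Delta_{1,1,q}(L_{2})\Delta_{1,1,q}(R_{2})}{\Delta_{1,1,q}(L_{1})\Delta_{1,1,q}(R_{1})},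 \] where the square root (whose argument is the square of a ratio of Laurent polynomials in $q$ after cancellation) is taken with the sign making the leading coefficients of numerator and denominator positive.
   Context: Work on the triangular lattice of unit triangles (side length $1$) with one family of lattice lines vertical. A left-pointing (resp. right-pointing) unit triangle has a vertical side on its right (resp. left) and a vertex pointing left (resp. right). A lozenge is the union of two unit triangles sharing an edge; it is horizontal if the shared edge is vertical. A unit segment declared a barrier may not be crossed by a lozenge. Weights: given a region with a distinguished horizontal line $\ell$, the $i$-coordinate of a point is twice its signed vertical distance above $\ell$. A horizontal lozenge whose center has $i$-coordinate $n$ gets weight $\frac{q^n+q^{-n}}{2}$; all other lozenges get weight $1$. The weight of a tiling is the product of its lozenge weights, and $\operatorname{M}_q(R)$ is the sum of weights of all lozenge tilings of $R$. Region $H'_{m,n,\alpha,\beta,\gamma}(L,R,B)$: take the hexagon whose sides, clockwise starting from the (vertical) left side, have lengths $2n+2\gamma$, $2m+2\alpha+2$, $2n+\beta$, $2m+2\alpha+2\gamma-\beta+2$, $2n+\beta$, $2m+2\alpha+2$; it is symmetric about a horizontal line $\ell$ (the perpendicular bisector of its left side). Remove the intrusion consisting of the $2m+2\alpha+2$ unit triangles crossed by $\ell$ that are nearest to the left side (the first is left-pointing with its left vertex at the midpoint of the left side, orientations alternate); it reaches the vertical diagonal joining the top and bottom vertices of the hexagon. This diagonal consists of $2(m+n+\alpha+\gamma)+2$ unit segments, labeled $-(m+n+\alpha+\gamma)-\frac12,\dots,m+n+\alpha+\gamma+\frac12$ from bottom to top (label $=$ signed height of its midpoint above $\ell$). Remove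 the left-pointing unit triangles whose right side is a diagonal segment with label in $L$, remove the right-pointing unit triangles whose left side is a diagonal segment with label in $R$, and make the diagonal segments with labels in $B$ barriers. Weights are with respect to $\ell$. Notation: $\langle n\rangle_q=\frac{q^n-q^{-n}}{q-q^{-1}}$, $\langle n\rangle_q!=\langle 1\rangle_q\cdots\langle n\rangle_q$ (with $\langle 0\rangle_q!=1$), $\langle n\rangle_q^+=\frac{q^n+q^{-n}}{2}$, and for a finite set $S\subset\mathbb{Z}$ or $S\subset\mathbb{Z}+\frac12$, $\Delta_{1,1,q}(S)=\prod_{s_1,s_2\in S,\,s_1<s_2}\langle s_2+s_1\rangle_q^+\langle s_2-s_1\rangle_q$. For a set $A$, $-A=\{-a:a\in A\}$. *)

theory Defs
  imports "HOL-Library.Disjoint_Sets" "HOL-Computational_Algebra.Computational_Algebra"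
begin

text \<open>
  Coordinates. The lattice point at horizontal distance \<open>x * sqrt 3 / 2\<close> to the right of the left
  side of the hexagon and at signed height \<open>y / 2\<close> above \<open>\<ell>\<close> is the pair \<open>(x, y)\<close>, so that
  \<open>y\<close> is the \<open>i\<close>-coordinate. Since the endpoints of the left side are at integral heights, the
  lattice points are the pairs with \<open>x + y\<close> even.

  The pair \<open>(c, y)\<close>, regarded as a triangle, is the unit triangle between the vertical lattice lines
  \<open>x = c\<close> and \<open>x = c + 1\<close> whose vertical side has its midpoint at \<open>i\<close>-coordinate \<open>y\<close>. Every pair is
  exactly one unit triangle; it is left-pointing iff \<open>c + y\<close> is even.
\<close>

type_synonym point = "int \<times> int"
type_synonym triangle = "int \<times> int"
type_synonym segment = "point set"

fun vertices :: "triangle \<Rightarrow> point set" where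
  "vertices (c, y) =
     (if even (c + y) then {(c, y), (c + 1, y - 1), (c + 1, y + 1)}
      else {(c + 1, y), (c, y - 1), (c, y + 1)})"

definition left_pointing :: "triangle \<Rightarrow> bool" where
  "left_pointing t \<longleftrightarrow> even (fst t + snd t)"

text \<open>The unit segment on the line at \<open>x\<close> whose midpoint has \<open>i\<close>-coordinate \<open>y\<close>.\<close>

definition vertical_segment :: "int \<Rightarrow> int \<Rightarrow> segment" where
  "vertical_segment x y = {(x, y - 1), (x, y + 1)}"

definition shared_edge :: "triangle set \<Rightarrow> segment" where
  "shared_edge T = (\<Inter>t\<in>T. vertices t)"

text \<open>Two distinct unit triangles share an edge iff they have two vertices in common.\<close>

definition lozenge :: "triangle set \<Rightarrow> bool" where
  "lozenge T \<longleftrightarrow> card T = 2 \<and> card (shared_edge T) = 2"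

definition horizontal :: "triangle set \<Rightarrow> bool" where
  "horizontal T \<longleftrightarrow> (\<exists>x y. shared_edge T = vertical_segment x y)"

text \<open>The center of a lozenge is the midpoint of its shared edge.\<close>

definition center_height :: "triangle set \<Rightarrow> int" where
  "center_height T = (THE y. \<exists>x. shared_edge T = vertical_segment x y)"

text \<open>A region is a set of unit triangles together with a set of barriers.\<close>

type_synonym region = "triangle set \<times> segment set"

definition tilings :: "region \<Rightarrow> triangle set set set" where
  "tilings Reg = {P. partition_on (fst Reg) P \<and> (\<forall>T\<in>P. lozenge T \<and> shared_edge T \<notin> snd Reg)}"

definition qnum :: "'a::field \<Rightarrow> int \<Rightarrow> 'a" where
  "qnum q n = (q powi n - q powi (- n)) / (q - q powi (- 1))"

definition qfact :: "'a::field \<Rightarrow> nat \<Rightarrow> 'a" where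
  "qfact q n = (\<Prod>i=1..n. qnum q (int i))"

definition qplus :: "'a::field \<Rightarrow> int \<Rightarrow> 'a" where
  "qplus q n = (q powi n + q powi (- n)) / 2"

text \<open>
  Used only for sets of integers or sets of half-integers, where \<open>s\<^sub>2 + s\<^sub>1\<close> and
  \<open>s\<^sub>2 - s\<^sub>1\<close> are integers and the floor is merely a type conversion.
\<close>

definition \<Delta>\<^sub>1\<^sub>1 :: "'a::field \<Rightarrow> rat set \<Rightarrow> 'a" where
  "\<Delta>\<^sub>1\<^sub>1 q S = (\<Prod>(s\<^sub>1, s\<^sub>2) \<in> {(s\<^sub>1, s\<^sub>2). s\<^sub>1 \<in> S \<and> s\<^sub>2 \<in> S \<and> s\<^sub>1 < s\<^sub>2}.
                qplus q \<lfloor>s\<^sub>2 + s\<^sub>1\<rfloor> * qnum q \<lfloor>s\<^sub>2 - s\<^sub>1\<rfloor>)"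

definition lozenge_weight :: "'a::field \<Rightarrow> triangle set \<Rightarrow> 'a" where
  "lozenge_weight q T = (if horizontal T then qplus q (center_height T) else 1)"

definition M :: "'a::field \<Rightarrow> region \<Rightarrow> 'a" where
  "M q Reg = (\<Sum>P\<in>tilings Reg. \<Prod>T\<in>P. lozenge_weight q T)"

text \<open>
  The hexagon, symmetric about \<open>\<ell>\<close>, with side lengths \<open>s, a, b, s + a - b, b, a\<close> clockwise from the
  left side (\<open>b \<le> s + a\<close>): its vertices are \<open>(0, \<plusminus>s)\<close>, \<open>(a, \<plusminus>(s + a))\<close> and
  \<open>(a + b, \<plusminus>(s + a - b))\<close>.
\<close>

definition hexagon_points :: "int \<Rightarrow> int \<Rightarrow> int \<Rightarrow> point set" where
  "hexagon_points s a b =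
     {(x, y). 0 \<le> x \<and> x \<le> a + b \<and> \<bar>y\<bar> \<le> s + x \<and> \<bar>y\<bar> \<le> s + 2 * a - x}"

definition hexagon :: "nat \<Rightarrow> nat \<Rightarrow> nat \<Rightarrow> nat \<Rightarrow> nat \<Rightarrow> triangle set" where
  "hexagon m n \<alpha> \<beta> \<gamma> =
     {t. vertices t \<subseteq> hexagon_points (int (2*n + 2*\<gamma>)) (int (2*m + 2*\<alpha> + 2)) (int (2*n + \<beta>))}"

text \<open>The abscissa of the vertical diagonal.\<close>

definition diag :: "nat \<Rightarrow> nat \<Rightarrow> int" where
  "diag m \<alpha> = int (2*m + 2*\<alpha> + 2)"

definition intrusion :: "nat \<Rightarrow> nat \<Rightarrow> triangle set" where
  "intrusion m \<alpha> = {(c, 0) | c. 0 \<le> c \<and> c < diag m \<alpha>}"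

text \<open>
  The diagonal segment with label \<open>s\<close> has its midpoint at \<open>i\<close>-coordinate \<open>2 * s\<close>.
  For labels on the diagonal the left dents always lie in the hexagon. If \<open>2 * n + \<beta> = 0\<close> then
  nothing of the hexagon lies to the right of the diagonal; a nonempty set \<open>R\<close> of dents would then
  name triangles that cannot be removed, which \<open>right_dents m \<alpha> R \<subseteq> hexagon m n \<alpha> \<beta> \<gamma>\<close> excludes.
\<close>

definition left_dents :: "nat \<Rightarrow> nat \<Rightarrow> rat set \<Rightarrow> triangle set" where
  "left_dents m \<alpha> L =
     {(c, y). left_pointing (c, y) \<and> c + 1 = diag m \<alpha> \<and> (\<exists>s\<in>L. of_int y = 2 * s)}"

definition right_dents :: "nat \<Rightarrow> nat \<Rightarrow> rat set \<Rightarrow> triangle set" where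
  "right_dents m \<alpha> R =
     {(c, y). \<not> left_pointing (c, y) \<and> c = diag m \<alpha> \<and> (\<exists>s\<in>R. of_int y = 2 * s)}"

definition barriers :: "nat \<Rightarrow> nat \<Rightarrow> rat set \<Rightarrow> segment set" where
  "barriers m \<alpha> B = {vertical_segment (diag m \<alpha>) y | y. \<exists>s\<in>B. of_int y = 2 * s}"

definition H' :: "nat \<Rightarrow> nat \<Rightarrow> nat \<Rightarrow> nat \<Rightarrow> nat \<Rightarrow> rat set \<Rightarrow> rat set \<Rightarrow> rat set \<Rightarrow> region" where
  "H' m n \<alpha> \<beta> \<gamma> L R B =
     (hexagon m n \<alpha> \<beta> \<gamma> - intrusion m \<alpha> - left_dents m \<alpha> L - right_dents m \<alpha> R, barriers m \<alpha> B)"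

text \<open>The labels \<open>-N - 1/2, -N + 1/2, \<dots>, N + 1/2\<close> of the diagonal segments.\<close>

definition labels :: "nat \<Rightarrow> rat set" where
  "labels N = {s. s - 1/2 \<in> \<int> \<and> \<bar>s\<bar> \<le> of_nat N + 1/2}"

text \<open>
  The variable \<open>q\<close>, as an element of the field of rational functions over the rationals. In the
  library's order on this field an element is positive iff the leading coefficients of its numerator
  and denominator have the same sign, so \<open>0 < r\<close> expresses the choice of sign of a square root \<open>r\<close>
  by leading coefficients.
\<close>

definition q_var :: "rat poly fract" where
  "q_var = Fract [:0, 1:] 1"

end

theory Submission
  imports Defs "Jordan_Normal_Form.Determinant"
begin

text \<open>
  The tilings of the region are cut along the vertical diagonal: summing over the set \<open>S\<close> of
  positions at which a horizontal lozenge crosses it, a summand is the product of the weights of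
  \<open>S\<close> and of the generating functions of the two halves with dents \<open>L \<union> S\<close> and \<open>R \<union> S\<close>. The
  intrusion separates the left half further into an upper and a lower part.

  Each of these pieces is tiled one vertical strip at a time. A strip with prescribed dents on both
  sides has at most one tiling, and it has one iff the dents interlace. The interlacing sums
  preserve Vandermonde products, because a Vandermonde product is a determinant of polynomials that
  may be chosen such that their product with the weight telescopes along the strip. Hence the
  generating functions are multiples of Vandermonde products: in \<open>x y = \<langle>y\<rangle>\<^sub>q / 2\<close> for the right half
  and in \<open>(x y)\<^sup>2\<close> for the two parts of the left half, where \<open>y\<close> is the \<open>i\<close>-coordinate of a dent.

  Since \<open>F\<^sub>L\<close> and \<open>F\<^sub>R\<close> are symmetric, the factors that link them to a dent \<open>y\<close> pair up to
  \<open>(x y)\<^sup>2 - (x f)\<^sup>2\<close>, so they are the same in both halves. After the flip the factors involving \<open>S\<close>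
  cancel, and the quotient of corresponding summands does not depend on \<open>S\<close>.
\<close>

section \<open>Vandermonde determinants and interlacing sums\<close>

text \<open>Everything takes place in a linearly ordered field with \<open>1 < q\<close>. The
  rational functions ordered by leading coefficients are such a field, and there positivity settles
  that denominators do not vanish, that Vandermonde products in increasing coordinates are positive,
  and which square root is meant. The obstacle is the left half. Its strips end at the intrusion, so
  the telescoping functions must respect the reflection in height 0, which forces the squared
  coordinate. Two kinds of columns then alternate: one leaves an extra product of
  \<open>qnum q s\<close>, which the next takes up as part of its weight. The constants arise as
  follows. A strip of the right half divides by one \<open>qfact q k\<close>; two successive strips
  of a left part together divide by one \<open>qfact q (2 * k)\<close>, and the squares account for
  the upper and the lower part. The square root records what the halves treat differently: a pair
  \<open>f\<close>, \<open>- f\<close> contributes \<open>x f - x (- f)\<close> on the right, while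
  on the left its members lie in different parts.\<close>

definition vprod :: "('b::linorder \<Rightarrow> 'a::comm_ring_1) \<Rightarrow> 'b set \<Rightarrow> 'a" where
  "vprod x S = (\<Prod>(a, b)\<in>{(a, b). a \<in> S \<and> b \<in> S \<and> a < b}. x b - x a)"

text \<open>The matrix is the power matrix times the matrix of coefficients. The latter is upper
  triangular by the degree bound, so only the coefficients \<open>coeff (p j) j\<close>
  enter.\<close>

lemma det_poly_newton:
  fixes x :: "nat \<Rightarrow> 'a::field"
  assumes "\<And>j. j < n \<Longrightarrow> degree (p j) \<le> j"
  shows "det (mat n n (\<lambda>(i, j). poly (p j) (x i)))
    = (\<Prod>j<n. coeff (p j) j) * det (mat n n (\<lambda>(i, j). x i ^ j))"
proof -
  let ?V = "mat n n (\<lambda>(i, j). x i ^ j)" and ?C = "mat n n (\<lambda>(l, j). coeff (p j) l)"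
  have "mat n n (\<lambda>(i, j). poly (p j) (x i)) = ?V * ?C"
  proof (rule eq_matI)
    fix i j assume ij: "i < dim_row (?V * ?C)" "j < dim_col (?V * ?C)"
    hence "poly (p j) (x i) = (\<Sum>l<n. coeff (p j) l * x i ^ l)"
      unfolding poly_altdef using assms[of j]
      by (intro sum.mono_neutral_left) (auto simp: coeff_eq_0)
    thus "mat n n (\<lambda>(i, j). poly (p j) (x i)) $$ (i, j) = (?V * ?C) $$ (i, j)"
      using ij by (simp add: scalar_prod_def atLeast0LessThan mult.commute)
  qed auto
  moreover have "det ?C = (\<Prod>j<n. coeff (p j) j)"
  proof -
    have "upper_triangular ?C"
    proof (rule upper_triangularI)
      fix l j assume "j < l" "l < dim_row ?C"
      moreover from this have "degree (p j) < l"
        using assms[of j] by simp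
      ultimately show "?C $$ (l, j) = 0"
        by (simp add: coeff_eq_0)
    qed
    hence "det ?C = prod_list (diag_mat ?C)"
      by (rule det_upper_triangular) auto
    thus ?thesis
      by (simp add: prod_list_diag_prod atLeast0LessThan)
  qed
  ultimately show ?thesis
    by (simp add: det_mult[of _ n])
qed

text \<open>In the monic Newton basis, the products of \<open>X - x l\<close> over
  \<open>l < j\<close>, the evaluation matrix is lower triangular with the desired diagonal, and the
  change of basis has determinant 1.\<close>

lemma det_vandermonde:
  fixes x :: "nat \<Rightarrow> 'a::field"
  shows "det (mat n n (\<lambda>(i, j). x i ^ j)) = (\<Prod>i<n. \<Prod>l<i. x i - x l)"
proof -
  define p where "p j = (\<Prod>l<j. [:- x l, 1:])" for j
  have deg: "degree (p j) = j" "coeff (p j) j = 1" for j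
  proof -
    show d: "degree (p j) = j"
      unfolding p_def by (subst degree_prod_eq_sum_degree) auto
    show "coeff (p j) j = 1"
      using lead_coeff_prod[of "\<lambda>l. [:- x l, 1:]" "{..<j}"] d by (simp add: p_def)
  qed
  let ?A = "mat n n (\<lambda>(i, j). poly (p j) (x i))"
  have "det ?A = prod_list (diag_mat ?A)"
    by (rule det_lower_triangular[of n]) (auto simp: p_def poly_prod)
  also have "\<dots> = (\<Prod>i<n. \<Prod>l<i. x i - x l)"
    by (simp add: prod_list_diag_prod atLeast0LessThan p_def poly_prod)
  finally show ?thesis
    using det_poly_newton[of n p x] deg by simp
qed

lemma strict_mono_on_less_iff:
  fixes s :: "nat \<Rightarrow> 'b::linorder"
  assumes "strict_mono_on {..<n} s" "i < n" "j < n"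
  shows "s i < s j \<longleftrightarrow> i < j"
  using assms by (metis lessThan_iff less_asym linorder_neqE_nat order_less_irrefl strict_mono_onD)

lemma vprod_image:
  fixes x :: "'b::linorder \<Rightarrow> 'a::comm_ring_1"
  assumes s: "strict_mono_on {..<n} (s :: nat \<Rightarrow> 'b)"
  shows "vprod x (s ` {..<n}) = (\<Prod>i<n. \<Prod>l<i. x (s i) - x (s l))"
proof -
  have "(\<Prod>i<n. \<Prod>l<i. x (s i) - x (s l)) = (\<Prod>(i, l)\<in>(SIGMA i:{..<n}. {..<i}). x (s i) - x (s l))"
    by (simp add: prod.Sigma)
  also have "bij_betw (\<lambda>(i, l). (s l, s i)) (SIGMA i:{..<n}. {..<i})
      {(a, b). a \<in> s ` {..<n} \<and> b \<in> s ` {..<n} \<and> a < b}"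
    unfolding bij_betw_def
  proof
    have "inj_on s {..<n}"
      using s strict_mono_on_imp_inj_on by blast
    thus "inj_on (\<lambda>(i, l). (s l, s i)) (SIGMA i:{..<n}. {..<i})"
      by (auto simp: inj_on_def)
    show "(\<lambda>(i, l). (s l, s i)) ` (SIGMA i:{..<n}. {..<i})
        = {(a, b). a \<in> s ` {..<n} \<and> b \<in> s ` {..<n} \<and> a < b}"
    proof (intro equalityI subsetI)
      fix ab assume "ab \<in> {(a, b). a \<in> s ` {..<n} \<and> b \<in> s ` {..<n} \<and> a < b}"
      then obtain i l where "ab = (s l, s i)" "i < n" "l < n" "s l < s i"
        by auto
      moreover from this have "l < i"
        using strict_mono_on_less_iff[OF s] by blast
      ultimately show "ab \<in> (\<lambda>(i, l). (s l, s i)) ` (SIGMA i:{..<n}. {..<i})"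
        by force
    qed (use strict_mono_on_less_iff[OF s] in auto)
  qed
  from prod.reindex_bij_betw[OF this, of "\<lambda>(a, b). x b - x a"]
  have "(\<Prod>(i, l)\<in>(SIGMA i:{..<n}. {..<i}). x (s i) - x (s l)) = vprod x (s ` {..<n})"
    unfolding vprod_def by (simp add: case_prod_unfold)
  finally show ?thesis ..
qed

lemma ex_strict_mono_enum:
  fixes S :: "'b::linorder set"
  assumes "finite S"
  obtains s where "strict_mono_on {..<card S} (s :: nat \<Rightarrow> 'b)" "s ` {..<card S} = S"
proof
  show "strict_mono_on {..<card S} (nth (sorted_list_of_set S))"
    by (auto intro!: strict_mono_onI sorted_wrt_nth_less[OF strict_sorted_list_of_set]
        simp: sorted_list_of_set.length_sorted_key_list_of_set)
  show "nth (sorted_list_of_set S) ` {..<card S} = S"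
    using assms by (metis sorted_list_of_set.length_sorted_key_list_of_set
        atLeast_upt list.set_map map_nth set_sorted_list_of_set)
qed

text \<open>Counting the elements up to \<open>y\<close> and enumerating them in increasing order
  are inverse to each other. This moves between \<open>interlaces\<close>, which speaks of counts,
  and the row indices of a determinant.\<close>

lemma card_enum_le:
  fixes s :: "nat \<Rightarrow> 'b::linorder"
  assumes s: "strict_mono_on {..<n} s" and "i < n"
  shows "i < card {a \<in> s ` {..<n}. a \<le> y} \<longleftrightarrow> s i \<le> y"
proof -
  have "inj_on s {j. j < n \<and> s j \<le> y}"
    by (rule inj_on_subset[OF strict_mono_on_imp_inj_on[OF s]]) auto
  moreover have "{a \<in> s ` {..<n}. a \<le> y} = s ` {j. j < n \<and> s j \<le> y}"
    by auto
  ultimately have c: "card {a \<in> s ` {..<n}. a \<le> y} = card {j. j < n \<and> s j \<le> y}"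
    by (simp add: card_image)
  show ?thesis
  proof
    assume "s i \<le> y"
    hence "{..i} \<subseteq> {j. j < n \<and> s j \<le> y}"
      using \<open>i < n\<close> strict_mono_on_less_iff[OF s]
      by (auto intro: order.trans[OF strict_mono_on_leD[OF s]])
    from card_mono[OF _ this] show "i < card {a \<in> s ` {..<n}. a \<le> y}"
      by (simp add: c)
  next
    assume less: "i < card {a \<in> s ` {..<n}. a \<le> y}"
    show "s i \<le> y"
    proof (rule ccontr)
      assume "\<not> s i \<le> y"
      hence "{j. j < n \<and> s j \<le> y} \<subseteq> {..<i}"
        using \<open>i < n\<close> strict_mono_on_leD[OF s, of i]
        by (auto simp: not_le) (metis linorder_not_le order.trans)
      from card_mono[OF _ this] show False
        using less by (simp add: c)
    qed
  qed
qed

text \<open>Counting functions are used because a tiling of a strip is governed by a difference of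
  counts. For disjoint finite sets this is strict alternation, beginning and ending in
  \<open>T\<close>. An infinite set has \<open>card\<close> 0, so sums over \<open>S\<close> ask for
  \<open>finite S\<close> separately.\<close>

definition interlaces :: "int set \<Rightarrow> int set \<Rightarrow> bool" where
  "interlaces S T \<longleftrightarrow> card T = Suc (card S) \<and>
    (\<forall>y. card {s \<in> S. s \<le> y} \<le> card {t \<in> T. t \<le> y} \<and>
         card {t \<in> T. t \<le> y} \<le> Suc (card {s \<in> S. s \<le> y}))"

text \<open>Comparing the counts at the points \<open>s i\<close> and \<open>t (Suc i)\<close>
  themselves yields weak inequalities, and disjointness makes them strict. For the converse, the
  last element counted at \<open>y\<close> is compared with its neighbour in the other set.\<close>

lemma interlaces_enum:
  fixes s t :: "nat \<Rightarrow> int"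
  assumes s: "strict_mono_on {..<k} s" and t: "strict_mono_on {..<Suc k} t"
    and disj: "s ` {..<k} \<inter> t ` {..<Suc k} = {}"
  shows "interlaces (s ` {..<k}) (t ` {..<Suc k}) \<longleftrightarrow> (\<forall>i<k. t i < s i \<and> s i < t (Suc i))"
proof -
  let ?S = "s ` {..<k}" and ?T = "t ` {..<Suc k}"
  let ?a = "\<lambda>y. card {a \<in> ?S. a \<le> y}" and ?b = "\<lambda>y. card {a \<in> ?T. a \<le> y}"
  have cS: "card ?S = k" and cT: "card ?T = Suc k"
    using strict_mono_on_imp_inj_on[OF s] strict_mono_on_imp_inj_on[OF t] card_image by fastforce+
  have aS: "?a y \<le> k" for y
    using card_mono[of ?S "{a \<in> ?S. a \<le> y}"] cS by auto
  have bT: "?b y \<le> Suc k" for y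
    using card_mono[of ?T "{a \<in> ?T. a \<le> y}"] cT by auto
  have ne: "s i \<noteq> t j" if "i < k" "j < Suc k" for i j
    using disj that by blast
  show ?thesis
  proof
    assume "interlaces ?S ?T"
    hence *: "?a y \<le> ?b y" "?b y \<le> Suc (?a y)" for y
      unfolding interlaces_def by blast+
    show "\<forall>i<k. t i < s i \<and> s i < t (Suc i)"
    proof (intro allI impI conjI)
      fix i assume i: "i < k"
      have "i < ?a (s i)"
        using card_enum_le[OF s i] by blast
      hence "i < ?b (s i)"
        using *(1)[of "s i"] by linarith
      hence "t i \<le> s i"
        using card_enum_le[OF t] i by (meson less_SucI)
      thus "t i < s i"
        using ne[of i i] i by linarith
      have "Suc i < ?b (t (Suc i))"
        using card_enum_le[OF t, of "Suc i"] i by blast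
      hence "i < ?a (t (Suc i))"
        using *(2)[of "t (Suc i)"] by linarith
      hence "s i \<le> t (Suc i)"
        using card_enum_le[OF s i] by blast
      thus "s i < t (Suc i)"
        using ne[of i "Suc i"] i by linarith
    qed
  next
    assume *: "\<forall>i<k. t i < s i \<and> s i < t (Suc i)"
    have "?a y \<le> ?b y" for y
    proof (cases "?a y")
      case (Suc i)
      hence i: "i < k"
        using aS[of y] by linarith
      hence "s i \<le> y"
        using card_enum_le[OF s i] Suc by (metis lessI)
      hence "t i \<le> y"
        using * i by fastforce
      hence "i < ?b y"
        using card_enum_le[OF t, of i] i by simp
      thus ?thesis
        using Suc by linarith
    qed linarith
    moreover have "?b y \<le> Suc (?a y)" for y
    proof (cases "?b y \<le> 1")
      case False
      \<comment> \<open>\<open>t (Suc i)\<close> is the last element of \<open>t\<close> counted at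
        \<open>y\<close>; the elements \<open>s 0\<close> up to \<open>s i\<close> lie below
        it.\<close>
      define i where "i = ?b y - 2"
      have i: "?b y = Suc (Suc i)"
        using False unfolding i_def by linarith
      have ik: "i < k"
        using bT[of y] i by linarith
      hence "t (Suc i) \<le> y"
        using card_enum_le[OF t, of "Suc i"] i by (metis Suc_less_eq lessI)
      hence "s i \<le> y"
        using * ik by fastforce
      hence "i < ?a y"
        using card_enum_le[OF s, of i] ik by simp
      thus ?thesis
        using i by linarith
    qed linarith
    ultimately show "interlaces ?S ?T"
      unfolding interlaces_def using cS cT by simp
  qed
qed

text \<open>Row \<open>i\<close> involves only the variable \<open>s i\<close>. In the Leibniz
  expansion each permutation thus contributes a sum over independent choices, which factors, and
  collecting the permutations again puts the summation inside the rows.\<close>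

lemma sum_PiE_det:
  fixes f :: "nat \<Rightarrow> 'b \<Rightarrow> 'a::comm_ring_1"
  assumes "\<And>i. i < k \<Longrightarrow> finite (I i)"
  shows "(\<Sum>s\<in>PiE {..<k} I. (\<Prod>i<k. w (s i)) * det (mat k k (\<lambda>(i, j). f j (s i))))
    = det (mat k k (\<lambda>(i, j). \<Sum>a\<in>I i. w a * f j a))"
proof -
  have "(\<Sum>s\<in>PiE {..<k} I. (\<Prod>i<k. w (s i)) * det (mat k k (\<lambda>(i, j). f j (s i))))
    = (\<Sum>s\<in>PiE {..<k} I. \<Sum>p | p permutes {0..<k}.
        signof p * (\<Prod>i<k. w (s i) * f (p i) (s i)))"
    by (subst det_def'[of _ k], simp, simp add: sum_distrib_left atLeast0LessThan prod.distrib,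
        intro sum.cong refl) (auto simp: mult_ac permutes_in_image intro!: prod.cong)
  also have "\<dots> = (\<Sum>p | p permutes {0..<k}. signof p *
      (\<Sum>s\<in>PiE {..<k} I. \<Prod>i<k. w (s i) * f (p i) (s i)))"
    by (subst sum.swap) (simp add: sum_distrib_left)
  also have "\<dots> = (\<Sum>p | p permutes {0..<k}. signof p * (\<Prod>i<k. \<Sum>a\<in>I i. w a * f (p i) a))"
    using assms by (subst prod_sum_PiE) auto
  also have "\<dots> = det (mat k k (\<lambda>(i, j). \<Sum>a\<in>I i. w a * f j a))"
    unfolding det_def'[OF mat_carrier]
    by (intro sum.cong refl) (auto simp: permutes_in_image atLeast0LessThan intro!: prod.cong)
  finally show ?thesis .
qed

lemma mat_delete_0_0:
  "mat_delete (mat (Suc k) (Suc k) a) 0 0 = mat k k (\<lambda>(i, j). a (Suc i, Suc j))"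
  unfolding mat_delete_def by (rule eq_matI) auto

lemma det_first_row_unit:
  fixes a :: "nat \<Rightarrow> nat \<Rightarrow> 'a::comm_ring_1"
  assumes "a 0 0 = 1" "\<And>j. 0 < j \<Longrightarrow> j \<le> k \<Longrightarrow> a 0 j = 0"
  shows "det (mat (Suc k) (Suc k) (\<lambda>(i, j). a i j)) = det (mat k k (\<lambda>(i, j). a (Suc i) (Suc j)))"
proof -
  let ?A = "mat (Suc k) (Suc k) (\<lambda>(i, j). a i j)"
  have "det ?A = (\<Sum>j<Suc k. ?A $$ (0, j) * cofactor ?A 0 j)"
    by (rule laplace_expansion_row) auto
  also have "\<dots> = (\<Sum>j\<in>{0}. ?A $$ (0, j) * cofactor ?A 0 j)"
    using assms by (intro sum.mono_neutral_right) auto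
  finally show ?thesis
    using assms by (simp add: cofactor_def mat_delete_0_0)
qed

lemma det_first_column_unit:
  fixes a :: "nat \<Rightarrow> nat \<Rightarrow> 'a::comm_ring_1"
  assumes "a 0 0 = 1" "\<And>i. 0 < i \<Longrightarrow> i \<le> k \<Longrightarrow> a i 0 = 0"
  shows "det (mat (Suc k) (Suc k) (\<lambda>(i, j). a i j)) = det (mat k k (\<lambda>(i, j). a (Suc i) (Suc j)))"
proof -
  let ?A = "mat (Suc k) (Suc k) (\<lambda>(i, j). a i j)"
  have "det ?A = (\<Sum>i<Suc k. ?A $$ (i, 0) * cofactor ?A i 0)"
    by (rule laplace_expansion_column) auto
  also have "\<dots> = (\<Sum>i\<in>{0}. ?A $$ (i, 0) * cofactor ?A i 0)"
    using assms by (intro sum.mono_neutral_right) auto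
  finally show ?thesis
    using assms by (simp add: cofactor_def mat_delete_0_0)
qed

text \<open>Prepending a column of ones makes up for the lost row.\<close>

lemma det_row_differences:
  fixes a :: "nat \<Rightarrow> nat \<Rightarrow> 'a::comm_ring_1"
  assumes "\<And>i. i \<le> k \<Longrightarrow> a i 0 = 1"
  shows "det (mat k k (\<lambda>(i, j). a (Suc i) (Suc j) - a i (Suc j)))
    = det (mat (Suc k) (Suc k) (\<lambda>(i, j). a i j))"
proof -
  let ?A = "mat (Suc k) (Suc k) (\<lambda>(i, j). a i j)"
  \<comment> \<open>Left multiplication by this unipotent bidiagonal matrix subtracts from each row
    the preceding one and keeps row 0.\<close>
  let ?L = "mat (Suc k) (Suc k) (\<lambda>(i, l). if l = i then 1 else if Suc l = i then - 1 else 0 :: 'a)"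
  define b where "b i j = (case i of 0 \<Rightarrow> a 0 j | Suc i' \<Rightarrow> a (Suc i') j - a i' j)" for i j
  have "?L * ?A = mat (Suc k) (Suc k) (\<lambda>(i, j). b i j)"
  proof (rule eq_matI)
    fix i j assume "i < dim_row (mat (Suc k) (Suc k) (\<lambda>(i, j). b i j))"
      "j < dim_col (mat (Suc k) (Suc k) (\<lambda>(i, j). b i j))"
    hence ij: "i < Suc k" "j < Suc k"
      by auto
    have "(?L * ?A) $$ (i, j) = (\<Sum>l<Suc k. (if l = i then 1 else if Suc l = i then - 1 else 0) * a l j)"
      using ij by (simp add: scalar_prod_def atLeast0LessThan del: sum.lessThan_Suc)
    also have "\<dots> = (\<Sum>l<Suc k. (if l = i then a l j else 0) + (if Suc l = i then - a l j else 0))"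
      by (intro sum.cong) auto
    also have "\<dots> = a i j + (\<Sum>l<Suc k. if Suc l = i then - a l j else 0)"
      using ij by (simp add: sum.distrib del: sum.lessThan_Suc)
    also have "\<dots> = b i j"
      using ij by (cases i) (simp_all add: b_def del: sum.lessThan_Suc)
    finally show "(?L * ?A) $$ (i, j) = mat (Suc k) (Suc k) (\<lambda>(i, j). b i j) $$ (i, j)"
      using ij by simp
  qed auto
  moreover have "det ?L = 1"
    by (subst det_lower_triangular[of "Suc k"]) (auto simp: prod_list_diag_prod)
  ultimately have "det ?A = det (mat (Suc k) (Suc k) (\<lambda>(i, j). b i j))"
    using det_mult[of ?L "Suc k" ?A] by simp
  also have "\<dots> = det (mat k k (\<lambda>(i, j). b (Suc i) (Suc j)))"
    using assms by (intro det_first_column_unit) (auto simp: b_def split: nat.splits)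
  finally show ?thesis
    by (simp add: b_def)
qed

lemma sum_telescope_parity:
  fixes g :: "int \<Rightarrow> 'a::ab_group_add"
  assumes "a \<le> b" "even (b - a)"
  shows "(\<Sum>s | a < s \<and> s < b \<and> odd (s - a). g (s + 1) - g (s - 1)) = g b - g a"
proof -
  have *: "(\<Sum>s | a < s \<and> s < a + 2 * int n \<and> odd (s - a). g (s + 1) - g (s - 1)) = g (a + 2 * int n) - g a" for n
  proof (induction n)
    case (Suc n)
    have fin: "finite {s. a < s \<and> s < a + 2 * int n \<and> odd (s - a)}"
      by (rule finite_subset[of _ "{a..a + 2 * int n}"]) auto
    have "{s. a < s \<and> s < a + 2 * int (Suc n) \<and> odd (s - a)}
        = insert (a + 2 * int n + 1) {s. a < s \<and> s < a + 2 * int n \<and> odd (s - a)}"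
      by (auto; presburger)
    thus ?case
      using Suc fin by (simp add: algebra_simps)
  next
    case 0
    have "{s. a < s \<and> s < a + 2 * int 0 \<and> odd (s - a)} = {}"
      by auto
    thus ?case
      by (simp only: sum.empty) simp
  qed
  define n where "n = nat ((b - a) div 2)"
  have b: "b = a + 2 * int n"
    using assms by (simp add: n_def even_two_times_div_two)
  show ?thesis
    unfolding b by (rule *)
qed

text \<open>An interlacing set is a choice of one point in each gap of \<open>t\<close>, and the
  gaps are independent. So the sum enters the rows, every entry telescopes over its gap, and the
  resulting row differences come from one larger determinant. The functions \<open>g\<close> need
  not be polynomials in \<open>x\<close>: the strip along the intrusion requires odd ones.\<close>

lemma interlacing_sum:
  fixes t :: "nat \<Rightarrow> int" and r :: int and x :: "int \<Rightarrow> 'a::field"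
  assumes t: "strict_mono_on {..<Suc k} t" and par: "\<And>i. i \<le> k \<Longrightarrow> even (t i - r)"
    and p: "\<And>j. j < k \<Longrightarrow> degree (p j) \<le> j" "\<And>j. j < k \<Longrightarrow> coeff (p j) j = 1"
    and g: "\<And>s. g 0 s = 1"
      "\<And>j s. j < k \<Longrightarrow> w s * poly (p j) (x s) = g (Suc j) (s + 1) - g (Suc j) (s - 1)"
  shows "(\<Sum>S | S \<subseteq> {s. odd (s - r)} \<and> finite S \<and> interlaces S (t ` {..<Suc k}). prod w S * vprod x S)
    = det (mat (Suc k) (Suc k) (\<lambda>(i, j). g j (t i)))"
proof -
  define I where "I i = {s. t i < s \<and> s < t (Suc i) \<and> odd (s - t i)}" for i
  have finI: "finite (I i)" for i
    by (rule finite_subset[of _ "{t i..t (Suc i)}"]) (auto simp: I_def)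
  have tmono: "t i \<le> t j" if "i \<le> j" "j \<le> k" for i j
    using strict_mono_on_leD[OF t] that by simp
  have smono: "strict_mono_on {..<k} s" if "s \<in> PiE {..<k} I" for s
  proof (rule strict_mono_onI)
    fix i j assume ij: "i \<in> {..<k}" "j \<in> {..<k}" "i < j"
    hence "s i < t (Suc i)" "t j < s j"
      using that by (auto simp: PiE_iff I_def)
    thus "s i < s j"
      using tmono[of "Suc i" j] ij by simp
  qed
  have bij: "bij_betw (\<lambda>s. s ` {..<k}) (PiE {..<k} I)
      {S. S \<subseteq> {s. odd (s - r)} \<and> finite S \<and> interlaces S (t ` {..<Suc k})}" (is "bij_betw _ _ ?X")
    unfolding bij_betw_def
  proof
    show "inj_on (\<lambda>s. s ` {..<k}) (PiE {..<k} I)"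
    proof (rule inj_onI)
      fix s s' assume s: "s \<in> PiE {..<k} I" "s' \<in> PiE {..<k} I" "s ` {..<k} = s' ` {..<k}"
      show "s = s'"
      proof (rule PiE_ext[OF s(1,2)])
        fix i assume i: "i \<in> {..<k}"
        then obtain j where j: "j < k" "s i = s' j"
          using s(3) by blast
        have "t i < s i" "s i < t (Suc i)" "t j < s' j" "s' j < t (Suc j)"
          using s(1,2) i j(1) by (auto simp: PiE_iff I_def)
        hence "i = j"
          using tmono[of "Suc i" j] tmono[of "Suc j" i] i j by (cases i j rule: linorder_cases) fastforce+
        thus "s i = s' i"
          using j by simp
      qed
    qed
    show "(\<lambda>s. s ` {..<k}) ` (PiE {..<k} I) = ?X"
    proof (intro equalityI subsetI)
      fix S assume "S \<in> (\<lambda>s. s ` {..<k}) ` (PiE {..<k} I)"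
      then obtain s where s: "s \<in> PiE {..<k} I" "S = s ` {..<k}"
        by auto
      have odd: "odd (s i - r)" if "i < k" for i
      proof -
        have "odd (s i - t i)" "even (t i - r)"
          using s that par by (auto simp: PiE_iff I_def)
        thus ?thesis by presburger
      qed
      have disj: "s ` {..<k} \<inter> t ` {..<Suc k} = {}"
        using odd par by fastforce
      have "\<forall>i<k. t i < s i \<and> s i < t (Suc i)"
        using s by (auto simp: PiE_iff I_def)
      hence "interlaces S (t ` {..<Suc k})"
        using interlaces_enum[OF smono t disj] s by blast
      thus "S \<in> ?X"
        using s odd by auto
    next
      fix S assume "S \<in> ?X"
      hence S: "S \<subseteq> {s. odd (s - r)}" "finite S" "interlaces S (t ` {..<Suc k})"
        by auto
      have "card (t ` {..<Suc k}) = Suc k"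
        using strict_mono_on_imp_inj_on[OF t] card_image by fastforce
      hence cS: "card S = k"
        using S(3) by (simp add: interlaces_def)
      obtain s where s: "strict_mono_on {..<k} s" "s ` {..<k} = S"
        using ex_strict_mono_enum[OF S(2)] cS by metis
      have odd: "odd (s i - r)" if "i < k" for i
        using s(2) S(1) that by auto
      have disj: "s ` {..<k} \<inter> t ` {..<Suc k} = {}"
        using odd par by fastforce
      have *: "t i < s i \<and> s i < t (Suc i)" if "i < k" for i
        using interlaces_enum[OF s(1) t disj] S(3) s(2) that by blast
      have "odd (s i - t i)" if "i < k" for i
        using odd[OF that] par[of i] that by presburger
      hence "restrict s {..<k} \<in> PiE {..<k} I"
        using * by (auto simp: I_def)
      moreover have "S = restrict s {..<k} ` {..<k}"
        using s(2) by auto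
      ultimately show "S \<in> (\<lambda>s. s ` {..<k}) ` (PiE {..<k} I)"
        by blast
    qed
  qed
  have "(\<Sum>S\<in>?X. prod w S * vprod x S)
      = (\<Sum>s\<in>PiE {..<k} I. prod w (s ` {..<k}) * vprod x (s ` {..<k}))"
    by (rule sum.reindex_bij_betw[OF bij, symmetric])
  also have "\<dots> = (\<Sum>s\<in>PiE {..<k} I. (\<Prod>i<k. w (s i)) * det (mat k k (\<lambda>(i, j). poly (p j) (x (s i)))))"
  proof (intro sum.cong refl)
    fix s assume s: "s \<in> PiE {..<k} I"
    have "det (mat k k (\<lambda>(i, j). poly (p j) (x (s i)))) = vprod x (s ` {..<k})"
      using p by (simp add: det_poly_newton det_vandermonde vprod_image[OF smono[OF s]])
    moreover have "prod w (s ` {..<k}) = (\<Prod>i<k. w (s i))"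
      using strict_mono_on_imp_inj_on[OF smono[OF s]] by (simp add: prod.reindex)
    ultimately show "prod w (s ` {..<k}) * vprod x (s ` {..<k})
        = (\<Prod>i<k. w (s i)) * det (mat k k (\<lambda>(i, j). poly (p j) (x (s i))))"
      by simp
  qed
  also have "\<dots> = det (mat k k (\<lambda>(i, j). \<Sum>a\<in>I i. w a * poly (p j) (x a)))"
    using finI by (intro sum_PiE_det)
  also have "mat k k (\<lambda>(i, j). \<Sum>a\<in>I i. w a * poly (p j) (x a))
      = mat k k (\<lambda>(i, j). g (Suc j) (t (Suc i)) - g (Suc j) (t i))"
  proof (rule eq_matI)
    fix i j assume "i < dim_row (mat k k (\<lambda>(i, j). g (Suc j) (t (Suc i)) - g (Suc j) (t i)))"
      "j < dim_col (mat k k (\<lambda>(i, j). g (Suc j) (t (Suc i)) - g (Suc j) (t i)))"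
    hence ij: "i < k" "j < k"
      by auto
    have "(\<Sum>a\<in>I i. w a * poly (p j) (x a)) = (\<Sum>a\<in>I i. g (Suc j) (a + 1) - g (Suc j) (a - 1))"
      using g(2)[OF ij(2)] by simp
    also have "even (t (Suc i) - t i)"
      using par[of i] par[of "Suc i"] ij by (metis diff_diff_eq2 diff_add_cancel dvd_diff less_imp_le_nat Suc_leI)
    hence "(\<Sum>a\<in>I i. g (Suc j) (a + 1) - g (Suc j) (a - 1)) = g (Suc j) (t (Suc i)) - g (Suc j) (t i)"
      unfolding I_def using tmono[of i "Suc i"] ij by (intro sum_telescope_parity) auto
    finally show "mat k k (\<lambda>(i, j). \<Sum>a\<in>I i. w a * poly (p j) (x a)) $$ (i, j)
        = mat k k (\<lambda>(i, j). g (Suc j) (t (Suc i)) - g (Suc j) (t i)) $$ (i, j)"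
      using ij by simp
  qed auto
  also have "det \<dots> = det (mat (Suc k) (Suc k) (\<lambda>(i, j). g j (t i)))"
    using det_row_differences[of k "\<lambda>i j. g j (t i)"] g(1) by simp
  finally show ?thesis .
qed

section \<open>Telescoping polynomials in Laurent coordinates\<close>

hide_const (open) Module.smult

text \<open>
  The functions \<open>\<alpha> u\<^sup>j + \<beta> v\<^sup>j\<close> satisfy \<open>E\<^bsub>j+2\<^esub> = (u + v) E\<^bsub>j+1\<^esub> - u v E\<^bsub>j\<^esub>\<close>. The set \<open>D\<close> excludes
  points at which the denominators of \<open>\<alpha>\<close> and \<open>\<beta>\<close> vanish.
\<close>

lemma poly_of_linear_recurrence:
  fixes x :: "'b \<Rightarrow> 'a::field"
  assumes uv: "\<And>s. s \<in> D \<Longrightarrow> u s + v s = a * x s" "\<And>s. s \<in> D \<Longrightarrow> u s * v s = e"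
    and E0: "\<And>s. s \<in> D \<Longrightarrow> \<alpha> s + \<beta> s = c"
    and E1: "\<And>s. s \<in> D \<Longrightarrow> \<alpha> s * u s + \<beta> s * v s = a * x s + b"
  obtains p where "\<And>j. degree (p j) \<le> j" "coeff (p 0) 0 = c" "\<And>j. 0 < j \<Longrightarrow> coeff (p j) j = a ^ j"
    "\<And>j s. s \<in> D \<Longrightarrow> poly (p j) (x s) = \<alpha> s * u s ^ j + \<beta> s * v s ^ j"
proof -
  \<comment> \<open>Index 0 is separate: for \<open>\<alpha> = \<beta> = 1\<close> the polynomial is
    the constant 2, whereas \<open>a ^ 0\<close> is 1. From index 1 on, each step multiplies the
    leading coefficient by \<open>a\<close>.\<close>
  let ?P = "\<lambda>j p. degree p \<le> j \<and> coeff p j = (if j = 0 then c else a ^ j) \<and>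
    (\<forall>s\<in>D. poly p (x s) = \<alpha> s * u s ^ j + \<beta> s * v s ^ j)"
  have "(\<exists>p. ?P j p) \<and> (\<exists>p. ?P (Suc j) p)" for j
  proof (induction j)
    case 0
    have "?P 0 [:c:]"
      using E0 by simp
    moreover have "?P (Suc 0) [:b, a:]"
      using E1 by (auto simp: degree_pCons_le algebra_simps)
    ultimately show ?case by blast
  next
    case (Suc j)
    then obtain p p' where p: "?P j p" "?P (Suc j) p'" by blast
    let ?p = "smult a (pCons 0 p') - smult e p"
    have "degree ?p \<le> Suc (Suc j)"
      using p by (intro degree_diff_le order.trans[OF degree_smult_le])
        (auto intro: order.trans[OF degree_pCons_le])
    moreover have "coeff ?p (Suc (Suc j)) = a ^ Suc (Suc j)"
      using p by (simp add: coeff_eq_0)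
    moreover have "poly ?p (x s) = \<alpha> s * u s ^ Suc (Suc j) + \<beta> s * v s ^ Suc (Suc j)" if "s \<in> D" for s
    proof -
      have "poly ?p (x s) = (a * x s) * (\<alpha> s * u s ^ Suc j + \<beta> s * v s ^ Suc j)
          - e * (\<alpha> s * u s ^ j + \<beta> s * v s ^ j)"
        using p that by simp
      also have "\<dots> = \<alpha> s * u s ^ Suc (Suc j) + \<beta> s * v s ^ Suc (Suc j)"
        unfolding uv(1)[OF that, symmetric] uv(2)[OF that, symmetric] by (simp add: algebra_simps)
      finally show ?thesis .
    qed
    ultimately have "?P (Suc (Suc j)) ?p" by simp
    with p show ?case by blast
  qed
  hence "\<forall>j. \<exists>p. ?P j p" by blast
  then obtain p where p: "\<And>j. ?P j (p j)" by metis
  show thesis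
    by (rule that[of p]) (use p[of 0] p in auto)
qed

text \<open>If the telescoping functions are polynomials in \<open>x\<close> of one degree more,
  then together with the constant 1 they form a basis of the kind required by
  \<open>det_poly_newton\<close>. The Vandermonde shape is reproduced and only leading coefficients
  survive.\<close>

lemma interlacing_poly_sum:
  fixes x :: "int \<Rightarrow> 'a::field"
  assumes "finite T" "card T = Suc k" "\<And>t. t \<in> T \<Longrightarrow> even (t - r)"
    and p: "\<And>j. j < k \<Longrightarrow> degree (p j) \<le> j" "\<And>j. j < k \<Longrightarrow> coeff (p j) j = 1"
    and P: "\<And>j. j < k \<Longrightarrow> degree (P j) \<le> Suc j"
    and step: "\<And>j s. j < k \<Longrightarrow> w s * poly (p j) (x s) = poly (P j) (x (s + 1)) - poly (P j) (x (s - 1))"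
  shows "(\<Sum>S | S \<subseteq> {s. odd (s - r)} \<and> finite S \<and> interlaces S T. prod w S * vprod x S)
    = (\<Prod>j<k. coeff (P j) (Suc j)) * vprod x T"
proof -
  obtain t where t: "strict_mono_on {..<Suc k} t" "t ` {..<Suc k} = T"
    using ex_strict_mono_enum[OF assms(1)] assms(2) by metis
  define P' where "P' j = (case j of 0 \<Rightarrow> 1 | Suc j \<Rightarrow> P j)" for j
  have "(\<Sum>S | S \<subseteq> {s. odd (s - r)} \<and> finite S \<and> interlaces S (t ` {..<Suc k}). prod w S * vprod x S)
      = det (mat (Suc k) (Suc k) (\<lambda>(i, j). poly (P' j) (x (t i))))"
    using assms(3) t p step by (intro interlacing_sum[where p = p]) (auto simp: P'_def)
  also have "\<dots> = (\<Prod>j<Suc k. coeff (P' j) j) * det (mat (Suc k) (Suc k) (\<lambda>(i, j). x (t i) ^ j))"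
    using P by (intro det_poly_newton) (auto simp: P'_def split: nat.splits)
  also have "\<dots> = (\<Prod>j<k. coeff (P j) (Suc j)) * vprod x T"
    using vprod_image[OF t(1), of x] t(2)
    by (simp add: det_vandermonde prod.lessThan_Suc_shift P'_def del: prod.lessThan_Suc)
  finally show ?thesis
    by (simp add: t)
qed

lemma qnum_of_nat:
  "qnum q (int j) = (q ^ j - inverse q ^ j) / (q - inverse q)"
  by (simp add: qnum_def power_int_minus power_inverse)

section \<open>Positivity for \<open>1 < q\<close>, and the summation steps for the three kinds of
  strips\<close>

context
  fixes q :: "'a::linordered_field"
  assumes q: "1 < q"
begin

lemma q_pos: "0 < q"
  using q by linarith

lemma q_neq_0 [simp]: "q \<noteq> 0"
  using q by auto

lemma q_minus_inverse_pos: "0 < q - inverse q"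
  using q one_less_inverse_iff[of "inverse q"] inverse_less_1_iff[of q] by simp

lemma qnum_pos: "0 < n \<Longrightarrow> 0 < qnum q n"
proof -
  assume "0 < n"
  hence "1 < q powi n"
    using q by (cases n) (auto simp: one_less_power)
  moreover from this have "q powi (- n) < 1"
    using q_pos by (simp add: power_int_minus inverse_less_1_iff)
  ultimately show ?thesis
    unfolding qnum_def using q_minus_inverse_pos by (simp add: power_int_minus divide_pos_pos)
qed

lemma qnum_minus: "qnum q (- n) = - qnum q n"
  by (simp add: qnum_def minus_divide_left)

lemma qnum_eq_0_iff [simp]: "qnum q n = 0 \<longleftrightarrow> n = 0"
  using qnum_pos[of n] qnum_pos[of "- n"] by (cases n "0 :: int" rule: linorder_cases)
    (auto simp: qnum_minus qnum_def)

lemma powi_minus_mult [simp]: "q powi (- s) * q powi s = 1" "q powi s * q powi (- s) = 1"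
  by (simp_all flip: power_int_add)

text \<open>
  Below, \<open>z = q\<^sup>s\<close>. Here the weight is proportional to \<open>z + z\<^sup>-\<^sup>1\<close>, and multiplying by it turns
  \<open>(z\<^bsup>j+1\<^esup> - (- z)\<^bsup>-(j+1)\<^esup>) / (z + z\<^sup>-\<^sup>1)\<close> into a difference of values of \<open>z\<^bsup>j+1\<^esup> + (- z)\<^bsup>-(j+1)\<^esup>\<close>; both are
  polynomials in \<open>z - z\<^sup>-\<^sup>1\<close>.
\<close>

lemma trapezoid_step:
  assumes T: "finite T" "card T = Suc k" "\<And>t. t \<in> T \<Longrightarrow> even (t - r)"
  shows "(\<Sum>S | S \<subseteq> {s. odd (s - r)} \<and> finite S \<and> interlaces S T.
      prod (qplus q) S * vprod (\<lambda>y. qnum q y / 2) S)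
    = vprod (\<lambda>y. qnum q y / 2) T / qfact q k"
proof -
  define d where "d = q - inverse q"
  have d: "d \<noteq> 0"
    using q_minus_inverse_pos by (simp add: d_def)
  define z where "z s = q powi s" for s
  define zi where "zi s = q powi (- s)" for s
  have zz: "z s * zi s = 1" "zi s * z s = 1" for s
    by (simp_all add: z_def zi_def)
  have z_pos: "0 < z s" "0 < zi s" for s
    using q_pos by (simp_all add: z_def zi_def zero_less_power_int)
  have z_plus: "z s + zi s \<noteq> 0" for s
    using z_pos[of s] by linarith
  define x where "x y = qnum q y / 2" for y
  have x: "2 * d * x s = z s - zi s" for s
  proof -
    have "qnum q s = (z s - zi s) / d"
      by (simp add: qnum_def d_def z_def zi_def)
    thus ?thesis
      using d by (simp add: x_def)
  qed
  \<comment> \<open>The sign in \<open>- zi s\<close> makes the sum of the two roots the odd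
    function \<open>2 * d * x s\<close>; their product is - 1.\<close>
  have u: "z s + - zi s = 2 * d * x s" "z s * - zi s = - 1" for s
    by (simp_all add: x zz)
  have U0: "z s / (z s + zi s) + zi s / (z s + zi s) = 1" for s
    using z_plus[of s] by (simp flip: add_divide_distrib)
  have U1: "z s / (z s + zi s) * z s + zi s / (z s + zi s) * - zi s = 2 * d * x s + 0" for s
  proof -
    have "z s / (z s + zi s) * z s + zi s / (z s + zi s) * - zi s
        = (z s - zi s) * (z s + zi s) / (z s + zi s)"
      by (simp add: diff_divide_distrib algebra_simps)
    thus ?thesis
      using z_plus[of s] by (simp add: x)
  qed
  obtain U where U: "\<And>j. degree (U j) \<le> j" "coeff (U 0) 0 = 1" "\<And>j. 0 < j \<Longrightarrow> coeff (U j) j = (2 * d) ^ j"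
    "\<And>j s. poly (U j) (x s) = z s / (z s + zi s) * z s ^ j + zi s / (z s + zi s) * (- zi s) ^ j"
    apply (rule poly_of_linear_recurrence[where D = UNIV and x = x and u = z, OF u U0 U1])
    subgoal for p by (rule that[of p]) simp_all
    done
  have UU: "coeff (U j) j = (2 * d) ^ j" for j
    using U(2,3) by (cases j) auto
  obtain D where D: "\<And>j. degree (D j) \<le> j" "\<And>j. 0 < j \<Longrightarrow> coeff (D j) j = (2 * d) ^ j"
    "\<And>j s. poly (D j) (x s) = 1 * z s ^ j + 1 * (- zi s) ^ j"
    apply (rule poly_of_linear_recurrence[where D = UNIV and x = x and u = z and \<alpha> = "\<lambda>_. 1" and \<beta> = "\<lambda>_. 1" and b = 0, OF u refl])
    using u apply simp
    subgoal for p by (rule that[of p]) simp_all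
    done
  define n where "n j = qnum q (int (Suc j))" for j
  have n: "n j \<noteq> 0" for j
    by (simp add: n_def del: of_nat_Suc)
  have dn: "d * n j = q ^ Suc j - inverse q ^ Suc j" for j
    unfolding n_def qnum_of_nat using d by (simp add: d_def del: power_Suc)
  have "(\<Sum>S | S \<subseteq> {s. odd (s - r)} \<and> finite S \<and> interlaces S T. prod (qplus q) S * vprod x S)
    = (\<Prod>j<k. coeff (smult (inverse (n j * (2 * d) ^ Suc j)) (D (Suc j))) (Suc j)) * vprod x T"
  proof (rule interlacing_poly_sum[where p = "\<lambda>j. smult (inverse ((2 * d) ^ j)) (U j)"])
    fix j :: nat and s :: int
    have "(z s + zi s) * (poly (U j) (x s)) = z s ^ Suc j - (- zi s) ^ Suc j"
      using z_plus[of s] by (simp add: U(4) distrib_left)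
    moreover have "2 * qplus q s = z s + zi s"
      by (simp add: qplus_def z_def zi_def)
    ultimately have 1: "2 * qplus q s * poly (U j) (x s) = z s ^ Suc j - (- zi s) ^ Suc j"
      by simp
    \<comment> \<open>Shifting \<open>s\<close> by 1 multiplies \<open>z\<close> by \<open>q\<close>
      and \<open>zi\<close> by \<open>inverse q\<close>. The four terms therefore factor into a
      constant, which is \<open>d * n j\<close>, and the power difference produced by the
      weight.\<close>
    have "poly (D (Suc j)) (x (s + 1)) - poly (D (Suc j)) (x (s - 1))
       = (z s * q) ^ Suc j + (- (zi s * inverse q)) ^ Suc j - ((z s * inverse q) ^ Suc j + (- (zi s * q)) ^ Suc j)"
      unfolding D(3) z_def zi_def
      by (simp add: power_int_add power_int_diff power_int_minus divide_inverse power_int_inverse mult.commute del: power_Suc)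
    also have "\<dots> = (q ^ Suc j - inverse q ^ Suc j) * (z s ^ Suc j - (- zi s) ^ Suc j)"
      unfolding minus_mult_left power_mult_distrib by (simp add: algebra_simps del: power_Suc)
    also have "\<dots> = n j * (2 * d) * (qplus q s * poly (U j) (x s))"
      unfolding 1[symmetric] dn[symmetric] by simp
    finally have 2: "poly (D (Suc j)) (x (s + 1)) - poly (D (Suc j)) (x (s - 1))
      = n j * (2 * d) * (qplus q s * poly (U j) (x s))" .
    show "qplus q s * poly (smult (inverse ((2 * d) ^ j)) (U j)) (x s)
      = poly (smult (inverse (n j * (2 * d) ^ Suc j)) (D (Suc j))) (x (s + 1))
        - poly (smult (inverse (n j * (2 * d) ^ Suc j)) (D (Suc j))) (x (s - 1))"
      using n[of j] d unfolding poly_smult right_diff_distrib[symmetric] 2 by (simp add: field_simps)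
  next
    fix j
    show "coeff (smult (inverse ((2 * d) ^ j)) (U j)) j = 1"
      unfolding coeff_smult UU using d by (intro left_inverse) simp
  qed (use T U UU D d in \<open>auto simp del: power_Suc intro: order.trans[OF degree_smult_le]\<close>)
  also have "(\<Prod>j<k. coeff (smult (inverse (n j * (2 * d) ^ Suc j)) (D (Suc j))) (Suc j)) = (\<Prod>j<k. inverse (n j))"
    proof (intro prod.cong refl)
    fix j
    have *: "inverse (a * b) * b = inverse a" if "b \<noteq> 0" for a b :: 'a
      using that by simp
    show "coeff (smult (inverse (n j * (2 * d) ^ Suc j)) (D (Suc j))) (Suc j) = inverse (n j)"
      unfolding coeff_smult D(2)[OF zero_less_Suc] using d by (intro *) simp
  qed
  also have "\<dots> = inverse (qfact q k)"
    unfolding qfact_def n_def by (simp add: prod_inversef[symmetric] comp_def prod.atLeast1_atMost_eq)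
  finally show ?thesis
    by (simp add: x_def[abs_def] field_simps)
qed

lemma laurent_difference:
  "(q powi (s + 1)) ^ l = (q powi s) ^ l * q ^ l"
  "(q powi (s - 1)) ^ l = (q powi s) ^ l * inverse q ^ l"
  "(q powi (- (s + 1))) ^ l = (q powi (- s)) ^ l * inverse q ^ l"
  "(q powi (- (s - 1))) ^ l = (q powi (- s)) ^ l * q ^ l"
proof -
  have "q powi (s + 1) = q powi s * q" "q powi (s - 1) = q powi s * inverse q"
    "q powi (- (s + 1)) = q powi (- s) * inverse q" "q powi (- (s - 1)) = q powi (- s) * q"
    using power_int_add[of q s 1] power_int_add[of q s "- 1"]
      power_int_add[of q "- s" 1] power_int_add[of q "- s" "- 1"]
    by (simp_all add: power_int_minus add.commute)
  thus "(q powi (s + 1)) ^ l = (q powi s) ^ l * q ^ l"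
    "(q powi (s - 1)) ^ l = (q powi s) ^ l * inverse q ^ l"
    "(q powi (- (s + 1))) ^ l = (q powi (- s)) ^ l * inverse q ^ l"
    "(q powi (- (s - 1))) ^ l = (q powi (- s)) ^ l * q ^ l"
    by (simp_all only: power_mult_distrib)
qed

lemma powi_eq_inverse_iff: "q powi s = q powi (- s) \<longleftrightarrow> s = 0"
  using qnum_eq_0_iff[of s] q_minus_inverse_pos by (auto simp: qnum_def)

text \<open>Up to the factor \<open>(2 * (q - inverse q))\<^sup>2\<close> this is the sum of
  \<open>z ^ 2\<close> and \<open>z ^ (- 2)\<close> for \<open>z = q powi y\<close>, the two roots
  of the recurrences below. It differs from \<open>(qnum q y / 2)\<^sup>2\<close> by a constant
  only.\<close>

definition cosh_coord :: "int \<Rightarrow> 'a" where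
  "cosh_coord y = (q powi (2 * y) + q powi (- 2 * y)) / (2 * (q - inverse q))\<^sup>2"

lemma cosh_coord_eq: "(2 * (q - inverse q))\<^sup>2 * cosh_coord s = (q powi s)\<^sup>2 + (q powi (- s))\<^sup>2"
proof -
  have "q powi (2 * s) = (q powi s)\<^sup>2" "q powi (- 2 * s) = (q powi (- s))\<^sup>2"
    by (simp_all add: power2_eq_square flip: power_int_add)
  thus ?thesis
    using q_minus_inverse_pos by (simp add: cosh_coord_def)
qed

text \<open>
  The factor \<open>qnum q s\<close> is produced by the strip at the other side of the same vertical line, see
  \<open>top_even_step\<close>.
\<close>

lemma top_odd_step:
  assumes T: "finite T" "card T = Suc k" "\<And>t. t \<in> T \<Longrightarrow> even (t - r)"
  shows "(\<Sum>S | S \<subseteq> {s. odd (s - r)} \<and> finite S \<and> interlaces S T.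
      prod (\<lambda>s. qplus q s * qnum q s) S * vprod cosh_coord S)
    = (\<Prod>j<k. 2 / qnum q (int (2 * Suc j))) * vprod cosh_coord T"
proof -
  define d where "d = q - inverse q"
  have d: "d \<noteq> 0"
    using q_minus_inverse_pos by (simp add: d_def)
  define e where "e = (2 * d)\<^sup>2"
  have e: "e \<noteq> 0"
    using d by (simp add: e_def)
  define z where "z s = q powi s" for s
  define zi where "zi s = q powi (- s)" for s
  have zz: "z s * zi s = 1" for s
    by (simp_all add: z_def zi_def)
  have z2: "(z s)\<^sup>2 * (zi s)\<^sup>2 = 1" for s
    by (simp flip: power_mult_distrib add: zz)
  have x: "(z s)\<^sup>2 + (zi s)\<^sup>2 = e * cosh_coord s" for s
    unfolding z_def zi_def e_def d_def cosh_coord_eq ..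
  have z_pos: "0 < z s" "0 < zi s" for s
    using q_pos by (simp_all add: z_def zi_def zero_less_power_int)
  define D where "D s = (z s)\<^sup>2 - (zi s)\<^sup>2" for s
  have D_eq: "D s = (z s + zi s) * (z s - zi s)" for s
    by (simp add: D_def power2_eq_square algebra_simps)
  have D_ne: "D s \<noteq> 0" if "s \<in> - {0}" for s
    using that z_pos[of s] powi_eq_inverse_iff[of s] unfolding D_eq by (auto simp: z_def zi_def)
  have w: "d * (qplus q s * qnum q s) = D s / 2" for s
  proof -
    have "qnum q s = (z s - zi s) / d"
      by (simp add: qnum_def d_def z_def zi_def)
    thus ?thesis
      using d by (simp add: D_eq qplus_def z_def zi_def)
  qed
  have H0: "(z s)\<^sup>2 / D s + - (zi s)\<^sup>2 / D s = 1" if "s \<in> - {0}" for s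
    using D_ne[OF that] by (simp flip: diff_divide_distrib add: D_def)
  have H1: "(z s)\<^sup>2 / D s * (z s)\<^sup>2 + - (zi s)\<^sup>2 / D s * (zi s)\<^sup>2 = e * cosh_coord s + 0" if "s \<in> - {0}" for s
  proof -
    have "(z s)\<^sup>2 / D s * (z s)\<^sup>2 + - (zi s)\<^sup>2 / D s * (zi s)\<^sup>2 = ((z s)\<^sup>2 + (zi s)\<^sup>2) * D s / D s"
      by (simp add: D_def diff_divide_distrib algebra_simps)
    thus ?thesis
      using D_ne[OF that] by (simp add: x)
  qed
  \<comment> \<open>\<open>poly (H j)\<close> is the quotient of
    \<open>z ^ (2 * Suc j) - zi ^ (2 * Suc j)\<close> by \<open>D\<close>, up to scaling a Chebyshev
    polynomial of the second kind. The weight is proportional to \<open>D\<close> and cancels the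
    denominator.\<close>
  obtain H where H: "\<And>j. degree (H j) \<le> j" "coeff (H 0) 0 = 1" "\<And>j. 0 < j \<Longrightarrow> coeff (H j) j = e ^ j"
    "\<And>j s. s \<in> - {0} \<Longrightarrow> poly (H j) (cosh_coord s) = (z s)\<^sup>2 / D s * ((z s)\<^sup>2) ^ j + - (zi s)\<^sup>2 / D s * ((zi s)\<^sup>2) ^ j"
    apply (rule poly_of_linear_recurrence[where D = "- {0}" and x = cosh_coord and u = "\<lambda>s. (z s)\<^sup>2", OF x z2 H0 H1])
    apply assumption+
    subgoal for p by (rule that[of p]) blast+
    done
  have HH: "coeff (H j) j = e ^ j" for j
    using H(2,3) by (cases j) auto
  obtain Q where Q: "\<And>j. degree (Q j) \<le> j" "\<And>j. 0 < j \<Longrightarrow> coeff (Q j) j = e ^ j"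
    "\<And>j s. poly (Q j) (cosh_coord s) = 1 * ((z s)\<^sup>2) ^ j + 1 * ((zi s)\<^sup>2) ^ j"
    apply (rule poly_of_linear_recurrence[where D = UNIV and x = cosh_coord and u = "\<lambda>s. (z s)\<^sup>2"
          and \<alpha> = "\<lambda>_. 1" and \<beta> = "\<lambda>_. 1" and b = 0, OF x z2 refl])
    using x apply simp
    subgoal for p by (rule that[of p]) blast+
    done
  define n where "n j = qnum q (int (2 * Suc j))" for j
  have n: "n j \<noteq> 0" for j
    by (simp add: n_def del: of_nat_Suc)
  have dn: "d * n j = q ^ (2 * Suc j) - inverse q ^ (2 * Suc j)" for j
    unfolding n_def qnum_of_nat using d by (simp add: d_def del: power_Suc mult_Suc_right)
  define c where "c j = inverse (2 * d\<^sup>2 * n j * e ^ j)" for j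
  have "(\<Sum>S | S \<subseteq> {s. odd (s - r)} \<and> finite S \<and> interlaces S T.
      prod (\<lambda>s. qplus q s * qnum q s) S * vprod cosh_coord S)
    = (\<Prod>j<k. coeff (smult (c j) (Q (Suc j))) (Suc j)) * vprod cosh_coord T"
  proof (rule interlacing_poly_sum[where p = "\<lambda>j. smult (inverse (e ^ j)) (H j)"])
    fix j :: nat and s :: int
    have "D s * (poly (H j) (cosh_coord s)) = z s ^ (2 * Suc j) - zi s ^ (2 * Suc j)"
    \<comment> \<open>The excluded point does no harm: at 0 both sides vanish, the left one because
      \<open>D 0 = 0\<close>.\<close>
    proof (cases "s = 0")
      case False
      thus ?thesis
        using D_ne[of s] by (simp add: H(4) right_diff_distrib power_mult power_add power2_eq_square)
    qed (simp add: D_def z_def zi_def)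
    moreover have "2 * d * (qplus q s * qnum q s) = D s"
      using w[of s] by simp
    ultimately have 1: "2 * d * (qplus q s * qnum q s) * poly (H j) (cosh_coord s) = z s ^ (2 * Suc j) - zi s ^ (2 * Suc j)"
      by simp
    have alg: "A * B + C * D - (A * D + C * B) = (B - D) * (A - C)" for A B C D :: 'a
      by (simp add: algebra_simps)
    have "poly (Q (Suc j)) (cosh_coord (s + 1)) - poly (Q (Suc j)) (cosh_coord (s - 1))
       = (q ^ (2 * Suc j) - inverse q ^ (2 * Suc j)) * (z s ^ (2 * Suc j) - zi s ^ (2 * Suc j))"
      unfolding Q(3) z_def zi_def power_mult[symmetric] mult_1
      unfolding laurent_difference
      by (rule alg)
    also have "\<dots> = 2 * d\<^sup>2 * n j * (qplus q s * qnum q s * poly (H j) (cosh_coord s))"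
      unfolding 1[symmetric] dn[symmetric] by (simp add: power2_eq_square)
    finally have 2: "poly (Q (Suc j)) (cosh_coord (s + 1)) - poly (Q (Suc j)) (cosh_coord (s - 1))
      = 2 * d\<^sup>2 * n j * (qplus q s * qnum q s * poly (H j) (cosh_coord s))" .
    show "qplus q s * qnum q s * poly (smult (inverse (e ^ j)) (H j)) (cosh_coord s)
      = poly (smult (c j) (Q (Suc j))) (cosh_coord (s + 1)) - poly (smult (c j) (Q (Suc j))) (cosh_coord (s - 1))"
      using n[of j] d unfolding poly_smult right_diff_distrib[symmetric] 2
      by (simp add: c_def mult.left_commute[of "inverse (n j)"])
  next
    fix j
    show "coeff (smult (inverse (e ^ j)) (H j)) j = 1"
      using e by (simp add: HH)
  qed (use T H(1) Q(1) in \<open>auto intro: order.trans[OF degree_smult_le]\<close>)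
  also have "(\<Prod>j<k. coeff (smult (c j) (Q (Suc j))) (Suc j)) = (\<Prod>j<k. 2 / n j)"
  proof (intro prod.cong refl)
    fix j
    \<comment> \<open>The leading coefficient is
      \<open>c j * e ^ Suc j = e / (2 * d\<^sup>2 * n j)\<close>, which explains the numerator
      2.\<close>
    have "2 * d\<^sup>2 * 2 = e"
      by (simp add: e_def power2_eq_square)
    thus "coeff (smult (c j) (Q (Suc j))) (Suc j) = 2 / n j"
      using d n[of j] e by (simp add: Q c_def field_simps)
  qed
  finally show ?thesis
    by (simp add: n_def)
qed

lemma det_row_scale:
  fixes a :: "nat \<Rightarrow> nat \<Rightarrow> 'b::comm_ring_1"
  shows "det (mat k k (\<lambda>(i, j). r i * a i j)) = (\<Prod>i<k. r i) * det (mat k k (\<lambda>(i, j). a i j))"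
  unfolding det_def'[OF mat_carrier] sum_distrib_left
  by (intro sum.cong refl) (auto simp: permutes_in_image atLeast0LessThan prod.distrib)

text \<open>
  The boundary along the intrusion acts as an additional dent at \<open>0\<close>. The telescoping functions are
  odd, so they vanish there, which reduces the determinant by one row.
\<close>

lemma top_even_step:
  assumes S: "finite S" "card S = k" "\<And>t. t \<in> S \<Longrightarrow> 0 < t \<and> even t"
  shows "(\<Sum>X | X \<subseteq> {x. odd x} \<and> finite X \<and> interlaces X (insert 0 S).
      prod (qplus q) X * vprod cosh_coord X)
    = (\<Prod>j<k. inverse (2 * qnum q (int (2 * j + 1)))) * (\<Prod>s\<in>S. qnum q s) * vprod cosh_coord S"
proof -
  define d where "d = q - inverse q"
  have d: "d \<noteq> 0"
    using q_minus_inverse_pos by (simp add: d_def)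
  define e where "e = (2 * d)\<^sup>2"
  have e: "e \<noteq> 0"
    using d by (simp add: e_def)
  define z where "z s = q powi s" for s
  define zi where "zi s = q powi (- s)" for s
  have zz: "z s * zi s = 1" for s
    by (simp_all add: z_def zi_def)
  have z2: "(z s)\<^sup>2 * (zi s)\<^sup>2 = 1" for s
    by (simp flip: power_mult_distrib add: zz)
  have x: "(z s)\<^sup>2 + (zi s)\<^sup>2 = e * cosh_coord s" for s
    unfolding z_def zi_def e_def d_def cosh_coord_eq ..
  have z_pos: "0 < z s" "0 < zi s" for s
    using q_pos by (simp_all add: z_def zi_def zero_less_power_int)
  define D where "D s = z s - zi s" for s
  have D_ne: "D s \<noteq> 0" if "s \<in> - {0}" for s
    using that powi_eq_inverse_iff[of s] by (auto simp: D_def z_def zi_def)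
  have D_qnum: "D s = d * qnum q s" for s
    using d by (simp add: D_def qnum_def d_def z_def zi_def)
  define P where "P s = z s + zi s" for s
  have P_ne: "P s \<noteq> 0" for s
    using z_pos[of s] by (simp add: P_def add_pos_pos less_imp_neq[symmetric])
  have w: "2 * qplus q s = P s" for s
    by (simp add: qplus_def P_def z_def zi_def)
  have H0: "z s / P s + zi s / P s = 1" for s
    using P_ne[of s] by (simp flip: add_divide_distrib add: P_def)
  \<comment> \<open>Dividing \<open>z ^ 3 + zi ^ 3\<close> by \<open>z + zi\<close> leaves
    \<open>z ^ 2 + zi ^ 2 - z * zi\<close>, hence the constant - 1. For the difference of cubes in
    \<open>F1\<close> the constant is 1.\<close>
  have H1: "z s / P s * (z s)\<^sup>2 + zi s / P s * (zi s)\<^sup>2 = e * cosh_coord s + - 1" for s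
  proof -
    have "z s / P s * (z s)\<^sup>2 + zi s / P s * (zi s)\<^sup>2 = ((z s)\<^sup>2 + (zi s)\<^sup>2 + - (z s * zi s)) * P s / P s"
      by (simp add: P_def add_divide_distrib diff_divide_distrib algebra_simps power2_eq_square)
    thus ?thesis
      using P_ne[of s] by (simp add: x zz)
  qed
  obtain H where H: "\<And>j. degree (H j) \<le> j" "coeff (H 0) 0 = 1" "\<And>j. 0 < j \<Longrightarrow> coeff (H j) j = e ^ j"
    "\<And>j s. poly (H j) (cosh_coord s) = z s / P s * ((z s)\<^sup>2) ^ j + zi s / P s * ((zi s)\<^sup>2) ^ j"
    apply (rule poly_of_linear_recurrence[where D = UNIV and x = cosh_coord and u = "\<lambda>s. (z s)\<^sup>2", OF x z2 H0 H1])
    subgoal for p by (rule that[of p]) blast+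
    done
  have HH: "coeff (H j) j = e ^ j" for j
    using H(2,3) by (cases j) auto
  have F0: "z s / D s + - zi s / D s = 1" if "s \<in> - {0}" for s
    using D_ne[OF that] by (simp flip: diff_divide_distrib add: D_def)
  have F1: "z s / D s * (z s)\<^sup>2 + - zi s / D s * (zi s)\<^sup>2 = e * cosh_coord s + 1" if "s \<in> - {0}" for s
  proof -
    have "z s / D s * (z s)\<^sup>2 + - zi s / D s * (zi s)\<^sup>2 = ((z s)\<^sup>2 + (zi s)\<^sup>2 + z s * zi s) * D s / D s"
      by (simp add: D_def add_divide_distrib diff_divide_distrib algebra_simps power2_eq_square)
    thus ?thesis
      using D_ne[OF that] by (simp add: x zz)
  qed
  obtain F where F: "\<And>j. degree (F j) \<le> j" "coeff (F 0) 0 = 1" "\<And>j. 0 < j \<Longrightarrow> coeff (F j) j = e ^ j"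
    "\<And>j s. s \<in> - {0} \<Longrightarrow> poly (F j) (cosh_coord s) = z s / D s * ((z s)\<^sup>2) ^ j + - zi s / D s * ((zi s)\<^sup>2) ^ j"
    apply (rule poly_of_linear_recurrence[where D = "- {0}" and x = cosh_coord and u = "\<lambda>s. (z s)\<^sup>2", OF x z2 F0 F1])
    apply assumption+
    subgoal for p by (rule that[of p]) blast+
    done
  have FF: "coeff (F j) j = e ^ j" for j
    using F(2,3) by (cases j) auto
  have DF: "D s * poly (F j) (cosh_coord s) = z s ^ (2 * j + 1) - zi s ^ (2 * j + 1)" for s j
  proof (cases "s = 0")
    case False
    thus ?thesis
      using D_ne[of s] by (simp add: F(4) right_diff_distrib power_mult power_add)
  qed (simp add: D_def z_def zi_def)
  define n where "n j = qnum q (int (2 * j + 1))" for j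
  have n: "n j \<noteq> 0" for j
    by (simp add: n_def)
  have dn: "d * n j = q ^ (2 * j + 1) - inverse q ^ (2 * j + 1)" for j
    unfolding n_def qnum_of_nat using d by (simp add: d_def)
  define c where "c j = inverse (2 * n j * e ^ j)" for j
  \<comment> \<open>The factor \<open>qnum q s\<close> makes these functions odd in
    \<open>s\<close>. They are not polynomials in \<open>cosh_coord\<close>, which is why
    \<open>interlacing_sum\<close> is used in its general form.\<close>
  define g where "g j s = (case j of 0 \<Rightarrow> 1 | Suc j \<Rightarrow> qnum q s * poly (smult (c j) (F j)) (cosh_coord s))" for j s
  obtain s where s: "strict_mono_on {..<k} s" "s ` {..<k} = S"
    using ex_strict_mono_enum[OF S(1)] S(2) by metis
  \<comment> \<open>All elements of \<open>S\<close> are positive, so the extra dent 0 comes first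
    and occupies row 0.\<close>
  define t where "t i = (case i of 0 \<Rightarrow> 0 | Suc i \<Rightarrow> s i)" for i
  have s_pos: "0 < s i" "even (s i)" if "i < k" for i
    using S(3) s(2) that by auto
  have t: "strict_mono_on {..<Suc k} t"
    using s_pos strict_mono_onD[OF s(1)] by (intro strict_mono_onI) (auto simp: t_def split: nat.splits)
  have tS: "t ` {..<Suc k} = insert 0 S"
    unfolding lessThan_Suc_eq_insert_0 using s(2) by (auto simp: t_def image_image)
  have "(\<Sum>X | X \<subseteq> {s. odd (s - 0)} \<and> finite X \<and> interlaces X (t ` {..<Suc k}).
      prod (qplus q) X * vprod cosh_coord X) = det (mat (Suc k) (Suc k) (\<lambda>(i, j). g j (t i)))"
  proof (rule interlacing_sum[where p = "\<lambda>j. smult (inverse (e ^ j)) (H j)"])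
    fix j :: nat and s :: int
    have "P s * (poly (H j) (cosh_coord s)) = z s ^ (2 * j + 1) + zi s ^ (2 * j + 1)"
      using P_ne[of s] by (simp add: H(4) distrib_left power_mult power_add)
    hence 1: "2 * qplus q s * poly (H j) (cosh_coord s) = z s ^ (2 * j + 1) + zi s ^ (2 * j + 1)"
      unfolding w .
    have "D (s + 1) * poly (F j) (cosh_coord (s + 1)) - D (s - 1) * poly (F j) (cosh_coord (s - 1))
       = (q ^ (2 * j + 1) - inverse q ^ (2 * j + 1)) * (z s ^ (2 * j + 1) + zi s ^ (2 * j + 1))"
      unfolding DF z_def zi_def laurent_difference by (simp add: algebra_simps)
    also have "\<dots> = d * (2 * n j * (qplus q s * poly (H j) (cosh_coord s)))"
      unfolding 1[symmetric] dn[symmetric] by simp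
    finally have 2: "qnum q (s + 1) * poly (F j) (cosh_coord (s + 1)) - qnum q (s - 1) * poly (F j) (cosh_coord (s - 1))
      = 2 * n j * (qplus q s * poly (H j) (cosh_coord s))"
      using d by (simp add: D_qnum mult.assoc flip: right_diff_distrib)
    have "g (Suc j) (s + 1) - g (Suc j) (s - 1) = c j *
        (qnum q (s + 1) * poly (F j) (cosh_coord (s + 1)) - qnum q (s - 1) * poly (F j) (cosh_coord (s - 1)))"
      by (simp add: g_def algebra_simps)
    also have "\<dots> = qplus q s * poly (smult (inverse (e ^ j)) (H j)) (cosh_coord s)"
      unfolding 2 using n[of j] by (simp add: c_def)
    finally show "qplus q s * poly (smult (inverse (e ^ j)) (H j)) (cosh_coord s) = g (Suc j) (s + 1) - g (Suc j) (s - 1)" ..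
  next
    fix j
    show "coeff (smult (inverse (e ^ j)) (H j)) j = 1"
      using e by (simp add: HH)
  next
    fix i
    assume "i \<le> k"
    thus "even (t i - 0)"
      using s_pos by (auto simp: t_def split: nat.splits)
  qed (use t H(1) in \<open>auto simp: g_def intro: order.trans[OF degree_smult_le]\<close>)
  \<comment> \<open>As \<open>qnum q 0 = 0\<close>, the row of the dent 0 has the entry 1 in column
    0 and zeros elsewhere.\<close>
  also have "\<dots> = det (mat k k (\<lambda>(i, j). g (Suc j) (t (Suc i))))"
    by (rule det_first_row_unit) (auto simp: t_def g_def qnum_def split: nat.splits)
  also have "\<dots> = det (mat k k (\<lambda>(i, j). qnum q (s i) * poly (smult (c j) (F j)) (cosh_coord (s i))))"
    by (simp add: g_def t_def)
  \<comment> \<open>The row factors \<open>qnum q (s i)\<close> leave the determinant here; they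
    reappear as part of the weight in \<open>top_odd_step\<close>.\<close>
  also have "\<dots> = (\<Prod>i<k. qnum q (s i)) * ((\<Prod>j<k. coeff (smult (c j) (F j)) j) *
      det (mat k k (\<lambda>(i, j). cosh_coord (s i) ^ j)))"
    unfolding det_row_scale by (subst det_poly_newton) (auto intro: order.trans[OF degree_smult_le] F(1))
  also have "det (mat k k (\<lambda>(i, j). cosh_coord (s i) ^ j)) = vprod cosh_coord S"
    using vprod_image[OF s(1), of cosh_coord] s(2) by (simp add: det_vandermonde)
  also have "(\<Prod>i<k. qnum q (s i)) = (\<Prod>s\<in>S. qnum q s)"
    using strict_mono_on_imp_inj_on[OF s(1)] by (simp flip: s(2) add: prod.reindex)
  also have "(\<Prod>j<k. coeff (smult (c j) (F j)) j) = (\<Prod>j<k. inverse (2 * n j))"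
    using e n by (intro prod.cong refl) (simp add: FF c_def field_simps)
  finally show ?thesis
    by (simp add: tS n_def mult_ac)
qed

end

section \<open>Cutting tilings\<close>

lemma vertical_segment_eq_iff: "vertical_segment x y = vertical_segment x' y' \<longleftrightarrow> x = x' \<and> y = y'"
  by (auto simp: vertical_segment_def doubleton_eq_iff)

lemma shared_edge_horizontal:
  "even (c + y) \<Longrightarrow> shared_edge {(c, y), (c + 1, y)} = vertical_segment (c + 1) y"
  by (auto simp: shared_edge_def vertical_segment_def)

lemma shared_edge_slanted:
  "shared_edge {(c, y), (c, y + 1)} = (if even (c + y) then {(c, y), (c + 1, y + 1)} else {(c + 1, y), (c, y + 1)})"
  by (auto simp: shared_edge_def)

lemma shared_edge_slanted_not_vertical: "shared_edge {(c, y), (c, y + 1)} \<noteq> vertical_segment x z"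
  by (auto simp: shared_edge_slanted vertical_segment_def doubleton_eq_iff)

lemma lozenge_horizontal: "even (c + y) \<Longrightarrow> lozenge {(c, y), (c + 1, y)}"
  by (simp add: lozenge_def shared_edge_horizontal vertical_segment_def)

lemma lozenge_slanted: "lozenge {(c, y), (c, y + 1)}"
  by (simp add: lozenge_def shared_edge_slanted)

lemma vertices_vertical_edge:
  assumes "(x, b) \<in> vertices (c, y)" "(x, d) \<in> vertices (c, y)" "b \<noteq> d"
  shows "b + d = 2 * y \<and> x = (if even (c + y) then c + 1 else c)"
  using assms by (cases "even (c + y)") auto

lemma vertices_slanted_edge:
  assumes "(x, b) \<in> vertices (c, y)" "(x', d) \<in> vertices (c, y)" "x \<noteq> x'"
  shows "x + x' = 2 * c + 1 \<and> (b + d = 2 * y + 1 \<or> b + d = 2 * y - 1)"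
  using assms by (cases "even (c + y)") auto

text \<open>Two common vertices on one vertical line determine the height of the triangle and on
  which line its vertical side lies. Two on different lines determine the strip, and the height up
  to one step.\<close>

lemma adjacent_triangles:
  assumes "(c, y) \<noteq> (c', y')" and "card (vertices (c, y) \<inter> vertices (c', y')) = 2"
  shows "c' = c \<and> (y' = y + 1 \<or> y = y' + 1)
    \<or> y' = y \<and> (even (c + y) \<and> c' = c + 1 \<or> odd (c + y) \<and> c = c' + 1)"
proof -
  obtain p r where "p \<noteq> r" and I: "vertices (c, y) \<inter> vertices (c', y') = {p, r}"
    using assms(2) by (auto simp: card_2_iff)
  obtain a b a' d where pr: "p = (a, b)" "r = (a', d)"
    by (cases p, cases r)
  have v: "(a, b) \<in> vertices (c, y)" "(a', d) \<in> vertices (c, y)"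
    "(a, b) \<in> vertices (c', y')" "(a', d) \<in> vertices (c', y')"
    using I pr by blast+
  show ?thesis
  proof (cases "a = a'")
    case True
    hence "b \<noteq> d"
      using \<open>p \<noteq> r\<close> pr by simp
    hence "b + d = 2 * y \<and> a = (if even (c + y) then c + 1 else c)"
      "b + d = 2 * y' \<and> a = (if even (c' + y') then c' + 1 else c')"
      using v True vertices_vertical_edge by blast+
    hence "y' = y" "(if even (c + y) then c + 1 else c) = (if even (c' + y') then c' + 1 else c')"
      by auto
    thus ?thesis
      using assms(1) by (auto split: if_splits)
  next
    case False
    hence "a + a' = 2 * c + 1 \<and> (b + d = 2 * y + 1 \<or> b + d = 2 * y - 1)"
      "a + a' = 2 * c' + 1 \<and> (b + d = 2 * y' + 1 \<or> b + d = 2 * y' - 1)"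
      using v vertices_slanted_edge by blast+
    hence "c' = c" "y' = y \<or> y' = y + 1 \<or> y = y' + 1"
      by linarith+
    thus ?thesis
      using assms(1) by auto
  qed
qed

text \<open>This is the normal form by which lozenges are handled from here on. Orientation matters
  only for the horizontal kind, whose left triangle must be left-pointing; the triangles of a
  slanted one always follow each other in their strip.\<close>

lemma lozenge_cases:
  assumes "lozenge T"
  obtains c y where "T = {(c, y), (c, y + 1)}"
    | c y where "even (c + y)" "T = {(c, y), (c + 1, y)}"
proof -
  obtain c y c' y' where T: "T = {(c, y), (c', y')}" "(c, y) \<noteq> (c', y')"
    using assms by (auto simp: lozenge_def card_2_iff)
  have "card (vertices (c, y) \<inter> vertices (c', y')) = 2"
    using assms by (simp add: lozenge_def shared_edge_def T(1) del: vertices.simps)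
  from adjacent_triangles[OF T(2) this] show thesis
  proof (elim disjE conjE)
    assume "c' = c" "y' = y + 1"
    thus thesis using that(1)[of c y] T(1) by simp
  next
    assume "c' = c" "y = y' + 1"
    thus thesis using that(1)[of c y'] T(1) by (simp add: insert_commute)
  next
    assume "y' = y" "even (c + y)" "c' = c + 1"
    thus thesis using that(2)[of c y] T(1) by simp
  next
    assume "y' = y" "odd (c + y)" "c = c' + 1"
    thus thesis using that(2)[of c' y] T(1) by (simp add: insert_commute)
  qed
qed

lemma lozenge_weight_horizontal:
  assumes "even (c + y)"
  shows "lozenge_weight q {(c, y), (c + 1, y)} = qplus q y"
proof -
  have "shared_edge {(c, y), (c + 1, y)} = vertical_segment (c + 1) y"
    using assms by (rule shared_edge_horizontal)
  thus ?thesis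
    by (auto simp: lozenge_weight_def horizontal_def center_height_def vertical_segment_eq_iff)
qed

lemma lozenge_weight_slanted: "lozenge_weight q {(c, y), (c, y + 1)} = 1"
  by (simp add: lozenge_weight_def horizontal_def shared_edge_slanted_not_vertical)

lemma finite_tilings: "finite (fst R) \<Longrightarrow> finite (tilings R)"
  by (rule finite_subset[of _ "Pow (Pow (fst R))"]) (auto simp: tilings_def partition_on_def)

lemma finite_tiling: "finite (fst R) \<Longrightarrow> P \<in> tilings R \<Longrightarrow> finite P"
  using finite_elements[of "fst R" P] by (auto simp: tilings_def)

lemma partition_on_union:
  assumes "A \<inter> B = {}" "partition_on A P" "partition_on B Q"
  shows "partition_on (A \<union> B) (P \<union> Q)"
  using assms by (auto simp: partition_on_def intro!: disjoint_union)

text \<open>A tiling is determined by its lozenges that meet both parts and by the tilings it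
  induces on the remainders. \<open>Q\<close> ranges over all disjoint sets of such lozenges; one
  that does not extend to a tiling contributes 0, since a remainder then has no tiling.\<close>

lemma M_split:
  fixes q :: "'a::field" and Bar :: "segment set"
  assumes fin: "finite X\<^sub>1" "finite X\<^sub>2" and disj: "X\<^sub>1 \<inter> X\<^sub>2 = {}"
  defines "C \<equiv> {T. lozenge T \<and> shared_edge T \<notin> Bar \<and> T \<subseteq> X\<^sub>1 \<union> X\<^sub>2 \<and> T \<inter> X\<^sub>1 \<noteq> {} \<and> T \<inter> X\<^sub>2 \<noteq> {}}"
  shows "M q (X\<^sub>1 \<union> X\<^sub>2, Bar) = (\<Sum>Q | Q \<subseteq> C \<and> disjoint Q.
    (\<Prod>T\<in>Q. lozenge_weight q T) * (M q (X\<^sub>1 - \<Union>Q, Bar) * M q (X\<^sub>2 - \<Union>Q, Bar)))"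
proof -
  let ?w = "\<lambda>P. \<Prod>T\<in>P. lozenge_weight q T"
  have finC: "finite C"
    by (rule finite_subset[of _ "Pow (X\<^sub>1 \<union> X\<^sub>2)"]) (use fin in \<open>auto simp: C_def\<close>)
  have finQ: "finite {Q. Q \<subseteq> C \<and> disjoint Q}"
    by (rule finite_subset[of _ "Pow C"]) (use finC in auto)
  have "(\<Sum>Q | Q \<subseteq> C \<and> disjoint Q. ?w Q * (M q (X\<^sub>1 - \<Union>Q, Bar) * M q (X\<^sub>2 - \<Union>Q, Bar)))
    = (\<Sum>Q | Q \<subseteq> C \<and> disjoint Q. \<Sum>(P\<^sub>1, P\<^sub>2)\<in>tilings (X\<^sub>1 - \<Union>Q, Bar) \<times> tilings (X\<^sub>2 - \<Union>Q, Bar).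
        ?w Q * (?w P\<^sub>1 * ?w P\<^sub>2))"
    unfolding M_def sum_product sum.cartesian_product by (simp add: sum_distrib_left case_prod_unfold)
  also have "\<dots> = (\<Sum>(Q, P\<^sub>1, P\<^sub>2)\<in>(SIGMA Q:{Q. Q \<subseteq> C \<and> disjoint Q}.
      tilings (X\<^sub>1 - \<Union>Q, Bar) \<times> tilings (X\<^sub>2 - \<Union>Q, Bar)). ?w Q * (?w P\<^sub>1 * ?w P\<^sub>2))"
    using fin finQ by (subst sum.Sigma) (auto intro!: finite_tilings simp: case_prod_unfold)
  also have "\<dots> = (\<Sum>P\<in>tilings (X\<^sub>1 \<union> X\<^sub>2, Bar). ?w P)"
  proof (rule sum.reindex_bij_witness[where j = "\<lambda>(Q, P\<^sub>1, P\<^sub>2). Q \<union> P\<^sub>1 \<union> P\<^sub>2"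
        and i = "\<lambda>P. (P \<inter> C, {T\<in>P. T \<subseteq> X\<^sub>1}, {T\<in>P. T \<subseteq> X\<^sub>2})"], goal_cases)
    case (1 a)
    then obtain Q P\<^sub>1 P\<^sub>2 where a: "a = (Q, P\<^sub>1, P\<^sub>2)" and Q: "Q \<subseteq> C" "disjoint Q"
      and P1: "P\<^sub>1 \<in> tilings (X\<^sub>1 - \<Union>Q, Bar)" and P2: "P\<^sub>2 \<in> tilings (X\<^sub>2 - \<Union>Q, Bar)"
      by auto
    have s: "T \<subseteq> X\<^sub>1 \<and> T \<noteq> {}" if "T \<in> P\<^sub>1" for T
      using P1 that by (auto simp: tilings_def partition_on_def)
    have s': "T \<subseteq> X\<^sub>2 \<and> T \<noteq> {}" if "T \<in> P\<^sub>2" for T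
      using P2 that by (auto simp: tilings_def partition_on_def)
    have c: "T \<inter> X\<^sub>1 \<noteq> {} \<and> T \<inter> X\<^sub>2 \<noteq> {}" if "T \<in> Q" for T
      using Q that by (auto simp: C_def)
    have "(Q \<union> P\<^sub>1 \<union> P\<^sub>2) \<inter> C = Q"
      using Q s s' disj unfolding C_def by blast
    moreover have "{T \<in> Q \<union> P\<^sub>1 \<union> P\<^sub>2. T \<subseteq> X\<^sub>1} = P\<^sub>1"
      using c s s' disj by blast
    moreover have "{T \<in> Q \<union> P\<^sub>1 \<union> P\<^sub>2. T \<subseteq> X\<^sub>2} = P\<^sub>2"
      using c s s' disj by blast
    ultimately show ?case
      by (simp add: a)
  next
    case (2 a)
    then obtain Q P\<^sub>1 P\<^sub>2 where a: "a = (Q, P\<^sub>1, P\<^sub>2)" and Q: "Q \<subseteq> C" "disjoint Q"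
      and P1: "P\<^sub>1 \<in> tilings (X\<^sub>1 - \<Union>Q, Bar)" and P2: "P\<^sub>2 \<in> tilings (X\<^sub>2 - \<Union>Q, Bar)"
      by auto
    have p1: "partition_on (X\<^sub>1 - \<Union>Q) P\<^sub>1" and p2: "partition_on (X\<^sub>2 - \<Union>Q) P\<^sub>2"
      using P1 P2 by (auto simp: tilings_def)
    have pQ: "partition_on (\<Union>Q) Q"
      using Q by (auto simp: partition_on_def C_def)
    have "partition_on (\<Union>Q \<union> (X\<^sub>1 - \<Union>Q)) (Q \<union> P\<^sub>1)"
      by (rule partition_on_union[OF _ pQ p1]) auto
    hence "partition_on ((\<Union>Q \<union> (X\<^sub>1 - \<Union>Q)) \<union> (X\<^sub>2 - \<Union>Q)) (Q \<union> P\<^sub>1 \<union> P\<^sub>2)"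
      by (rule partition_on_union[rotated, OF _ p2]) (use disj in auto)
    moreover have "(\<Union>Q \<union> (X\<^sub>1 - \<Union>Q)) \<union> (X\<^sub>2 - \<Union>Q) = X\<^sub>1 \<union> X\<^sub>2"
      using Q by (auto simp: C_def)
    ultimately show ?case
      using P1 P2 Q by (auto simp: a tilings_def C_def)
  next
    case (3 P)
    have p: "partition_on (X\<^sub>1 \<union> X\<^sub>2) P" and loz: "\<And>T. T \<in> P \<Longrightarrow> lozenge T \<and> shared_edge T \<notin> Bar"
      using 3 by (auto simp: tilings_def)
    have "T \<in> C \<or> T \<subseteq> X\<^sub>1 \<or> T \<subseteq> X\<^sub>2" if "T \<in> P" for T
      using loz[OF that] partition_onD1[OF p] that unfolding C_def by blast
    thus ?case by auto
  next
    case (4 P)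
    have p: "partition_on (X\<^sub>1 \<union> X\<^sub>2) P" and loz: "\<And>T. T \<in> P \<Longrightarrow> lozenge T \<and> shared_edge T \<notin> Bar"
      using 4 by (auto simp: tilings_def)
    have cov: "T \<in> C \<or> T \<subseteq> X\<^sub>1 \<or> T \<subseteq> X\<^sub>2" if "T \<in> P" for T
      using loz[OF that] partition_onD1[OF p] that unfolding C_def by blast
    have dj: "disjoint P" and ne: "{} \<notin> P" and un: "\<Union>P = X\<^sub>1 \<union> X\<^sub>2"
      using p by (auto simp: partition_on_def)
    have dj2: "T = T'" if "T \<in> P" "T' \<in> P" "x \<in> T" "x \<in> T'" for T T' x
      using dj that by (auto simp: disjoint_def)
    have "partition_on (X\<^sub>1 - \<Union>(P \<inter> C)) {T \<in> P. T \<subseteq> X\<^sub>1}"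
    proof (rule partition_onI)
      show "\<Union>{T \<in> P. T \<subseteq> X\<^sub>1} = X\<^sub>1 - \<Union>(P \<inter> C)"
      proof (intro equalityI subsetI)
        fix x assume "x \<in> \<Union>{T \<in> P. T \<subseteq> X\<^sub>1}"
        then obtain T where T: "T \<in> P" "T \<subseteq> X\<^sub>1" "x \<in> T" by auto
        hence "T \<notin> C" using disj by (auto simp: C_def)
        thus "x \<in> X\<^sub>1 - \<Union>(P \<inter> C)" using T dj2 by blast
      next
        fix x assume x: "x \<in> X\<^sub>1 - \<Union>(P \<inter> C)"
        then obtain T where T: "T \<in> P" "x \<in> T" using un by blast
        thus "x \<in> \<Union>{T \<in> P. T \<subseteq> X\<^sub>1}" using cov[OF T(1)] x disj by auto
      qed
    qed (use dj ne in \<open>auto simp: disjoint_def disjnt_def\<close>)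
    moreover have "partition_on (X\<^sub>2 - \<Union>(P \<inter> C)) {T \<in> P. T \<subseteq> X\<^sub>2}"
    proof (rule partition_onI)
      show "\<Union>{T \<in> P. T \<subseteq> X\<^sub>2} = X\<^sub>2 - \<Union>(P \<inter> C)"
      proof (intro equalityI subsetI)
        fix x assume "x \<in> \<Union>{T \<in> P. T \<subseteq> X\<^sub>2}"
        then obtain T where T: "T \<in> P" "T \<subseteq> X\<^sub>2" "x \<in> T" by auto
        hence "T \<notin> C" using disj by (auto simp: C_def)
        thus "x \<in> X\<^sub>2 - \<Union>(P \<inter> C)" using T dj2 by blast
      next
        fix x assume x: "x \<in> X\<^sub>2 - \<Union>(P \<inter> C)"
        then obtain T where T: "T \<in> P" "x \<in> T" using un by blast
        thus "x \<in> \<Union>{T \<in> P. T \<subseteq> X\<^sub>2}" using cov[OF T(1)] x disj by auto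
      qed
    qed (use dj ne in \<open>auto simp: disjoint_def disjnt_def\<close>)
    moreover have "disjoint (P \<inter> C)"
      using dj by (auto simp: disjoint_def)
    ultimately show ?case
      using loz by (auto simp: tilings_def)
  next
    case (5 a)
    then obtain Q P\<^sub>1 P\<^sub>2 where a: "a = (Q, P\<^sub>1, P\<^sub>2)" and Q: "Q \<subseteq> C"
      and P1: "P\<^sub>1 \<in> tilings (X\<^sub>1 - \<Union>Q, Bar)" and P2: "P\<^sub>2 \<in> tilings (X\<^sub>2 - \<Union>Q, Bar)"
      by auto
    have s: "T \<subseteq> X\<^sub>1 \<and> T \<noteq> {}" if "T \<in> P\<^sub>1" for T
      using P1 that by (auto simp: tilings_def partition_on_def)
    have s': "T \<subseteq> X\<^sub>2 \<and> T \<noteq> {}" if "T \<in> P\<^sub>2" for T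
      using P2 that by (auto simp: tilings_def partition_on_def)
    have c: "T \<inter> X\<^sub>1 \<noteq> {} \<and> T \<inter> X\<^sub>2 \<noteq> {}" if "T \<in> Q" for T
      using Q that by (auto simp: C_def)
    have f: "finite Q" "finite P\<^sub>1" "finite P\<^sub>2"
      using finite_subset[OF Q finC] finite_tiling[OF _ P1] finite_tiling[OF _ P2] fin by auto
    have "Q \<inter> P\<^sub>1 = {}" "(Q \<union> P\<^sub>1) \<inter> P\<^sub>2 = {}"
      using s s' c disj by blast+
    thus ?case
      using f by (simp add: a prod.union_disjoint mult.assoc)
  qed
  finally show ?thesis
    by (simp add: M_def)
qed

text \<open>Only horizontal lozenges cross a vertical lattice line, at most one at each height, and
  no two of them overlap. So the crossings form an arbitrary set of admissible heights, which also
  determines their weight.\<close>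

lemma M_cut:
  fixes q :: "'a::field" and Bar :: "segment set" and a :: int
  assumes fin: "finite X"
  defines "C \<equiv> {y. odd (a + y) \<and> (a - 1, y) \<in> X \<and> (a, y) \<in> X \<and> vertical_segment a y \<notin> Bar}"
  shows "M q (X, Bar) = (\<Sum>S\<in>Pow C. prod (qplus q) S *
    (M q ({t \<in> X. fst t < a} - Pair (a - 1) ` S, Bar) * M q ({t \<in> X. a \<le> fst t} - Pair a ` S, Bar)))"
proof -
  let ?X1 = "{t \<in> X. fst t < a}" and ?X2 = "{t \<in> X. a \<le> fst t}"
  define h where "h y = {(a - 1, y), (a, y)}" for y :: int
  have inj: "inj h"
    by (auto simp: inj_def h_def doubleton_eq_iff)
  have seg: "shared_edge (h y) = vertical_segment a y" "lozenge (h y)" "lozenge_weight q (h y) = qplus q y"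
    if "odd (a + y)" for y
    using that shared_edge_horizontal[of "a - 1" y] lozenge_horizontal[of "a - 1" y]
      lozenge_weight_horizontal[of "a - 1" y q] by (simp_all add: h_def)
  have X: "X = ?X1 \<union> ?X2"
    by auto
  let ?C = "{T. lozenge T \<and> shared_edge T \<notin> Bar \<and> T \<subseteq> ?X1 \<union> ?X2 \<and> T \<inter> ?X1 \<noteq> {} \<and> T \<inter> ?X2 \<noteq> {}}"
  have "?C = h ` C"
  proof (intro equalityI subsetI)
    fix T assume "T \<in> h ` C"
    then obtain y where y: "y \<in> C" "T = h y" by blast
    thus "T \<in> ?C"
      using seg[of y] by (auto simp: C_def) (auto simp: h_def)
  next
    fix T assume T: "T \<in> ?C"
    hence "lozenge T" by blast
    thus "T \<in> h ` C"
    proof (cases rule: lozenge_cases)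
      case (1 c y)
      with T have False by auto
      thus ?thesis ..
    next
      case (2 c y)
      with T have c: "c = a - 1" by auto
      hence "T = h y" "odd (a + y)"
        using 2 by (auto simp: h_def)
      moreover from this have "y \<in> C"
        using T seg[of y] by (auto simp: C_def h_def)
      ultimately show ?thesis by blast
    qed
  qed
  moreover have "disjoint (h ` S)" for S
    by (auto simp: disjoint_def h_def)
  ultimately have Q: "{Q. Q \<subseteq> ?C \<and> disjoint Q} = image h ` Pow C"
    by (auto simp: subset_image_iff)
  have "M q (?X1 \<union> ?X2, Bar) = (\<Sum>Q | Q \<subseteq> ?C \<and> disjoint Q.
    (\<Prod>T\<in>Q. lozenge_weight q T) * (M q (?X1 - \<Union>Q, Bar) * M q (?X2 - \<Union>Q, Bar)))"
    by (rule M_split) (use fin in auto)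
  also have "\<dots> = (\<Sum>S\<in>Pow C. (\<Prod>T\<in>h ` S. lozenge_weight q T) *
      (M q (?X1 - \<Union>(h ` S), Bar) * M q (?X2 - \<Union>(h ` S), Bar)))"
    unfolding Q using inj by (subst sum.reindex) (auto simp: inj_on_def inj_image_eq_iff)
  also have "\<dots> = (\<Sum>S\<in>Pow C. prod (qplus q) S *
    (M q (?X1 - Pair (a - 1) ` S, Bar) * M q (?X2 - Pair a ` S, Bar)))"
  proof (intro sum.cong refl)
    fix S assume "S \<in> Pow C"
    hence odd: "odd (a + y)" if "y \<in> S" for y
      using that by (auto simp: C_def)
    have "inj_on h S"
      using inj by (rule inj_on_subset) simp
    hence "(\<Prod>T\<in>h ` S. lozenge_weight q T) = (\<Prod>y\<in>S. lozenge_weight q (h y))"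
      by (simp add: prod.reindex)
    also have "\<dots> = prod (qplus q) S"
      by (intro prod.cong refl seg(3) odd)
    finally have "(\<Prod>T\<in>h ` S. lozenge_weight q T) = prod (qplus q) S" .
    moreover have "?X1 - \<Union>(h ` S) = ?X1 - Pair (a - 1) ` S" "?X2 - \<Union>(h ` S) = ?X2 - Pair a ` S"
      by (auto simp: h_def)
    ultimately show "(\<Prod>T\<in>h ` S. lozenge_weight q T) * (M q (?X1 - \<Union>(h ` S), Bar) * M q (?X2 - \<Union>(h ` S), Bar))
      = prod (qplus q) S * (M q (?X1 - Pair (a - 1) ` S, Bar) * M q (?X2 - Pair a ` S, Bar))"
      by simp
  qed
  finally show ?thesis
    using X by simp
qed

lemma M_no_crossing:
  fixes q :: "'a::field" and Bar :: "segment set"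
  assumes fin: "finite X\<^sub>1" "finite X\<^sub>2" and disj: "X\<^sub>1 \<inter> X\<^sub>2 = {}"
    and "\<And>T. lozenge T \<Longrightarrow> T \<subseteq> X\<^sub>1 \<union> X\<^sub>2 \<Longrightarrow> T \<subseteq> X\<^sub>1 \<or> T \<subseteq> X\<^sub>2"
  shows "M q (X\<^sub>1 \<union> X\<^sub>2, Bar) = M q (X\<^sub>1, Bar) * M q (X\<^sub>2, Bar)"
proof -
  have "\<not> (lozenge T \<and> shared_edge T \<notin> Bar \<and> T \<subseteq> X\<^sub>1 \<union> X\<^sub>2 \<and> T \<inter> X\<^sub>1 \<noteq> {} \<and> T \<inter> X\<^sub>2 \<noteq> {})" for T
    using assms(4)[of T] disj by blast
  hence C: "{T. lozenge T \<and> shared_edge T \<notin> Bar \<and> T \<subseteq> X\<^sub>1 \<union> X\<^sub>2 \<and> T \<inter> X\<^sub>1 \<noteq> {} \<and> T \<inter> X\<^sub>2 \<noteq> {}} = {}"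
    by (intro Collect_empty_eq[THEN iffD2] allI)
  have "{Q. Q \<subseteq> {} \<and> disjoint Q} = {{} :: triangle set set}"
    by auto
  thus ?thesis
    using M_split[OF fin disj, of q Bar] unfolding C by simp
qed

lemma M_barriers_off_region:
  assumes "\<And>T. lozenge T \<Longrightarrow> T \<subseteq> X \<Longrightarrow> shared_edge T \<notin> Bar"
  shows "M q (X, Bar) = M q (X, {})"
proof -
  have "tilings (X, Bar) = tilings (X, {})"
    using assms by (auto simp: tilings_def partition_on_def)
  thus ?thesis by (simp add: M_def)
qed

lemma M_empty [simp]: "M q ({}, Bar) = 1"
proof -
  have "tilings ({}, Bar) = {{}}"
    by (auto simp: tilings_def partition_on_empty)
  thus ?thesis by (simp add: M_def)
qed

text \<open>The weight \<open>qplus\<close> is even, so reflection in the horizontal line preserves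
  it. This lets the lower part of the left half be treated as a mirrored upper part.\<close>

lemma M_reflect:
  fixes q :: "'a::field"
  defines "\<rho> \<equiv> \<lambda>t :: triangle. (fst t, - snd t)"
  shows "M q (\<rho> ` X, {}) = M q (X, {})"
proof -
  have inj: "inj \<rho>" and inv: "\<rho> (\<rho> t) = t" for t
    by (auto simp: inj_def \<rho>_def prod_eq_iff)
  have inv': "\<rho> ` (\<rho> ` T) = T" for T
    by (simp add: image_image inv)
  have inv'': "image \<rho> ` (image \<rho> ` P) = P" for P
    by (simp add: image_image inv)
  have loz: "lozenge (\<rho> ` T) \<and> lozenge_weight q (\<rho> ` T) = lozenge_weight q T" if "lozenge T" for T
    using that
  proof (cases rule: lozenge_cases)
    case (1 c y)
    \<comment> \<open>Reflection exchanges the lower and the upper triangle of a slanted lozenge, so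
      the lower one is now at \<open>- y - 1\<close>.\<close>
    have "\<rho> ` T = {(c, - y - 1), (c, (- y - 1) + 1)}"
      by (auto simp: 1 \<rho>_def)
    thus ?thesis
      by (metis 1 lozenge_slanted lozenge_weight_slanted)
  next
    case (2 c y)
    have "\<rho> ` T = {(c, - y), (c + 1, - y)}" "even (c + - y)"
      using 2 by (auto simp: \<rho>_def)
    moreover have "qplus q (- y) = qplus q y"
      by (simp add: qplus_def add.commute)
    ultimately show ?thesis
      using 2 by (metis lozenge_horizontal lozenge_weight_horizontal)
  qed
  have til: "image \<rho> ` P \<in> tilings (\<rho> ` X, {})" if "P \<in> tilings (X, {})" for P X
  proof -
    have P: "partition_on X P" and "\<forall>T\<in>P. lozenge T"
      using that by (auto simp: tilings_def)
    have "partition_on (\<rho> ` X) (image \<rho> ` P - {{}})"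
      using P inj by (intro partition_on_inj_image) (auto intro: inj_on_subset)
    moreover have "image \<rho> ` P - {{}} = image \<rho> ` P"
      using partition_onD3[OF P] by auto
    ultimately show ?thesis
      using \<open>\<forall>T\<in>P. lozenge T\<close> loz by (auto simp: tilings_def)
  qed
  have "(\<Sum>P\<in>tilings (X, {}). \<Prod>T\<in>P. lozenge_weight q T) = (\<Sum>P\<in>tilings (\<rho> ` X, {}). \<Prod>T\<in>P. lozenge_weight q T)"
  proof (rule sum.reindex_bij_witness[where i = "image (image \<rho>)" and j = "image (image \<rho>)"], goal_cases)
    case (4 P)
    thus ?case
      using til[of P "\<rho> ` X"] by (simp add: inv')
  next
    case (5 P)
    have "inj_on (image \<rho>) P"
      using inj by (auto simp: inj_on_def inj_image_eq_iff)
    thus ?case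
      using 5 loz by (subst prod.reindex) (auto simp: tilings_def intro!: prod.cong)
  qed (auto simp: inv'' til)
  thus ?thesis
    by (simp add: M_def)
qed

section \<open>Tilings of a single strip\<close>

lemma card_le_Suc_split:
  fixes y :: int
  assumes "finite A"
  shows "card {a \<in> A. a \<le> y} = card {a \<in> A. a \<le> y - 1} + (if y \<in> A then 1 else 0)"
proof -
  have "{a \<in> A. a \<le> y} = (if y \<in> A then insert y {a \<in> A. a \<le> y - 1} else {a \<in> A. a \<le> y - 1})"
    using order_le_less[of _ y] by auto
  thus ?thesis
    using assms by auto
qed

text \<open>One column of triangles at the heights from \<open>lo\<close> to \<open>hi\<close>.
  Those of the parity of \<open>lo\<close> have their vertical side on one boundary line, the others
  on the opposite line. As both ends have the same parity, the first kind is in the majority by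
  one.\<close>

locale strip =
  fixes lo hi :: int and S T :: "int set"
  assumes lo_hi: "lo \<le> hi" "even (hi - lo)"
    and T: "T \<subseteq> {lo..hi}" "\<And>t. t \<in> T \<Longrightarrow> even (t - lo)"
    and S: "S \<subseteq> {lo..hi}" "\<And>s. s \<in> S \<Longrightarrow> odd (s - lo)"
begin

text \<open>
  A slanted lozenge leaves the part of the strip up to height \<open>y\<close> iff this part contains different
  numbers of left-pointing and right-pointing triangles, so the tiling can be read off from \<open>excess\<close>.
\<close>

definition excess :: "int \<Rightarrow> int" where
  "excess y = int (card {t \<in> T. t \<le> y}) - int (card {s \<in> S. s \<le> y})"

lemma fin: "finite S" "finite T"
  using T(1) S(1) finite_subset by blast+

lemma excess_step: "excess y = excess (y - 1) + (if y \<in> T then 1 else 0) - (if y \<in> S then 1 else 0)"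
  unfolding excess_def using card_le_Suc_split[OF fin(1), of y] card_le_Suc_split[OF fin(2), of y] by simp

lemma excess_below: "y < lo \<Longrightarrow> excess y = 0"
proof -
  assume "y < lo"
  hence "{t \<in> T. t \<le> y} = {}" "{t \<in> S. t \<le> y} = {}"
    using T(1) S(1) by auto
  thus ?thesis
    unfolding excess_def by (simp only: card.empty)
qed

lemma excess_above: "hi \<le> y \<Longrightarrow> excess y = int (card T) - int (card S)"
proof -
  assume "hi \<le> y"
  hence "{t \<in> T. t \<le> y} = T" "{t \<in> S. t \<le> y} = S"
    using T(1) S(1) by auto
  thus ?thesis
    unfolding excess_def by simp
qed

lemma interlaces_iff: "interlaces S T \<longleftrightarrow> excess hi = 1 \<and> (\<forall>y. excess y = 0 \<or> excess y = 1)"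
proof -
  have "card T = Suc (card S) \<longleftrightarrow> excess hi = 1"
    unfolding excess_above[OF order.refl] by linarith
  moreover have "card {s \<in> S. s \<le> y} \<le> card {t \<in> T. t \<le> y} \<and> card {t \<in> T. t \<le> y} \<le> Suc (card {s \<in> S. s \<le> y})
    \<longleftrightarrow> excess y = 0 \<or> excess y = 1" for y
    unfolding excess_def by linarith
  ultimately show ?thesis
    unfolding interlaces_def by simp
qed

text \<open>Up to height \<open>y\<close>, the numbers of remaining triangles of the two kinds
  differ by \<open>1 - excess y\<close> if \<open>y - lo\<close> is even and by
  \<open>- excess y\<close> otherwise. If \<open>excess\<close> takes only the values 0 and 1, these
  are the heights where the difference is not 0, so that a lozenge must join \<open>y\<close> to
  \<open>y + 1\<close>.\<close>

definition lower :: "int set" where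
  "lower = {y \<in> {lo..hi}. if even (y - lo) then excess y = 0 else excess y = 1}"

definition slanted :: "int \<Rightarrow> int \<Rightarrow> triangle set" where
  "slanted c y = {(c, y), (c, y + 1)}"

text \<open>All lozenges inside one column are slanted, so a tiling amounts to the set
  \<open>U\<close> of their lower heights. Going upwards, membership in \<open>U\<close> fixes
  \<open>excess\<close> and keeps it in 0 and 1, which is interlacing.\<close>

lemma tiling_unique:
  assumes P: "P \<in> tilings (Pair c ` ({lo..hi} - T - S), {})"
  shows "interlaces S T \<and> P = slanted c ` lower"
proof -
  let ?Y = "{lo..hi} - T - S"
  define U where "U = {y. slanted c y \<in> P}"
  have part: "\<Union>P = Pair c ` ?Y" "disjoint P" and loz: "\<And>Q. Q \<in> P \<Longrightarrow> lozenge Q"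
    using P by (auto simp: tilings_def partition_on_def)
  have block: "\<exists>y. Q = slanted c y" if "Q \<in> P" for Q
    using loz[OF that]
  proof (cases rule: lozenge_cases)
    case (1 c' y)
    have "(c', y) \<in> Pair c ` ?Y"
      using that 1 part(1) by blast
    thus ?thesis
      using 1 by (auto simp: slanted_def)
  next
    case (2 c' y)
    have "(c', y) \<in> Pair c ` ?Y" "(c' + 1, y) \<in> Pair c ` ?Y"
      using that 2 part(1) by blast+
    thus ?thesis by auto
  qed
  have U_Y: "y \<in> ?Y" "y + 1 \<in> ?Y" if "y \<in> U" for y
  proof -
    have "(c, y) \<in> \<Union>P" "(c, y + 1) \<in> \<Union>P"
      using that by (auto simp: U_def slanted_def)
    thus "y \<in> ?Y" "y + 1 \<in> ?Y"
      unfolding part(1) by auto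
  qed
  have U_next: "y + 1 \<notin> U" if "y \<in> U" for y
  proof
    assume "y + 1 \<in> U"
    hence "slanted c y \<in> P" "slanted c (y + 1) \<in> P"
      using that by (auto simp: U_def)
    moreover have "slanted c y \<noteq> slanted c (y + 1)" "slanted c y \<inter> slanted c (y + 1) \<noteq> {}"
      by (auto simp: slanted_def doubleton_eq_iff)
    ultimately show False
      using part(2) unfolding disjoint_def by blast
  qed
  have Y_U: "y \<in> U \<or> y - 1 \<in> U" if "y \<in> ?Y" for y
  proof -
    have "(c, y) \<in> \<Union>P"
      unfolding part(1) using that by auto
    then obtain Q where Q: "Q \<in> P" "(c, y) \<in> Q" by blast
    obtain y' where "Q = slanted c y'"
      using block[OF Q(1)] by blast
    thus ?thesis
      using Q by (auto simp: U_def slanted_def)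
  qed
  \<comment> \<open>The induction starts one step below the column, where \<open>excess\<close> is 0
    and no lozenge begins.\<close>
  have excess_U: "excess y = (if even (y - lo) \<longleftrightarrow> y \<in> U then 0 else 1)" if "lo - 1 \<le> y" "y \<le> hi" for y
    using that
  proof (induction y rule: int_ge_induct)
    case base
    have "lo - 1 \<notin> U"
      using U_Y[of "lo - 1"] by auto
    thus ?case
      using excess_below[of "lo - 1"] by simp
  next
    case (step y)
    hence IH: "excess y = (if even (y - lo) \<longleftrightarrow> y \<in> U then 0 else 1)" and y: "y + 1 \<in> {lo..hi}"
      by auto
    have es: "excess (y + 1) = excess y + (if y + 1 \<in> T then 1 else 0) - (if y + 1 \<in> S then 1 else 0)"
      using excess_step[of "y + 1"] by simp
    consider "y + 1 \<in> T" | "y + 1 \<in> S" | "y + 1 \<in> ?Y"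
      using y by auto
    thus ?case
    proof cases
      case 1
      hence "even (y + 1 - lo)" "y + 1 \<notin> S" "y \<notin> U" "y + 1 \<notin> U"
        using T(2) S(2) U_Y by blast+
      thus ?thesis
        using es IH 1 by auto
    next
      case 2
      hence "odd (y + 1 - lo)" "y + 1 \<notin> T" "y \<notin> U" "y + 1 \<notin> U"
        using T(2) S(2) U_Y by blast+
      thus ?thesis
        using es IH 2 by auto
    next
      case 3
      hence "y + 1 \<notin> T" "y + 1 \<notin> S" "y \<in> U \<longleftrightarrow> y + 1 \<notin> U"
        using U_next[of y] Y_U[of "y + 1"] by auto
      thus ?thesis
        using es IH by auto
    qed
  qed
  have "hi \<notin> U"
    using U_Y[of hi] by auto
  hence hi: "excess hi = 1"
    using excess_U[of hi] lo_hi by simp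
  have "excess y = 0 \<or> excess y = 1" for y
    using excess_U[of y] excess_below[of y] excess_above[of y] excess_above[of hi] hi by (cases "y < lo"; cases "y < hi") auto
  hence "interlaces S T"
    using hi interlaces_iff by blast
  moreover have "y \<in> U \<longleftrightarrow> y \<in> lower" for y
  proof (cases "y \<in> {lo..hi}")
    case True
    thus ?thesis
      using excess_U[of y] by (simp add: lower_def)
  next
    case False
    thus ?thesis
      using U_Y[of y] by (auto simp: lower_def)
  qed
  hence "U = lower"
    by blast
  moreover have "P = slanted c ` U"
    using block by (auto simp: U_def)
  ultimately show ?thesis
    by simp
qed

text \<open>A dent changes \<open>excess\<close> only at heights of its own parity. With values
  confined to 0 and 1 this forces the lozenges starting in \<open>lower\<close> to avoid the dents,
  to be disjoint, and to cover everything else.\<close>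

lemma tiling_exists:
  assumes "interlaces S T"
  shows "slanted c ` lower \<in> tilings (Pair c ` ({lo..hi} - T - S), {})"
proof -
  let ?Y = "{lo..hi} - T - S"
  have excess01: "excess y = 0 \<or> excess y = 1" and hi: "excess hi = 1" for y
    using assms interlaces_iff by auto
  have parity: "even (y - lo) \<Longrightarrow> y \<notin> S" "odd (y - lo) \<Longrightarrow> y \<notin> T" for y
    using T(2) S(2) by blast+
  have lower: "y \<in> ?Y \<and> y + 1 \<in> ?Y \<and> y + 1 \<notin> lower" if "y \<in> lower" for y
  proof -
    have y: "y \<in> {lo..hi}" "if even (y - lo) then excess y = 0 else excess y = 1"
      using that by (auto simp: lower_def)
    have "y \<noteq> hi"
      using y(2) hi lo_hi by auto
    hence "y + 1 \<in> {lo..hi}"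
      using y(1) by auto
    thus ?thesis
      using y parity[of y] parity[of "y + 1"] excess_step[of y] excess_step[of "y + 1"]
        excess01[of y] excess01[of "y - 1"] excess01[of "y + 1"]
      by (auto simp: lower_def split: if_splits)
  qed
  have cover: "y \<in> lower \<or> y - 1 \<in> lower" if "y \<in> ?Y" for y
  proof (cases "y = lo")
    case True
    thus ?thesis
      using that excess_step[of lo] excess_below[of "lo - 1"] lo_hi by (auto simp: lower_def)
  next
    case False
    thus ?thesis
      using that excess_step[of y] excess01[of y] by (auto simp: lower_def split: if_splits)
  qed
  have "partition_on (Pair c ` ?Y) (slanted c ` lower)"
  proof (rule partition_onI)
    show "\<Union>(slanted c ` lower) = Pair c ` ?Y"
    proof (intro equalityI subsetI)
      fix t assume "t \<in> \<Union>(slanted c ` lower)"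
      thus "t \<in> Pair c ` ?Y"
        using lower by (auto simp: slanted_def)
    next
      fix t assume "t \<in> Pair c ` ?Y"
      then obtain y where y: "t = (c, y)" "y \<in> ?Y" by auto
      show "t \<in> \<Union>(slanted c ` lower)"
        using cover[OF y(2)]
      proof
        assume "y \<in> lower"
        moreover have "t \<in> slanted c y"
          by (simp add: y slanted_def)
        ultimately show ?thesis by blast
      next
        assume "y - 1 \<in> lower"
        moreover have "t \<in> slanted c (y - 1)"
          by (simp add: y slanted_def)
        ultimately show ?thesis by blast
      qed
    qed
  next
    fix p r assume "p \<in> slanted c ` lower" "r \<in> slanted c ` lower" "p \<noteq> r"
    thus "disjnt p r"
      using lower by (auto simp: slanted_def disjnt_def)
  qed (auto simp: slanted_def)
  thus ?thesis
    by (auto simp: tilings_def slanted_def lozenge_slanted)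
qed

lemma M_strip: "M q (Pair c ` ({lo..hi} - T - S), {}) = (if interlaces S T then 1 else 0)"
proof (cases "interlaces S T")
  case True
  hence "tilings (Pair c ` ({lo..hi} - T - S), {}) = {slanted c ` lower}"
    using tiling_unique tiling_exists by blast
  moreover have "(\<Prod>t\<in>slanted c ` lower. lozenge_weight q t) = 1"
    by (intro prod.neutral) (auto simp: slanted_def lozenge_weight_slanted)
  ultimately show ?thesis
    using True by (simp add: M_def)
next
  case False
  hence "tilings (Pair c ` ({lo..hi} - T - S), {}) = {}"
    using tiling_unique by blast
  thus ?thesis
    using False by (simp add: M_def)
qed

end

text \<open>An element of \<open>S\<close> has one of \<open>T\<close> below it, since it is itself
  counted, and one above it, since just before it not all of \<open>T\<close> can be counted. This
  keeps interlacing sets inside the region.\<close>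

lemma interlaces_within:
  assumes i: "interlaces S T" and fin: "finite S" and T: "T \<subseteq> {a..b}" and disj: "S \<inter> T = {}"
  shows "S \<subseteq> {a<..<b}"
proof
  fix s assume s: "s \<in> S"
  have fT: "finite T"
    using T finite_subset by blast
  have *: "card {s \<in> S. s \<le> y} \<le> card {t \<in> T. t \<le> y}" "card {t \<in> T. t \<le> y} \<le> Suc (card {s \<in> S. s \<le> y})" for y
    using i by (auto simp: interlaces_def)
  have "0 < card {x \<in> S. x \<le> s}"
    unfolding card_gt_0_iff using fin s by auto
  hence "{t \<in> T. t \<le> s} \<noteq> {}"
    using *(1)[of s] by (metis card.empty not_le)
  then obtain t where "t \<in> T" "t \<le> s"
    by blast
  moreover have "t \<noteq> s"
    using disj s \<open>t \<in> T\<close> by blast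
  ultimately have "a < s"
    using T by (meson atLeastAtMost_iff order_le_less_trans order_neq_le_trans subsetD)
  have "card {x \<in> S. x \<le> s - 1} < card S"
    by (rule psubset_card_mono[OF fin]) (use s in auto)
  hence "card {t \<in> T. t \<le> s - 1} < card T"
    using *(2)[of "s - 1"] i by (simp add: interlaces_def)
  hence "{t \<in> T. t \<le> s - 1} \<noteq> T"
    by (metis less_irrefl)
  then obtain t' where "t' \<in> T" "\<not> t' \<le> s - 1"
    by blast
  moreover have "t' \<noteq> s"
    using disj s \<open>t' \<in> T\<close> by blast
  ultimately have "s < t'" "t' \<le> b"
    using T by auto
  thus "s \<in> {a<..<b}"
    using \<open>a < s\<close> by simp
qed

section \<open>Generating functions of the pieces\<close>

text \<open>\<open>M_cut\<close> yields a sum over subsets of the admissible heights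
  \<open>C\<close>; the interlacing sums run over all finite sets of one parity. They have the same
  nonzero terms once interlacing sets of size \<open>k\<close> lie in \<open>C\<close>. If
  \<open>T\<close> has the wrong size, no term survives.\<close>

lemma sum_Pow_interlacing:
  fixes f v :: "int set \<Rightarrow> 'a::field"
  assumes C: "finite C" "C \<subseteq> {s. odd (s - r)}"
    and sub: "\<And>S. finite S \<Longrightarrow> interlaces S T \<Longrightarrow> card S = k \<Longrightarrow> S \<subseteq> {s. odd (s - r)} \<Longrightarrow> S \<subseteq> C"
  shows "(\<Sum>S\<in>Pow C. f S * ((if interlaces S T then 1 else 0) * (if card S = k then v S else 0)))
    = (if card T = Suc k then \<Sum>S | S \<subseteq> {s. odd (s - r)} \<and> finite S \<and> interlaces S T. f S * v S else 0)"
proof (cases "card T = Suc k")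
  case True
  have "(\<Sum>S | S \<subseteq> {s. odd (s - r)} \<and> finite S \<and> interlaces S T. f S * v S)
      = (\<Sum>S\<in>Pow C. f S * ((if interlaces S T then 1 else 0) * (if card S = k then v S else 0)))"
  proof (rule sum.mono_neutral_cong_left)
    show "finite (Pow C)"
      using C by simp
    show "{S. S \<subseteq> {s. odd (s - r)} \<and> finite S \<and> interlaces S T} \<subseteq> Pow C"
      using sub True by (auto simp: interlaces_def)
    show "\<forall>S\<in>Pow C - {S. S \<subseteq> {s. odd (s - r)} \<and> finite S \<and> interlaces S T}.
        f S * ((if interlaces S T then 1 else 0) * (if card S = k then v S else 0)) = 0"
      using C finite_subset by auto
    show "f S * v S = f S * ((if interlaces S T then 1 else 0) * (if card S = k then v S else 0))"
      if "S \<in> {S. S \<subseteq> {s. odd (s - r)} \<and> finite S \<and> interlaces S T}" for S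
      using that True by (simp add: interlaces_def)
  qed
  thus ?thesis
    using True by simp
next
  case False
  hence "(\<Sum>S\<in>Pow C. f S * ((if interlaces S T then 1 else 0) * (if card S = k then v S else 0))) = 0"
    by (intro sum.neutral) (auto simp: interlaces_def)
  thus ?thesis
    using False by simp
qed

definition trapezoid :: "int \<Rightarrow> int \<Rightarrow> nat \<Rightarrow> triangle set" where
  "trapezoid a h k = {(c, y). a \<le> c \<and> c < a + int k \<and> \<bar>y\<bar> \<le> h - (c - a)}"

lemma finite_trapezoid: "finite (trapezoid a h k)"
  by (rule finite_subset[of _ "{a..a + int k} \<times> {-h..h}"]) (auto simp: trapezoid_def)

text \<open>Heights start at 1 because row 0 is the intrusion. \<open>g\<close> is the i-coordinate
  of the upper end of the left side.\<close>

definition upper_part :: "int \<Rightarrow> nat \<Rightarrow> triangle set" where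
  "upper_part g k = {(c, y). 0 \<le> c \<and> c < int k \<and> 1 \<le> y \<and> y \<le> g + c}"

lemma finite_upper_part: "finite (upper_part g k)"
  by (rule finite_subset[of _ "{0..int k} \<times> {1..g + int k}"]) (auto simp: upper_part_def)

lemma vprod_empty [simp]: "vprod x {} = 1"
  by (simp add: vprod_def)

context
  fixes q :: "'a::linordered_field"
  assumes q: "1 < q"
begin

text \<open>The leftmost column is peeled off: it is a strip with dents \<open>T\<close> on its left
  line and crossings \<open>S\<close> on its right line. \<open>int k \<le> h + 1\<close> keeps
  every column nonempty. For \<open>k = 0\<close> there is no triangle that a dent could remove, so
  \<open>T\<close> has to be empty.\<close>

lemma M_trapezoid:
  assumes "int k \<le> h + 1" "odd (h + a)" "T \<subseteq> {y. \<bar>y\<bar> \<le> h \<and> even (y - h)}" "k = 0 \<Longrightarrow> T = {}"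
  shows "M q (trapezoid a h k - Pair a ` T, {})
    = (if card T = k then vprod (\<lambda>y. qnum q y / 2) T / (\<Prod>i\<in>{1..<k}. qfact q i) else 0)"
  using assms
proof (induction k arbitrary: a h T)
  case 0
  moreover have "trapezoid a h 0 = {}"
    by (auto simp: trapezoid_def image_iff)
  ultimately show ?case
    by simp
next
  case (Suc k)
  let ?x = "\<lambda>y. qnum q y / 2"
  let ?X = "trapezoid a h (Suc k) - Pair a ` T"
  define C where "C = {y. odd (a + 1 + y) \<and> (a + 1 - 1, y) \<in> ?X \<and> (a + 1, y) \<in> ?X \<and> vertical_segment (a + 1) y \<notin> {}}"
  have C: "y \<in> C \<longleftrightarrow> odd (y - h) \<and> \<bar>y\<bar> \<le> h - 1 \<and> 0 < k" for y
  proof -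
    have "even (y - h) \<longleftrightarrow> odd (a + y)"
      using Suc.prems(2) by presburger
    thus ?thesis
      using Suc.prems(3) by (auto simp: C_def trapezoid_def)
  qed
  have finC: "finite C"
    by (rule finite_subset[of _ "{-h..h}"]) (auto simp: C)
  have Th: "T \<subseteq> {-h..h}"
  proof
    fix t assume "t \<in> T"
    hence "\<bar>t\<bar> \<le> h"
      using Suc.prems(3) by blast
    thus "t \<in> {-h..h}"
      by auto
  qed
  have finT: "finite T"
    using Th finite_subset by blast
  have h: "0 \<le> h"
    using Suc.prems(1) by simp
  have "M q (?X, {}) = (\<Sum>S\<in>Pow C. prod (qplus q) S *
    (M q ({t \<in> ?X. fst t < a + 1} - Pair (a + 1 - 1) ` S, {}) * M q ({t \<in> ?X. a + 1 \<le> fst t} - Pair (a + 1) ` S, {})))"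
    unfolding C_def by (rule M_cut) (simp add: finite_trapezoid)
  also have "\<dots> = (\<Sum>S\<in>Pow C. prod (qplus q) S *
    ((if interlaces S T then 1 else 0) * (if card S = k then vprod ?x S / (\<Prod>i\<in>{1..<k}. qfact q i) else 0)))"
  proof (intro sum.cong refl arg_cong2[of _ _ _ _ "(*)"])
    fix S assume "S \<in> Pow C"
    hence S: "S \<subseteq> C" by simp
    have "{t \<in> ?X. fst t < a + 1} - Pair (a + 1 - 1) ` S = Pair a ` ({-h..h} - T - S)"
      by (auto simp: trapezoid_def image_iff)
    moreover have "s \<in> {-h..h}" if "s \<in> S" for s
    proof -
      have "\<bar>s\<bar> \<le> h - 1"
        using that S C by blast
      thus ?thesis by auto
    qed
    hence "S \<subseteq> {-h..h}"
      by blast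
    hence "strip (- h) h S T"
      using h S Suc.prems(3) Th by unfold_locales (auto simp: C)
    ultimately show "M q ({t \<in> ?X. fst t < a + 1} - Pair (a + 1 - 1) ` S, {}) = (if interlaces S T then 1 else 0)"
      by (simp add: strip.M_strip)
    have "{t \<in> ?X. a + 1 \<le> fst t} - Pair (a + 1) ` S = trapezoid (a + 1) (h - 1) k - Pair (a + 1) ` S"
      by (auto simp: trapezoid_def image_iff)
    moreover have "M q (trapezoid (a + 1) (h - 1) k - Pair (a + 1) ` S, {})
        = (if card S = k then vprod ?x S / (\<Prod>i\<in>{1..<k}. qfact q i) else 0)"
      using S Suc.prems by (intro Suc.IH) (auto simp: C)
    ultimately show "M q ({t \<in> ?X. a + 1 \<le> fst t} - Pair (a + 1) ` S, {})
        = (if card S = k then vprod ?x S / (\<Prod>i\<in>{1..<k}. qfact q i) else 0)"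
      by simp
  qed
  also have "\<dots> = (if card T = Suc k then \<Sum>S | S \<subseteq> {s. odd (s - h)} \<and> finite S \<and> interlaces S T.
      prod (qplus q) S * (vprod ?x S / (\<Prod>i\<in>{1..<k}. qfact q i)) else 0)"
  proof (rule sum_Pow_interlacing[OF finC])
    fix S assume S: "finite S" "interlaces S T" "card S = k" "S \<subseteq> {s. odd (s - h)}"
    have "S \<inter> T = {}"
      using S(4) Suc.prems(3) by auto
    hence "S \<subseteq> {-h<..<h}"
      using Th S by (intro interlaces_within) auto
    moreover have "S = {}" if "k = 0"
      using S that by simp
    ultimately show "S \<subseteq> C"
      using S(4) by (fastforce simp: C)
  qed (auto simp: C)
  also have "\<dots> = (if card T = Suc k then vprod ?x T / (\<Prod>i\<in>{1..<Suc k}. qfact q i) else 0)"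
  proof -
    have "(\<Sum>S | S \<subseteq> {s. odd (s - h)} \<and> finite S \<and> interlaces S T.
        prod (qplus q) S * (vprod ?x S / (\<Prod>i\<in>{1..<k}. qfact q i)))
      = vprod ?x T / qfact q k / (\<Prod>i\<in>{1..<k}. qfact q i)" if "card T = Suc k"
    proof -
      have "even (t - h)" if "t \<in> T" for t
        using Suc.prems(3) that by blast
      from trapezoid_step[OF q finT that this] show ?thesis
        by (simp flip: sum_divide_distrib)
    qed
    moreover have "(\<Prod>i\<in>{1..<Suc k}. qfact q i) = (\<Prod>i\<in>{1..<k}. qfact q i) * qfact q k"
      by (cases k) (simp_all add: qfact_def)
    ultimately show ?thesis
      by (simp add: mult.commute)
  qed
  finally show ?case .
qed

text \<open>The constants of the two kinds of left strips belong together: one supplies the odd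
  q-numbers, the other the even ones, and the powers of 2 cancel.\<close>

lemma qfact_even_split:
  "(\<Prod>j<k. inverse (2 * qnum q (int (2 * j + 1)))) * (\<Prod>j<k. 2 / qnum q (int (2 * Suc j)))
    = inverse (qfact q (2 * k))"
proof (induction k)
  case (Suc k)
  have "qfact q (2 * Suc k) = qfact q (2 * k) * (qnum q (int (2 * k + 1)) * qnum q (int (2 * Suc k)))"
    by (simp add: qfact_def mult.assoc)
  moreover have *: "(A * inverse (2 * a)) * (B * (2 / b)) = (A * B) * inverse (a * b)" for A B a b :: 'a
    by (simp add: field_simps)
  ultimately show ?case
    unfolding prod.lessThan_Suc * Suc by simp
qed (simp add: qfact_def)

text \<open>Two columns are added at a time, since the dents alternate between odd and even heights.
  In between, \<open>mid\<close> has an odd number of columns and carries the additional factor of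
  the \<open>qnum q s\<close>.\<close>

lemma M_upper_part:
  assumes "0 \<le> g" "even g" "T \<subseteq> {y. odd y \<and> 1 \<le> y \<and> y \<le> g + 2 * int k - 1}" "k = 0 \<Longrightarrow> T = {}"
  shows "M q (upper_part g (2 * k) - Pair (2 * int k - 1) ` T, {})
    = (if card T = k then vprod (cosh_coord q) T / (\<Prod>i=1..k. qfact q (2 * i - 2)) else 0)"
  using assms
proof (induction k arbitrary: T)
  case 0
  moreover have "upper_part g 0 = {}"
    by (auto simp: upper_part_def image_iff)
  ultimately show ?case
    by simp
next
  case (Suc k)
  define \<kappa> where "\<kappa> = (\<Prod>i=1..k. qfact q (2 * i - 2))"
  define \<mu> where "\<mu> = (\<Prod>j<k. inverse (2 * qnum q (int (2 * j + 1))))"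
  have mid: "M q (upper_part g (2 * k + 1) - Pair (2 * int k) ` S, {})
      = (if card S = k then \<mu> * (\<Prod>s\<in>S. qnum q s) * vprod (cosh_coord q) S / \<kappa> else 0)"
    if S: "S \<subseteq> {y. even y \<and> 1 \<le> y \<and> y \<le> g + 2 * int k}" for S
  proof -
    let ?X = "upper_part g (2 * k + 1) - Pair (2 * int k) ` S"
    define C where "C = {y. odd (2 * int k + y) \<and> (2 * int k - 1, y) \<in> ?X \<and> (2 * int k, y) \<in> ?X
      \<and> vertical_segment (2 * int k) y \<notin> {}}"
    have C: "y \<in> C \<longleftrightarrow> odd y \<and> 1 \<le> y \<and> y \<le> g + 2 * int k - 1 \<and> 0 < k" for y
      using S by (auto simp: C_def upper_part_def)
    have finC: "finite C"
      by (rule finite_subset[of _ "{0..g + 2 * int k}"]) (auto simp: C)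
    have finS: "finite S"
      by (rule finite_subset[of _ "{0..g + 2 * int k}"]) (use S in auto)
    have "M q (?X, {}) = (\<Sum>X\<in>Pow C. prod (qplus q) X *
      (M q ({t \<in> ?X. fst t < 2 * int k} - Pair (2 * int k - 1) ` X, {}) *
       M q ({t \<in> ?X. 2 * int k \<le> fst t} - Pair (2 * int k) ` X, {})))"
      unfolding C_def by (rule M_cut) (simp add: finite_upper_part)
    also have "\<dots> = (\<Sum>X\<in>Pow C. prod (qplus q) X *
      ((if interlaces X (insert 0 S) then 1 else 0) * (if card X = k then vprod (cosh_coord q) X / \<kappa> else 0)))"
    proof (rule sum.cong[OF refl], rule arg_cong2[of _ _ _ _ "(*)", OF refl])
      fix X assume "X \<in> Pow C"
      hence X: "X \<subseteq> C" by simp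
      \<comment> \<open>The column begins at height 1. Treating the missing height 0 as a dent lets
        it begin at 0, so that both ends are even as \<open>strip\<close> demands, and supplies the
        extra dent of \<open>top_even_step\<close>.\<close>
      have 1: "{t \<in> ?X. 2 * int k \<le> fst t} - Pair (2 * int k) ` X
          = Pair (2 * int k) ` ({0..g + 2 * int k} - insert 0 S - X)"
        by (auto simp: upper_part_def image_iff)
      have 2: "strip 0 (g + 2 * int k) X (insert 0 S)"
        using S X Suc.prems(1,2) by unfold_locales (auto simp: C)
      have 3: "{t \<in> ?X. fst t < 2 * int k} - Pair (2 * int k - 1) ` X
          = upper_part g (2 * k) - Pair (2 * int k - 1) ` X"
        by (auto simp: upper_part_def image_iff)
      have 4: "M q (upper_part g (2 * k) - Pair (2 * int k - 1) ` X, {})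
          = (if card X = k then vprod (cosh_coord q) X / \<kappa> else 0)"
        unfolding \<kappa>_def using X Suc.prems(1,2) by (intro Suc.IH) (auto simp: C)
      show "M q ({t \<in> ?X. fst t < 2 * int k} - Pair (2 * int k - 1) ` X, {}) *
          M q ({t \<in> ?X. 2 * int k \<le> fst t} - Pair (2 * int k) ` X, {})
        = (if interlaces X (insert 0 S) then 1 else 0) * (if card X = k then vprod (cosh_coord q) X / \<kappa> else 0)"
        unfolding 1 3 4 strip.M_strip[OF 2] by (rule mult.commute)
    qed
    also have "\<dots> = (if card (insert 0 S) = Suc k then
        \<Sum>X | X \<subseteq> {s. odd (s - 0)} \<and> finite X \<and> interlaces X (insert 0 S).
        prod (qplus q) X * (vprod (cosh_coord q) X / \<kappa>) else 0)"
    proof (rule sum_Pow_interlacing[OF finC])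
      fix X assume X: "finite X" "interlaces X (insert 0 S)" "card X = k" "X \<subseteq> {s. odd (s - 0)}"
      have "X \<inter> insert 0 S = {}"
        using X(4) S by auto
      hence "X \<subseteq> {0<..<g + 2 * int k}"
        using S X Suc.prems(1) by (intro interlaces_within) auto
      moreover have "X = {}" if "k = 0"
        using X that by simp
      ultimately show "X \<subseteq> C"
        using X(4) by (fastforce simp: C)
    qed (auto simp: C)
    also have "card (insert 0 S) = Suc k \<longleftrightarrow> card S = k"
      using finS S by (subst card_insert_disjoint) auto
    also have "(if card S = k then \<Sum>X | X \<subseteq> {s. odd (s - 0)} \<and> finite X \<and> interlaces X (insert 0 S).
        prod (qplus q) X * (vprod (cosh_coord q) X / \<kappa>) else 0)
      = (if card S = k then \<mu> * (\<Prod>s\<in>S. qnum q s) * vprod (cosh_coord q) S / \<kappa> else 0)"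
    proof -
      have "0 < t \<and> even t" if "t \<in> S" for t
        using S that by auto
      from top_even_step[OF q finS _ this] show ?thesis
        by (simp add: \<mu>_def flip: sum_divide_distrib)
    qed
    finally show ?thesis .
  qed
  let ?X = "upper_part g (2 * Suc k) - Pair (2 * int (Suc k) - 1) ` T"
  define C where "C = {y. odd (2 * int k + 1 + y) \<and> (2 * int k + 1 - 1, y) \<in> ?X \<and> (2 * int k + 1, y) \<in> ?X
    \<and> vertical_segment (2 * int k + 1) y \<notin> {}}"
  have C: "y \<in> C \<longleftrightarrow> even y \<and> 1 \<le> y \<and> y \<le> g + 2 * int k" for y
    using Suc.prems(3) by (auto simp: C_def upper_part_def)
  have finC: "finite C"
    by (rule finite_subset[of _ "{0..g + 2 * int k}"]) (auto simp: C)
  have finT: "finite T"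
    by (rule finite_subset[of _ "{0..g + 2 * int (Suc k) - 1}"]) (use Suc.prems(3) in auto)
  have "M q (?X, {}) = (\<Sum>S\<in>Pow C. prod (qplus q) S *
    (M q ({t \<in> ?X. fst t < 2 * int k + 1} - Pair (2 * int k + 1 - 1) ` S, {}) *
     M q ({t \<in> ?X. 2 * int k + 1 \<le> fst t} - Pair (2 * int k + 1) ` S, {})))"
    unfolding C_def by (rule M_cut) (simp add: finite_upper_part)
  also have "\<dots> = (\<Sum>S\<in>Pow C. prod (qplus q) S * ((if interlaces S T then 1 else 0) *
      (if card S = k then \<mu> * (\<Prod>s\<in>S. qnum q s) * vprod (cosh_coord q) S / \<kappa> else 0)))"
  proof (rule sum.cong[OF refl], rule arg_cong2[of _ _ _ _ "(*)", OF refl])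
    fix S assume "S \<in> Pow C"
    hence S: "S \<subseteq> C" by simp
    have 1: "{t \<in> ?X. 2 * int k + 1 \<le> fst t} - Pair (2 * int k + 1) ` S
        = Pair (2 * int k + 1) ` ({1..g + 2 * int k + 1} - T - S)"
      by (auto simp: upper_part_def image_iff)
    have 2: "strip 1 (g + 2 * int k + 1) S T"
      using S Suc.prems(1-3) by unfold_locales (auto simp: C)
    have 3: "{t \<in> ?X. fst t < 2 * int k + 1} - Pair (2 * int k + 1 - 1) ` S
        = upper_part g (2 * k + 1) - Pair (2 * int k) ` S"
      by (auto simp: upper_part_def image_iff)
    have 4: "S \<subseteq> {y. even y \<and> 1 \<le> y \<and> y \<le> g + 2 * int k}"
      using S C by auto
    show "M q ({t \<in> ?X. fst t < 2 * int k + 1} - Pair (2 * int k + 1 - 1) ` S, {}) *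
        M q ({t \<in> ?X. 2 * int k + 1 \<le> fst t} - Pair (2 * int k + 1) ` S, {})
      = (if interlaces S T then 1 else 0) *
        (if card S = k then \<mu> * (\<Prod>s\<in>S. qnum q s) * vprod (cosh_coord q) S / \<kappa> else 0)"
      unfolding 1 3 mid[OF 4] strip.M_strip[OF 2] by (rule mult.commute)
  qed
  also have "\<dots> = (if card T = Suc k then \<Sum>S | S \<subseteq> {s. odd (s - 1)} \<and> finite S \<and> interlaces S T.
      prod (qplus q) S * (\<mu> * (\<Prod>s\<in>S. qnum q s) * vprod (cosh_coord q) S / \<kappa>) else 0)"
  proof (rule sum_Pow_interlacing[OF finC])
    fix S assume S: "finite S" "interlaces S T" "card S = k" "S \<subseteq> {s. odd (s - 1)}"
    have "S \<inter> T = {}"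
      using S(4) Suc.prems(3) by auto
    hence "S \<subseteq> {1<..<g + 2 * int k + 1}"
      using Suc.prems(3) S by (intro interlaces_within) auto
    thus "S \<subseteq> C"
      using S(4) by (fastforce simp: C)
  qed (auto simp: C)
  also have "\<dots> = (if card T = Suc k then vprod (cosh_coord q) T / (\<Prod>i=1..Suc k. qfact q (2 * i - 2)) else 0)"
  proof (cases "card T = Suc k")
    case True
    have "(\<Sum>S | S \<subseteq> {s. odd (s - 1)} \<and> finite S \<and> interlaces S T.
        prod (qplus q) S * (\<mu> * (\<Prod>s\<in>S. qnum q s) * vprod (cosh_coord q) S / \<kappa>))
      = \<mu> / \<kappa> * (\<Sum>S | S \<subseteq> {s. odd (s - 1)} \<and> finite S \<and> interlaces S T.
          prod (\<lambda>s. qplus q s * qnum q s) S * vprod (cosh_coord q) S)"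
      unfolding sum_distrib_left by (intro sum.cong refl) (simp add: prod.distrib)
    also have "\<dots> = \<mu> / \<kappa> * ((\<Prod>j<k. 2 / qnum q (int (2 * Suc j))) * vprod (cosh_coord q) T)"
      using Suc.prems(3) by (subst top_odd_step[OF q finT True]) auto
    also have "\<dots> = (\<mu> * (\<Prod>j<k. 2 / qnum q (int (2 * Suc j)))) * vprod (cosh_coord q) T / \<kappa>"
      by simp
    also have "\<dots> = vprod (cosh_coord q) T / (\<kappa> * qfact q (2 * k))"
      unfolding \<mu>_def qfact_even_split by (simp add: field_simps)
    finally show ?thesis
      using True by (simp add: \<kappa>_def)
  qed simp
  finally show ?case .
qed

end

section \<open>Flipping a symmetric set of dents\<close>

text \<open>Absolute values make the position of the new element in the order irrelevant.\<close>

lemma vprod_insert_abs: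
  fixes x :: "'b::linorder \<Rightarrow> 'a::linordered_idom"
  assumes "finite A" "a \<notin> A"
  shows "\<bar>vprod x (insert a A)\<bar> = \<bar>vprod x A\<bar> * (\<Prod>b\<in>A. \<bar>x a - x b\<bar>)"
proof -
  let ?P = "\<lambda>A. {(a, b). a \<in> A \<and> b \<in> A \<and> a < b}"
  let ?g = "\<lambda>(a, b). x b - x a"
  have fin: "finite (?P A)"
    by (rule finite_subset[of _ "A \<times> A"]) (use assms in auto)
  let ?D = "(\<lambda>b. (b, a)) ` {b \<in> A. b < a}" and ?U = "Pair a ` {b \<in> A. \<not> b < a}"
  have "?P (insert a A) = ?P A \<union> (?D \<union> ?U)"
    using assms(2) by (auto simp: not_less order.strict_iff_order)
  moreover have "?P A \<inter> (?D \<union> ?U) = {}" "?D \<inter> ?U = {}"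
    using assms(2) by auto
  ultimately have "vprod x (insert a A) = vprod x A * (prod ?g ?D * prod ?g ?U)"
    unfolding vprod_def using assms(1) fin by (simp add: prod.union_disjoint)
  hence "\<bar>vprod x (insert a A)\<bar> = \<bar>vprod x A\<bar> * ((\<Prod>b | b \<in> A \<and> b < a. \<bar>x a - x b\<bar>) * (\<Prod>b | b \<in> A \<and> \<not> b < a. \<bar>x a - x b\<bar>))"
    by (simp add: abs_mult abs_prod prod.reindex inj_on_def abs_minus_commute)
  also have "(\<Prod>b | b \<in> A \<and> b < a. \<bar>x a - x b\<bar>) * (\<Prod>b | b \<in> A \<and> \<not> b < a. \<bar>x a - x b\<bar>)
      = (\<Prod>b\<in>{b \<in> A. b < a} \<union> {b \<in> A. \<not> b < a}. \<bar>x a - x b\<bar>)"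
    by (rule prod.union_disjoint[symmetric]) (use assms(1) in auto)
  also have "{b \<in> A. b < a} \<union> {b \<in> A. \<not> b < a} = A"
    by auto
  finally show ?thesis .
qed

lemma vprod_Un_abs:
  fixes x :: "'b::linorder \<Rightarrow> 'a::linordered_idom"
  assumes "finite A" "finite B" "A \<inter> B = {}"
  shows "\<bar>vprod x (A \<union> B)\<bar> = \<bar>vprod x A\<bar> * \<bar>vprod x B\<bar> * (\<Prod>a\<in>A. \<Prod>b\<in>B. \<bar>x a - x b\<bar>)"
  using assms(1,3)
proof (induction A rule: finite_induct)
  case (insert a A)
  have "\<bar>vprod x (insert a A \<union> B)\<bar> = \<bar>vprod x (A \<union> B)\<bar> * (\<Prod>b\<in>A \<union> B. \<bar>x a - x b\<bar>)"
    using insert assms(2) vprod_insert_abs[of "A \<union> B" a x] by simp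
  also have "(\<Prod>b\<in>A \<union> B. \<bar>x a - x b\<bar>) = (\<Prod>b\<in>A. \<bar>x a - x b\<bar>) * (\<Prod>b\<in>B. \<bar>x a - x b\<bar>)"
    using insert assms(2) by (intro prod.union_disjoint) auto
  finally show ?case
    using insert vprod_insert_abs[of A a x] by (simp add: mult_ac)
qed simp

lemma vprod_uminus_abs:
  fixes x :: "'b::linordered_ab_group_add \<Rightarrow> 'a::linordered_idom"
  assumes "finite A" "\<And>a. x (- a) = x a"
  shows "\<bar>vprod x (uminus ` A)\<bar> = \<bar>vprod x A\<bar>"
  using assms(1)
proof (induction A rule: finite_induct)
  case (insert a A)
  have "(\<Prod>b\<in>uminus ` A. \<bar>x (- a) - x b\<bar>) = (\<Prod>b\<in>A. \<bar>x a - x b\<bar>)"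
    by (simp add: prod.reindex assms(2))
  moreover have "- a \<notin> uminus ` A"
    using insert by auto
  ultimately show ?case
    using insert vprod_insert_abs[of A a x] vprod_insert_abs[of "uminus ` A" "- a" x] by simp
qed simp

lemma vprod_pos:
  fixes x :: "'b::linorder \<Rightarrow> 'a::linordered_idom"
  assumes "\<And>a b. a \<in> A \<Longrightarrow> b \<in> A \<Longrightarrow> a < b \<Longrightarrow> x a < x b"
  shows "0 < vprod x A"
  unfolding vprod_def using assms by (intro prod_pos) auto

text \<open>The flip uses only that the coordinate \<open>qnum q y / 2\<close> is odd and strictly
  increasing.\<close>

locale odd_monotone =
  fixes x :: "int \<Rightarrow> 'a::linordered_field"
  assumes odd: "x (- a) = - x a" and mono: "a < b \<Longrightarrow> x a < x b"
begin

definition V :: "int set \<Rightarrow> 'a" where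
  "V A = \<bar>vprod x A\<bar>"

text \<open>The parts above and below the intrusion contribute separately, so no factor links a
  positive to a negative dent.\<close>

definition W :: "int set \<Rightarrow> 'a" where
  "W A = \<bar>vprod (\<lambda>a. (x a)\<^sup>2) {a \<in> A. 0 < a}\<bar> * \<bar>vprod (\<lambda>a. (x a)\<^sup>2) {a \<in> A. a < 0}\<bar>"

text \<open>The factors \<open>x f - x (- f)\<close> between the two members of a pair, which occur
  in \<open>V\<close> but not in \<open>W\<close>.\<close>

definition Y :: "int set \<Rightarrow> 'a" where
  "Y F = (\<Prod>f | f \<in> F \<and> 0 < f. 2 * x f)"

lemma x_pos: "0 < a \<Longrightarrow> 0 < x a"
  using odd[of 0] mono[of 0 a] by simp

lemma V_pos: "0 < V A"
proof -
  have "0 < vprod x A"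
    using mono by (intro vprod_pos)
  thus ?thesis by (simp add: V_def)
qed

lemma Y_pos: "0 < Y F"
  unfolding Y_def using x_pos by (intro prod_pos) auto

lemma V_pair:
  assumes "finite A" "f \<notin> A" "- f \<notin> A" "0 < f"
  shows "V (A \<union> {f, - f}) = V A * (2 * x f) * (\<Prod>a\<in>A. \<bar>(x a)\<^sup>2 - (x f)\<^sup>2\<bar>)"
proof -
  have "V (A \<union> {f, - f}) = \<bar>vprod x (insert f (insert (- f) A))\<bar>"
    by (simp add: V_def)
  also have "\<dots> = V A * (\<Prod>a\<in>A. \<bar>x (- f) - x a\<bar>) * (\<Prod>b\<in>insert (- f) A. \<bar>x f - x b\<bar>)"
    using assms by (simp add: V_def vprod_insert_abs del: prod.insert)
  also have "(\<Prod>b\<in>insert (- f) A. \<bar>x f - x b\<bar>) = 2 * x f * (\<Prod>a\<in>A. \<bar>x f - x a\<bar>)"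
    using assms x_pos[of f] by (simp add: odd)
  also have "V A * (\<Prod>a\<in>A. \<bar>x (- f) - x a\<bar>) * (2 * x f * (\<Prod>a\<in>A. \<bar>x f - x a\<bar>))
      = V A * (2 * x f) * (\<Prod>a\<in>A. \<bar>x (- f) - x a\<bar> * \<bar>x f - x a\<bar>)"
    by (simp add: prod.distrib)
  also have "(\<Prod>a\<in>A. \<bar>x (- f) - x a\<bar> * \<bar>x f - x a\<bar>) = (\<Prod>a\<in>A. \<bar>(x a)\<^sup>2 - (x f)\<^sup>2\<bar>)"
    unfolding abs_mult[symmetric] by (simp add: odd power2_eq_square algebra_simps)
  finally show ?thesis .
qed

text \<open>Each \<open>a\<close> meets only the one of \<open>f\<close> and \<open>- f\<close> that
  has its sign, and squaring hides which one it was. So every \<open>a\<close> contributes exactly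
  one factor.\<close>

lemma W_pair:
  assumes "finite A" "f \<notin> A" "- f \<notin> A" "0 < f" "0 \<notin> A"
  shows "W (A \<union> {f, - f}) = W A * (\<Prod>a\<in>A. \<bar>(x a)\<^sup>2 - (x f)\<^sup>2\<bar>)"
proof -
  have 1: "{a \<in> A \<union> {f, - f}. 0 < a} = insert f {a \<in> A. 0 < a}"
    "{a \<in> A \<union> {f, - f}. a < 0} = insert (- f) {a \<in> A. a < 0}"
    using assms(4) by auto
  have "a \<noteq> 0" if "a \<in> A" for a
    using assms(5) that by metis
  hence "A = {a \<in> A. 0 < a} \<union> {a \<in> A. a < 0}"
    by (auto simp: neq_iff)
  hence "(\<Prod>a\<in>A. \<bar>(x a)\<^sup>2 - (x f)\<^sup>2\<bar>)
      = (\<Prod>a\<in>{a \<in> A. 0 < a} \<union> {a \<in> A. a < 0}. \<bar>(x f)\<^sup>2 - (x a)\<^sup>2\<bar>)"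
    by (simp add: abs_minus_commute)
  also have "\<dots> = (\<Prod>a | a \<in> A \<and> 0 < a. \<bar>(x f)\<^sup>2 - (x a)\<^sup>2\<bar>) * (\<Prod>a | a \<in> A \<and> a < 0. \<bar>(x f)\<^sup>2 - (x a)\<^sup>2\<bar>)"
    by (rule prod.union_disjoint) (use assms(1) in auto)
  finally show ?thesis
    unfolding W_def 1 using assms by (simp add: vprod_insert_abs odd mult_ac)
qed

text \<open>
  For a pair \<open>\<plusminus>f\<close> the factors \<open>x a - x f\<close> and \<open>x a - x (- f)\<close> combine to \<open>(x a)\<^sup>2 - (x f)\<^sup>2\<close>. Thus
  \<open>V\<close> and \<open>W\<close> change in the same way, up to the factor \<open>2 x f\<close> from the pair itself.
\<close>

lemma W_symmetric:
  assumes fin: "finite A" "finite F" and sym: "F = uminus ` F" and "0 \<notin> A" "0 \<notin> F" and disj: "A \<inter> F = {}"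
  shows "W (A \<union> F) * V A * Y F = V (A \<union> F) * W A"
proof -
  \<comment> \<open>The induction runs over the positive members of the pairs: a further pair
    multiplies both sides by \<open>2 * x f\<close> and by the same product over the dents already
    present.\<close>
  have *: "W (A \<union> (G \<union> uminus ` G)) * V A * Y G = V (A \<union> (G \<union> uminus ` G)) * W A"
    if "finite G" "\<forall>g\<in>G. 0 < g" "A \<inter> (G \<union> uminus ` G) = {}" for G
    using that
  proof (induction G rule: finite_induct)
    case (insert f G)
    let ?B = "A \<union> (G \<union> uminus ` G)"
    have eq: "A \<union> (insert f G \<union> uminus ` insert f G) = ?B \<union> {f, - f}"
      by auto
    have f: "finite ?B" "f \<notin> ?B" "- f \<notin> ?B" "0 < f" "0 \<notin> ?B"
      using insert fin assms(4) by auto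
    have "{a. (a = f \<or> a \<in> G) \<and> 0 < a} = insert f {a. a \<in> G \<and> 0 < a}"
      using f by auto
    hence Yf: "Y (insert f G) = 2 * x f * Y G"
      unfolding Y_def using insert by simp
    let ?p = "\<Prod>a\<in>?B. \<bar>(x a)\<^sup>2 - (x f)\<^sup>2\<bar>"
    have "W (?B \<union> {f, - f}) * V A * Y (insert f G) = (W ?B * V A * Y G) * (2 * x f * ?p)"
      unfolding W_pair[OF f] Yf by (simp add: mult_ac)
    also have "\<dots> = (V ?B * W A) * (2 * x f * ?p)"
      using insert by simp
    also have "\<dots> = V (?B \<union> {f, - f}) * W A"
      unfolding V_pair[OF f(1-4)] by (simp add: mult_ac)
    finally show ?case
      unfolding eq .
  qed (simp add: Y_def)
  let ?G = "{f \<in> F. 0 < f}"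
  have "F \<subseteq> ?G \<union> uminus ` ?G"
  proof
    fix f assume f: "f \<in> F"
    hence "- f \<in> F" "f \<noteq> 0"
      using sym assms(5) by auto
    thus "f \<in> ?G \<union> uminus ` ?G"
      using f by (cases "0 < f") (auto intro!: image_eqI[of f uminus "- f"])
  qed
  moreover have "?G \<union> uminus ` ?G \<subseteq> F"
    using sym by auto
  ultimately have F: "?G \<union> uminus ` ?G = F"
    by blast
  have G: "finite ?G" "\<forall>g\<in>?G. 0 < g"
    using fin by auto
  have "Y ?G = Y F"
    by (simp add: Y_def)
  with *[OF G, unfolded F, OF disj] show ?thesis
    by (simp only:)
qed

text \<open>With \<open>A\<close> the left dents that stay, crossings included,
  \<open>W_symmetric\<close> expresses both values of \<open>W\<close> through \<open>V\<close> and
  the common \<open>V A\<close>, \<open>W A\<close>. The links to \<open>S\<close> enter as products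
  of \<open>g\<close> over left and right dents together, and the flip merely moves elements between
  the two sides.\<close>

lemma flip_ratio:
  assumes fin: "finite L\<^sub>1" "finite R\<^sub>1" "finite S"
    and FL: "F\<^sub>L \<subseteq> L\<^sub>1 - R\<^sub>1" "F\<^sub>L = uminus ` F\<^sub>L" and FR: "F\<^sub>R \<subseteq> R\<^sub>1 - L\<^sub>1" "F\<^sub>R = uminus ` F\<^sub>R"
    and zero: "0 \<notin> L\<^sub>1 \<union> R\<^sub>1 \<union> S" and S: "S \<inter> (L\<^sub>1 \<union> R\<^sub>1) = {}"
    and L2: "L\<^sub>2 = (L\<^sub>1 - F\<^sub>L) \<union> F\<^sub>R" and R2: "R\<^sub>2 = (R\<^sub>1 - F\<^sub>R) \<union> F\<^sub>L"
  shows "W (L\<^sub>2 \<union> S) * V (R\<^sub>2 \<union> S) * (Y F\<^sub>R * V L\<^sub>1 * V R\<^sub>1)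
    = W (L\<^sub>1 \<union> S) * V (R\<^sub>1 \<union> S) * (Y F\<^sub>L * V L\<^sub>2 * V R\<^sub>2)"
proof -
  define A where "A = (L\<^sub>1 - F\<^sub>L) \<union> S"
  have fin': "finite F\<^sub>L" "finite F\<^sub>R" "finite A" "finite L\<^sub>2" "finite R\<^sub>2"
    using fin FL(1) FR(1) finite_subset[of F\<^sub>L L\<^sub>1] finite_subset[of F\<^sub>R R\<^sub>1] by (auto simp: A_def L2 R2)
  have zero': "0 \<notin> A" "0 \<notin> F\<^sub>L" "0 \<notin> F\<^sub>R"
    using zero FL(1) FR(1) by (auto simp: A_def)
  have AL: "L\<^sub>1 \<union> S = A \<union> F\<^sub>L" "L\<^sub>2 \<union> S = A \<union> F\<^sub>R"
    using FL(1) by (auto simp: A_def L2)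
  have disj: "A \<inter> F\<^sub>L = {}" "A \<inter> F\<^sub>R = {}"
    using FL(1) FR(1) S by (auto simp: A_def)
  have WL: "W (L\<^sub>1 \<union> S) * V A * Y F\<^sub>L = V (L\<^sub>1 \<union> S) * W A"
    unfolding AL using fin' FL(2) zero' disj by (intro W_symmetric)
  have WR: "W (L\<^sub>2 \<union> S) * V A * Y F\<^sub>R = V (L\<^sub>2 \<union> S) * W A"
    unfolding AL using fin' FR(2) zero' disj by (intro W_symmetric)
  define g where "g a = (\<Prod>s\<in>S. \<bar>x a - x s\<bar>)" for a
  have split: "V (B \<union> S) = V B * V S * prod g B" if "B \<inter> S = {}" "finite B" for B
    unfolding V_def g_def using that fin by (intro vprod_Un_abs)
  have VL1: "V (L\<^sub>1 \<union> S) = V L\<^sub>1 * V S * prod g L\<^sub>1" and VR1: "V (R\<^sub>1 \<union> S) = V R\<^sub>1 * V S * prod g R\<^sub>1"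
    using S fin by (auto intro!: split)
  have VL2: "V (L\<^sub>2 \<union> S) = V L\<^sub>2 * V S * prod g L\<^sub>2" and VR2: "V (R\<^sub>2 \<union> S) = V R\<^sub>2 * V S * prod g R\<^sub>2"
    using S fin' FL(1) FR(1) by (auto simp: L2 R2 intro!: split)
  have "prod g L\<^sub>2 = prod g (L\<^sub>1 - F\<^sub>L) * prod g F\<^sub>R" "prod g R\<^sub>2 = prod g (R\<^sub>1 - F\<^sub>R) * prod g F\<^sub>L"
    unfolding L2 R2 using fin fin' FL(1) FR(1) by (subst prod.union_disjoint; auto)+
  moreover have "prod g L\<^sub>1 = prod g (L\<^sub>1 - F\<^sub>L) * prod g F\<^sub>L" "prod g R\<^sub>1 = prod g (R\<^sub>1 - F\<^sub>R) * prod g F\<^sub>R"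
    using fin FL(1) FR(1) by (auto intro!: prod.subset_diff)
  ultimately have g: "prod g L\<^sub>2 * prod g R\<^sub>2 = prod g L\<^sub>1 * prod g R\<^sub>1"
    by (simp add: mult_ac)
  \<comment> \<open>The factor \<open>V A\<close> makes \<open>W_symmetric\<close> applicable on
    both sides without division; it is positive and is cancelled at the end.\<close>
  have "(W (L\<^sub>2 \<union> S) * V (R\<^sub>2 \<union> S) * (Y F\<^sub>R * V L\<^sub>1 * V R\<^sub>1)) * V A
      = (W (L\<^sub>2 \<union> S) * V A * Y F\<^sub>R) * V (R\<^sub>2 \<union> S) * (V L\<^sub>1 * V R\<^sub>1)"
    by (simp add: mult_ac)
  also have "\<dots> = V L\<^sub>2 * V S * W A * V R\<^sub>2 * V S * V L\<^sub>1 * V R\<^sub>1 * (prod g L\<^sub>2 * prod g R\<^sub>2)"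
    unfolding WR VL2 VR2 by (simp add: mult_ac)
  also have "\<dots> = (V (L\<^sub>1 \<union> S) * W A) * V (R\<^sub>1 \<union> S) * (V L\<^sub>2 * V R\<^sub>2)"
    unfolding g VL1 VR1 by (simp add: mult_ac)
  also have "\<dots> = (W (L\<^sub>1 \<union> S) * V (R\<^sub>1 \<union> S) * (Y F\<^sub>L * V L\<^sub>2 * V R\<^sub>2)) * V A"
    unfolding WL[symmetric] by (simp add: mult_ac)
  finally show ?thesis
    using V_pos[of A] by simp
qed

end

section \<open>The region cut along the diagonal\<close>

text \<open>Testing the three vertices gives bounds that depend on the orientation. Where such a
  bound is smaller by 1 than stated, the parity of \<open>y\<close> excludes the value in between,
  so one bound per column serves both kinds of triangles.\<close>

lemma mem_hexagon_iff:
  "(c, y) \<in> hexagon m n \<alpha> \<beta> \<gamma> \<longleftrightarrow> 0 \<le> c \<and> c < diag m \<alpha> + int (2 * n + \<beta>) \<and>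
    (if c < diag m \<alpha> then \<bar>y\<bar> \<le> int (2 * n + 2 * \<gamma>) + c
     else \<bar>y\<bar> \<le> int (2 * n + 2 * \<gamma>) + 2 * diag m \<alpha> - c - 1)"
proof -
  define s where "s = int (2 * n + 2 * \<gamma>)"
  define a where "a = diag m \<alpha>"
  define b where "b = int (2 * n + \<beta>)"
  have *: "even s" "0 \<le> s" "even a" "0 \<le> b"
    by (auto simp: s_def a_def b_def diag_def)
  have hex: "hexagon m n \<alpha> \<beta> \<gamma> = {t. vertices t \<subseteq> hexagon_points s a b}"
    by (simp add: hexagon_def s_def a_def b_def diag_def)
  show ?thesis
    unfolding s_def[symmetric] a_def[symmetric] b_def[symmetric]
  proof (cases "even (c + y)")
    case True
    hence "(c, y) \<in> hexagon m n \<alpha> \<beta> \<gamma> \<longleftrightarrow> 0 \<le> c \<and> c + 1 \<le> a + b \<and> \<bar>y\<bar> \<le> s + c \<and> \<bar>y\<bar> \<le> s + 2 * a - c - 2"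
      unfolding hex by (auto simp: hexagon_points_def abs_le_iff)
    thus "(c, y) \<in> hexagon m n \<alpha> \<beta> \<gamma> \<longleftrightarrow> 0 \<le> c \<and> c < a + b \<and> (if c < a then \<bar>y\<bar> \<le> s + c else \<bar>y\<bar> \<le> s + 2 * a - c - 1)"
      using * True by (simp add: abs_le_iff) presburger
  next
    case False
    have "y \<noteq> s + c" "- y \<noteq> s + c"
      using False *(1) by presburger+
    from False have "(c, y) \<in> hexagon m n \<alpha> \<beta> \<gamma> \<longleftrightarrow> 0 \<le> c \<and> c + 1 \<le> a + b \<and> \<bar>y\<bar> \<le> s + c - 1 \<and> \<bar>y\<bar> \<le> s + 2 * a - c - 1"
      unfolding hex by (auto simp: hexagon_points_def abs_le_iff)
    thus "(c, y) \<in> hexagon m n \<alpha> \<beta> \<gamma> \<longleftrightarrow> 0 \<le> c \<and> c < a + b \<and> (if c < a then \<bar>y\<bar> \<le> s + c else \<bar>y\<bar> \<le> s + 2 * a - c - 1)"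
      using *(2,4) \<open>y \<noteq> s + c\<close> \<open>- y \<noteq> s + c\<close> by (auto simp: abs_le_iff)
  qed
qed

text \<open>The i-coordinates of diagonal segments, which are odd integers for labels. As a preimage
  the map respects unions, differences and inclusions without any injectivity argument.\<close>

definition heights :: "rat set \<Rightarrow> int set" where
  "heights L = {y. of_int y / 2 \<in> L}"

lemma mem_heights_iff: "y \<in> heights L \<longleftrightarrow> (\<exists>s\<in>L. of_int y = 2 * s)"
  by (auto simp: heights_def intro!: bexI[of _ "of_int y / 2"])

lemma heights_labels:
  assumes "L \<subseteq> labels N" "y \<in> heights L"
  shows "odd y" "\<bar>y\<bar> \<le> 2 * int N + 1"
proof -
  have y: "of_int y / 2 - 1 / 2 \<in> (\<int> :: rat set)" "\<bar>of_int y / 2 :: rat\<bar> \<le> of_nat N + 1 / 2"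
    using assms by (auto simp: heights_def labels_def)
  from y(1) obtain z where "of_int y / 2 - 1 / 2 = (of_int z :: rat)"
    by (auto elim: Ints_cases)
  hence "of_int y = (of_int (2 * z + 1) :: rat)"
    by (simp add: field_simps)
  hence "y = 2 * z + 1"
    by (simp only: of_int_eq_iff)
  thus "odd y" by simp
  have "of_int \<bar>y\<bar> \<le> (of_int (2 * int N + 1) :: rat)"
    using y(2) by (simp add: field_simps)
  thus "\<bar>y\<bar> \<le> 2 * int N + 1"
    by (simp only: of_int_le_iff)
qed

lemma abs_le_interval: "{y :: int. \<bar>y\<bar> \<le> c} = {- c..c}"
  by auto

lemma finite_heights:
  assumes "L \<subseteq> labels N"
  shows "finite (heights L)"
proof (rule finite_subset)
  show "heights L \<subseteq> {y. \<bar>y\<bar> \<le> 2 * int N + 1}"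
    using heights_labels(2)[OF assms] by blast
qed (simp add: abs_le_interval)

lemma heights_image:
  assumes "L \<subseteq> labels N"
  shows "L = (\<lambda>y. of_int y / 2) ` heights L"
proof -
  have "\<exists>y. s = of_int y / 2" if "s \<in> L" for s
  proof -
    obtain z where "s - 1 / 2 = of_int z"
      using assms \<open>s \<in> L\<close> by (auto simp: labels_def elim: Ints_cases)
    hence "s = of_int (2 * z + 1) / 2"
      by (simp add: field_simps)
    thus ?thesis by blast
  qed
  thus ?thesis
    unfolding heights_def by blast
qed

lemma inj_half: "inj_on (\<lambda>y :: int. of_int y / 2 :: rat) A"
  by (auto simp: inj_on_def)

lemma card_heights: "L \<subseteq> labels N \<Longrightarrow> card (heights L) = card L"
  using card_image[OF inj_half, of "heights L"] heights_image[of L N] by simp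

lemma heights_Un: "heights (A \<union> B) = heights A \<union> heights B"
  and heights_Diff: "heights (A - B) = heights A - heights B"
  by (auto simp: heights_def)

lemma heights_mono: "A \<subseteq> B \<Longrightarrow> heights A \<subseteq> heights B"
  by (auto simp: heights_def)

lemma heights_uminus: "F = uminus ` F \<Longrightarrow> heights F = uminus ` heights F"
proof -
  assume F: "F = uminus ` F"
  have "- y \<in> heights F" if "y \<in> heights F" for y
  proof -
    have "of_int y / 2 \<in> F"
      using that by (simp add: heights_def)
    hence "- (of_int y / 2) \<in> F"
      using F by blast
    thus ?thesis by (simp add: heights_def)
  qed
  thus ?thesis
    by (force intro: image_eqI[of _ uminus "- _"])
qed

lemma prod_labels:
  fixes g :: "int \<Rightarrow> 'a::comm_monoid_mult"
  assumes "L \<subseteq> labels N"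
  shows "(\<Prod>s\<in>L. g \<lfloor>2 * \<bar>s\<bar>\<rfloor>) = (\<Prod>y\<in>heights L. g \<bar>y\<bar>)"
proof -
  have "(\<Prod>s\<in>L. g \<lfloor>2 * \<bar>s\<bar>\<rfloor>) = (\<Prod>y\<in>heights L. g \<lfloor>2 * \<bar>of_int y / 2 :: rat\<bar>\<rfloor>)"
    by (subst heights_image[OF assms]) (simp add: prod.reindex inj_half)
  moreover have "\<lfloor>2 * \<bar>of_int y / 2 :: rat\<bar>\<rfloor> = \<bar>y\<bar>" for y
  proof -
    have "2 * \<bar>of_int y / 2 :: rat\<bar> = of_int \<bar>y\<bar>"
      by simp
    thus ?thesis
      by (simp only: floor_of_int)
  qed
  ultimately show ?thesis
    by (simp only:)
qed

lemma upper_part_reflect: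
  "(\<lambda>t. (fst t, - snd t)) ` (upper_part g k - Pair c ` T) = {(c, y). 0 \<le> c \<and> c < int k \<and> y \<le> - 1 \<and> - y \<le> g + c} - Pair c ` uminus ` T"
proof -
  have inj: "inj (\<lambda>t :: triangle. (fst t, - snd t))"
    by (auto simp: inj_def prod_eq_iff)
  have "(\<lambda>t. (fst t, - snd t)) ` upper_part g k = {(c, y). 0 \<le> c \<and> c < int k \<and> y \<le> - 1 \<and> - y \<le> g + c}"
  proof (intro equalityI subsetI)
    fix t :: triangle assume "t \<in> {(c, y). 0 \<le> c \<and> c < int k \<and> y \<le> - 1 \<and> - y \<le> g + c}"
    hence "(fst t, - snd t) \<in> upper_part g k"
      by (auto simp: upper_part_def)
    thus "t \<in> (\<lambda>t. (fst t, - snd t)) ` upper_part g k"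
      by (intro image_eqI[of _ _ "(fst t, - snd t)"]) auto
  qed (auto simp: upper_part_def)
  thus ?thesis
    unfolding image_set_diff[OF inj] by (simp add: image_image)
qed

context
  fixes q :: "'a::linordered_field"
  assumes q: "1 < q"
begin

lemma odd_monotone_qnum: "odd_monotone (\<lambda>y. qnum q y / 2)"
proof
  show "qnum q (- a) / 2 = - (qnum q a / 2)" for a
    by (simp add: qnum_minus[OF q])
  fix a b :: int assume "a < b"
  have "q powi a < q powi b"
    using \<open>a < b\<close> q by (intro power_int_strict_increasing)
  moreover have "q powi (- b) < q powi (- a)"
    using \<open>a < b\<close> q by (intro power_int_strict_increasing) auto
  ultimately have "qnum q a < qnum q b"
    unfolding qnum_def using q_minus_inverse_pos[OF q] by (simp add: divide_strict_right_mono)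
  thus "qnum q a / 2 < qnum q b / 2"
    by (simp add: divide_strict_right_mono)
qed

interpretation odd_monotone "\<lambda>y. qnum q y / 2"
  by (rule odd_monotone_qnum)

text \<open>\<open>qplus q u * qnum q v\<close> is half the difference of
  \<open>qnum q (u + v)\<close> and \<open>qnum q (u - v)\<close>. So each factor is a difference of
  values of a single coordinate at the doubled labels.\<close>

lemma Delta_heights:
  assumes "L \<subseteq> labels N"
  shows "\<Delta>\<^sub>1\<^sub>1 q L = V (heights L)"
proof -
  let ?P = "{(a, b). a \<in> heights L \<and> b \<in> heights L \<and> a < b}"
  let ?h = "\<lambda>y :: int. of_int y / 2 :: rat"
  have img: "{(s\<^sub>1, s\<^sub>2). s\<^sub>1 \<in> L \<and> s\<^sub>2 \<in> L \<and> s\<^sub>1 < s\<^sub>2} = map_prod ?h ?h ` ?P"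
    by (subst (1 2) heights_image[OF assms]) (force simp: divide_less_cancel)
  have "\<Delta>\<^sub>1\<^sub>1 q L = (\<Prod>(a, b)\<in>?P. qplus q \<lfloor>?h b + ?h a\<rfloor> * qnum q \<lfloor>?h b - ?h a\<rfloor>)"
    unfolding \<Delta>\<^sub>1\<^sub>1_def img by (subst prod.reindex) (auto simp: inj_on_def case_prod_unfold)
  also have "\<dots> = vprod (\<lambda>y. qnum q y / 2) (heights L)"
    unfolding vprod_def
  proof (intro prod.cong refl, clarify)
    fix a b assume "a \<in> heights L" "b \<in> heights L"
    hence "odd a" "odd b"
      using heights_labels(1)[OF assms] by auto
    \<comment> \<open>These are the sum and the difference of the two labels; they are integers
      because \<open>a\<close> and \<open>b\<close> are odd.\<close>
    define u where "u = (a + b) div 2"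
    define v where "v = (b - a) div 2"
    have uv: "b = u + v" "a = u - v"
      unfolding u_def v_def using \<open>odd a\<close> \<open>odd b\<close> by presburger+
    have "?h b + ?h a = of_int u" "?h b - ?h a = of_int v"
      by (simp_all add: uv field_simps)
    hence "qplus q \<lfloor>?h b + ?h a\<rfloor> * qnum q \<lfloor>?h b - ?h a\<rfloor> = qplus q u * qnum q v"
      by simp
    also have "\<dots> = qnum q b / 2 - qnum q a / 2"
    proof -
      have "(q powi u + q powi (- u)) * (q powi v - q powi (- v))
        = q powi b - q powi (- b) - (q powi a - q powi (- a))"
        using q by (simp add: uv algebra_simps flip: power_int_add)
      thus ?thesis
        by (simp add: qplus_def qnum_def flip: diff_divide_distrib)
    qed
    finally show "qplus q \<lfloor>?h b + ?h a\<rfloor> * qnum q \<lfloor>?h b - ?h a\<rfloor> = qnum q b / 2 - qnum q a / 2" .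
  qed
  finally show ?thesis
    using vprod_pos[of "heights L" "\<lambda>y. qnum q y / 2"] mono unfolding V_def by (simp add: less_imp_le)
qed

text \<open>The two coordinates differ by a constant, so their differences agree. On positive
  heights both increase, which makes the absolute value harmless.\<close>

lemma vprod_cosh_coord:
  assumes "\<And>a. a \<in> A \<Longrightarrow> 0 < a"
  shows "vprod (cosh_coord q) A = \<bar>vprod (\<lambda>a. (qnum q a / 2)\<^sup>2) A\<bar>"
proof -
  define d where "d = q - inverse q"
  have d: "d \<noteq> 0"
    using q_minus_inverse_pos[OF q] by (simp add: d_def)
  have "cosh_coord q y = (qnum q y / 2)\<^sup>2 + 1 / (2 * d\<^sup>2)" for y
  proof -
    have "d * qnum q y = q powi y - q powi (- y)"
      using d by (simp add: qnum_def d_def)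
    hence "(d * qnum q y)\<^sup>2 = (q powi y)\<^sup>2 + (q powi (- y))\<^sup>2 - 2"
      by (simp add: power2_diff mult.assoc powi_minus_mult[OF q])
    also have "(q powi y)\<^sup>2 + (q powi (- y))\<^sup>2 = 4 * d\<^sup>2 * cosh_coord q y"
      unfolding cosh_coord_eq[OF q, symmetric] d_def[symmetric] by (simp add: power_mult_distrib)
    finally show ?thesis
      using d by (simp add: field_simps)
  qed
  hence "vprod (cosh_coord q) A = vprod (\<lambda>a. (qnum q a / 2)\<^sup>2) A"
    by (simp only: vprod_def add_diff_cancel_right)
  moreover have "0 < vprod (\<lambda>a. (qnum q a / 2)\<^sup>2) A"
  proof (rule vprod_pos)
    fix a b assume "a \<in> A" "b \<in> A" "a < b"
    thus "(qnum q a / 2)\<^sup>2 < (qnum q b / 2)\<^sup>2"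
      using mono[of a b] x_pos[of a] assms[of a] by (intro power_strict_mono) auto
  qed
  ultimately show ?thesis by simp
qed

definition left_norm :: "nat \<Rightarrow> 'a" where
  "left_norm k = (\<Prod>i=1..k. qfact q (2 * i - 2))"

definition right_norm :: "nat \<Rightarrow> 'a" where
  "right_norm k = (\<Prod>i\<in>{1..<k}. qfact q i)"

text \<open>Without row 0 no lozenge joins positive to negative heights: a horizontal one stays at
  its height and a slanted one moves by a single step. What remains is an upper part and a mirrored
  one.\<close>

lemma M_left_half:
  assumes g: "0 \<le> g" "even g" and k: "0 < k"
    and T: "T \<subseteq> {y. odd y \<and> \<bar>y\<bar> \<le> g + 2 * int k - 1}"
  shows "M q ({(c, y). 0 \<le> c \<and> c < 2 * int k \<and> \<bar>y\<bar> \<le> g + c \<and> y \<noteq> 0} - Pair (2 * int k - 1) ` T, {})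
    = (if card {t \<in> T. 0 < t} = k \<and> card {t \<in> T. t < 0} = k then W T / (left_norm k)\<^sup>2 else 0)"
proof -
  let ?T1 = "{t \<in> T. 0 < t}" and ?T2 = "uminus ` {t \<in> T. t < 0}"
  let ?U = "\<lambda>T. upper_part g (2 * k) - Pair (2 * int k - 1) ` T"
  let ?\<rho> = "\<lambda>t :: triangle. (fst t, - snd t)"
  have bound: "\<bar>t\<bar> \<le> g + 2 * int k - 1 \<and> odd t" if "t \<in> T" for t
    using T that by blast
  have bound': "t \<le> g + 2 * int k - 1 \<and> - t \<le> g + 2 * int k - 1 \<and> odd t" if "t \<in> T" for t
    using bound[OF that] by linarith
  have finT: "finite T"
  proof (rule finite_subset)
    show "T \<subseteq> {y. \<bar>y\<bar> \<le> g + 2 * int k - 1}"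
      using bound by blast
  qed (simp only: abs_le_interval finite_atLeastAtMost_int)
  have low: "?\<rho> ` ?U ?T2 = {(c, y). 0 \<le> c \<and> c < 2 * int k \<and> y \<le> - 1 \<and> - y \<le> g + c} - Pair (2 * int k - 1) ` {t \<in> T. t < 0}"
    unfolding upper_part_reflect by (simp add: image_image)
  have "{(c, y). 0 \<le> c \<and> c < 2 * int k \<and> \<bar>y\<bar> \<le> g + c \<and> y \<noteq> 0} - Pair (2 * int k - 1) ` T = ?U ?T1 \<union> ?\<rho> ` ?U ?T2"
    unfolding low by (auto simp: upper_part_def image_iff abs_le_iff)
  moreover have "M q (?U ?T1 \<union> ?\<rho> ` ?U ?T2, {}) = M q (?U ?T1, {}) * M q (?\<rho> ` ?U ?T2, {})"
  proof (rule M_no_crossing)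
    show "?U ?T1 \<inter> ?\<rho> ` ?U ?T2 = {}"
      by (auto simp: upper_part_def)
    fix Q assume "lozenge Q" and Q: "Q \<subseteq> ?U ?T1 \<union> ?\<rho> ` ?U ?T2"
    have pos: "0 < snd t \<longleftrightarrow> t \<in> ?U ?T1" if "t \<in> ?U ?T1 \<union> ?\<rho> ` ?U ?T2" for t
      using that by (auto simp: upper_part_def)
    have ne: "snd t \<noteq> 0" if "t \<in> ?U ?T1 \<union> ?\<rho> ` ?U ?T2" for t
      using that by (auto simp: upper_part_def)
    from \<open>lozenge Q\<close> show "Q \<subseteq> ?U ?T1 \<or> Q \<subseteq> ?\<rho> ` ?U ?T2"
    proof (cases rule: lozenge_cases)
      case (1 c y)
      have "(c, y) \<in> ?U ?T1 \<union> ?\<rho> ` ?U ?T2" "(c, y + 1) \<in> ?U ?T1 \<union> ?\<rho> ` ?U ?T2"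
        using Q 1 by auto
      with pos[OF this(1)] pos[OF this(2)] ne[OF this(1)] ne[OF this(2)] show ?thesis
        unfolding 1 by (cases "0 < y") auto
    next
      case (2 c y)
      have "(c, y) \<in> ?U ?T1 \<union> ?\<rho> ` ?U ?T2" "(c + 1, y) \<in> ?U ?T1 \<union> ?\<rho> ` ?U ?T2"
        using Q 2 by auto
      with pos[OF this(1)] pos[OF this(2)] show ?thesis
        unfolding 2 by (cases "0 < y") auto
    qed
  qed (simp_all add: finite_upper_part)
  moreover have "M q (?U ?T1, {}) = (if card ?T1 = k then vprod (cosh_coord q) ?T1 / left_norm k else 0)"
    unfolding left_norm_def using g k bound' by (intro M_upper_part[OF q]) fastforce+
  moreover have "M q (?U ?T2, {}) = (if card ?T2 = k then vprod (cosh_coord q) ?T2 / left_norm k else 0)"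
    unfolding left_norm_def using g k bound' by (intro M_upper_part[OF q]) fastforce+
  moreover have "card ?T2 = card {t \<in> T. t < 0}"
    by (rule card_image) auto
  moreover have "vprod (cosh_coord q) ?T1 * vprod (cosh_coord q) ?T2 = W T"
  proof -
    have "\<bar>vprod (\<lambda>a. (qnum q a / 2)\<^sup>2) ?T2\<bar> = \<bar>vprod (\<lambda>a. (qnum q a / 2)\<^sup>2) {t \<in> T. t < 0}\<bar>"
      using finT by (intro vprod_uminus_abs) (auto simp: qnum_minus[OF q])
    thus ?thesis
      unfolding W_def by (subst (1 2) vprod_cosh_coord) auto
  qed
  ultimately show ?thesis
    by (simp add: M_reflect power2_eq_square)
qed

end

lemma shared_edge_off_line:
  assumes "lozenge T" "(\<forall>t\<in>T. fst t < a) \<or> (\<forall>t\<in>T. a \<le> fst t)"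
  shows "shared_edge T \<noteq> vertical_segment a y"
  using assms(1)
proof (cases rule: lozenge_cases)
  case (1 c z)
  thus ?thesis
    using shared_edge_slanted_not_vertical by simp
next
  case (2 c z)
  hence "shared_edge T = vertical_segment (c + 1) z" "c + 1 \<noteq> a"
    using assms(2) shared_edge_horizontal[of c z] by auto
  thus ?thesis
    by (simp add: vertical_segment_eq_iff)
qed

text \<open>Barriers lie on the diagonal and can forbid only lozenges crossing it. Once the region
  is cut there, the halves are free of them.\<close>

lemma M_barriers_off_diagonal:
  assumes "(\<forall>t\<in>X. fst t < diag m \<alpha>) \<or> (\<forall>t\<in>X. diag m \<alpha> \<le> fst t)"
  shows "M q (X, barriers m \<alpha> B) = M q (X, {})"
proof (rule M_barriers_off_region)
  fix T assume T: "lozenge T" "T \<subseteq> X"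
  hence "(\<forall>t\<in>T. fst t < diag m \<alpha>) \<or> (\<forall>t\<in>T. diag m \<alpha> \<le> fst t)"
    using assms by blast
  from shared_edge_off_line[OF T(1) this] show "shared_edge T \<notin> barriers m \<alpha> B"
    by (auto simp: barriers_def)
qed

text \<open>The places where a horizontal lozenge may cross the diagonal: no dent on either side and
  no barrier.\<close>

definition free_heights :: "nat \<Rightarrow> rat set \<Rightarrow> rat set \<Rightarrow> rat set \<Rightarrow> int set" where
  "free_heights N L R B = {y. odd y \<and> \<bar>y\<bar> \<le> 2 * int N + 1} - heights L - heights R - heights B"

lemma finite_free_heights: "finite (free_heights N L R B)"
proof (rule finite_subset)
  show "free_heights N L R B \<subseteq> {y. \<bar>y\<bar> \<le> 2 * int N + 1}"
    by (auto simp: free_heights_def)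
qed (simp only: abs_le_interval finite_atLeastAtMost_int)

lemma symmetric_split:
  fixes F :: "int set"
  assumes "F = uminus ` F" "0 \<notin> F"
  shows "{f \<in> F. f < 0} = uminus ` {f \<in> F. 0 < f}" "F = {f \<in> F. 0 < f} \<union> {f \<in> F. f < 0}"
proof -
  show "{f \<in> F. f < 0} = uminus ` {f \<in> F. 0 < f}"
  proof (intro equalityI subsetI)
    fix f assume "f \<in> {f \<in> F. f < 0}"
    hence "- f \<in> {f \<in> F. 0 < f}"
      using assms(1) by auto
    thus "f \<in> uminus ` {f \<in> F. 0 < f}"
      by (intro image_eqI[of _ _ "- f"]) auto
  qed (use assms(1) in auto)
  have "f \<noteq> 0" if "f \<in> F" for f
    using assms(2) that by metis
  thus "F = {f \<in> F. 0 < f} \<union> {f \<in> F. f < 0}"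
    by (auto simp: neq_iff)
qed

lemma card_symmetric:
  fixes F :: "int set"
  assumes "finite F" "F = uminus ` F" "0 \<notin> F"
  shows "card F = 2 * card {f \<in> F. 0 < f}" "card F = 2 * card {f \<in> F. f < 0}"
proof -
  have *: "card {f \<in> F. f < 0} = card {f \<in> F. 0 < f}"
    unfolding symmetric_split(1)[OF assms(2,3)] by (simp add: card_image)
  have "card F = card ({f \<in> F. 0 < f} \<union> {f \<in> F. f < 0})"
    using symmetric_split(2)[OF assms(2,3)] by (rule arg_cong)
  also have "\<dots> = card {f \<in> F. 0 < f} + card {f \<in> F. f < 0}"
    by (rule card_Un_disjoint) (use assms(1) in auto)
  finally show "card F = 2 * card {f \<in> F. 0 < f}" "card F = 2 * card {f \<in> F. f < 0}"
    by (simp_all add: *)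
qed

section \<open>The sum over the crossings of the diagonal, and the effect of the flip on it\<close>

context
  fixes q :: "'a::linordered_field"
  assumes q: "1 < q"
begin

interpretation odd_monotone "\<lambda>y. qnum q y / 2"
  by (rule odd_monotone_qnum[OF q])

definition left_factor :: "nat \<Rightarrow> int set \<Rightarrow> 'a" where
  "left_factor k T = (if card {t \<in> T. 0 < t} = k \<and> card {t \<in> T. t < 0} = k then W T / (left_norm q k)\<^sup>2 else 0)"

definition right_factor :: "nat \<Rightarrow> int set \<Rightarrow> 'a" where
  "right_factor k T = (if card T = k then V T / right_norm q k else 0)"

lemma M_H':
  assumes \<beta>: "\<beta> \<le> 2 * \<alpha> + 2 * \<gamma> + 2" and N: "N = m + n + \<alpha> + \<gamma>"
    and L: "L \<subseteq> labels N" and R: "R \<subseteq> labels N" and degenerate: "2 * n + \<beta> = 0 \<Longrightarrow> R = {}"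
  shows "M q (H' m n \<alpha> \<beta> \<gamma> L R B) = (\<Sum>S\<in>Pow (free_heights N L R B). prod (qplus q) S *
    (left_factor (m + \<alpha> + 1) (heights L \<union> S) * right_factor (2 * n + \<beta>) (heights R \<union> S)))"
proof -
  define k where "k = m + \<alpha> + 1"
  define K where "K = 2 * n + \<beta>"
  define g where "g = int (2 * n + 2 * \<gamma>)"
  define a where "a = 2 * int k"
  define X where "X = fst (H' m n \<alpha> \<beta> \<gamma> L R B)"
  let ?C = "free_heights N L R B"
  let ?Bar = "barriers m \<alpha> B"
  have a: "diag m \<alpha> = a" "even a" "0 < a"
    by (simp_all add: a_def k_def diag_def)
  have g: "0 \<le> g" "even g"
    by (simp_all add: g_def)
  have N2: "2 * int N + 1 = g + a - 1"
    by (simp add: N g_def a_def k_def)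
  have H: "H' m n \<alpha> \<beta> \<gamma> L R B = (X, ?Bar)"
    by (simp add: X_def H'_def)
  note hL = heights_labels[OF L] and hR = heights_labels[OF R]
  have memX: "(c, y) \<in> X \<longleftrightarrow> 0 \<le> c \<and> c < a + int K \<and>
      (if c < a then \<bar>y\<bar> \<le> g + c \<and> y \<noteq> 0 \<and> \<not> (c = a - 1 \<and> y \<in> heights L)
       else \<bar>y\<bar> \<le> g + 2 * a - c - 1 \<and> \<not> (c = a \<and> y \<in> heights R))" for c y
  proof -
    have "(c, y) \<in> left_dents m \<alpha> L \<longleftrightarrow> c = a - 1 \<and> y \<in> heights L"
      using hL(1)[of y] a by (auto simp: left_dents_def left_pointing_def mem_heights_iff[symmetric])
    moreover have "(c, y) \<in> right_dents m \<alpha> R \<longleftrightarrow> c = a \<and> y \<in> heights R"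
      using hR(1)[of y] a by (auto simp: right_dents_def left_pointing_def mem_heights_iff[symmetric])
    moreover have "(c, y) \<in> intrusion m \<alpha> \<longleftrightarrow> 0 \<le> c \<and> c < a \<and> y = 0"
      by (auto simp: intrusion_def a)
    ultimately show ?thesis
      by (auto simp: X_def H'_def mem_hexagon_iff a(1) K_def g_def)
  qed
  have finX: "finite X"
  proof (rule finite_subset)
    show "X \<subseteq> {0..a + int K} \<times> {y. \<bar>y\<bar> \<le> g + 2 * a}"
      by (auto simp: memX split: if_splits)
  qed (simp only: abs_le_interval finite_atLeastAtMost_int finite_cartesian_product)
  define C where "C = {y. odd (a + y) \<and> (a - 1, y) \<in> X \<and> (a, y) \<in> X \<and> vertical_segment a y \<notin> ?Bar}"
  have bar: "vertical_segment a y \<in> ?Bar \<longleftrightarrow> y \<in> heights B" for y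
    by (auto simp: barriers_def a(1) vertical_segment_eq_iff mem_heights_iff)
  \<comment> \<open>If \<open>K = 0\<close>, no column lies to the right of the diagonal, so nothing
    crosses it.\<close>
  have C: "C = (if K = 0 then {} else ?C)"
    using a(2,3) N2 by (auto simp: C_def free_heights_def memX bar)
  have "M q (X, ?Bar) = (\<Sum>S\<in>Pow C. prod (qplus q) S *
    (M q ({t \<in> X. fst t < a} - Pair (a - 1) ` S, ?Bar) * M q ({t \<in> X. a \<le> fst t} - Pair a ` S, ?Bar)))"
    unfolding C_def using finX by (rule M_cut)
  also have "\<dots> = (\<Sum>S\<in>Pow C. prod (qplus q) S *
    (left_factor k (heights L \<union> S) * right_factor K (heights R \<union> S)))"
  proof (intro sum.cong refl arg_cong2[of _ _ _ _ "(*)"])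
    fix S assume "S \<in> Pow C"
    hence SC: "S \<subseteq> C" by simp
    have S: "odd y \<and> \<bar>y\<bar> \<le> g + a - 1" if "y \<in> S" for y
      using SC that N2 by (auto simp: C free_heights_def split: if_splits)
    have LS: "odd y \<and> \<bar>y\<bar> \<le> g + a - 1" if "y \<in> heights L \<union> S" for y
      using S hL N2 that by auto
    have RS: "odd y \<and> \<bar>y\<bar> \<le> g + a - 1" if "y \<in> heights R \<union> S" for y
      using S hR N2 that by auto
    have left: "{t \<in> X. fst t < a} - Pair (a - 1) ` S
        = {(c, y). 0 \<le> c \<and> c < 2 * int k \<and> \<bar>y\<bar> \<le> g + c \<and> y \<noteq> 0} - Pair (2 * int k - 1) ` (heights L \<union> S)"
      by (auto simp: memX a_def image_iff)
    have "M q ({t \<in> X. fst t < a} - Pair (a - 1) ` S, ?Bar) = M q ({t \<in> X. fst t < a} - Pair (a - 1) ` S, {})"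
      by (rule M_barriers_off_diagonal) (simp add: a(1))
    also have "\<dots> = left_factor k (heights L \<union> S)"
      unfolding left left_factor_def by (rule M_left_half[OF q g]) (use LS in \<open>auto simp: k_def a_def\<close>)
    finally show "M q ({t \<in> X. fst t < a} - Pair (a - 1) ` S, ?Bar) = left_factor k (heights L \<union> S)" .
    have right: "{t \<in> X. a \<le> fst t} - Pair a ` S = trapezoid a (g + a - 1) K - Pair a ` (heights R \<union> S)"
      using a(3) by (auto simp: memX trapezoid_def image_iff)
    have "M q ({t \<in> X. a \<le> fst t} - Pair a ` S, ?Bar) = M q ({t \<in> X. a \<le> fst t} - Pair a ` S, {})"
      by (rule M_barriers_off_diagonal) (simp add: a(1))
    also have "\<dots> = (if card (heights R \<union> S) = K
        then vprod (\<lambda>y. qnum q y / 2) (heights R \<union> S) / (\<Prod>i\<in>{1..<K}. qfact q i) else 0)"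
      unfolding right
    proof (rule M_trapezoid[OF q])
      show "int K \<le> g + a - 1 + 1"
        using \<beta> by (simp add: K_def g_def a_def k_def)
      show "odd (g + a - 1 + a)"
        using g(2) by simp
      show "heights R \<union> S \<subseteq> {y. \<bar>y\<bar> \<le> g + a - 1 \<and> even (y - (g + a - 1))}"
        using RS g(2) a(2) by auto
      show "K = 0 \<Longrightarrow> heights R \<union> S = {}"
        using degenerate SC by (simp add: K_def C heights_def)
    qed
    also have "\<dots> = right_factor K (heights R \<union> S)"
    proof -
      have "0 < vprod (\<lambda>y. qnum q y / 2) (heights R \<union> S)"
        using mono by (intro vprod_pos)
      thus ?thesis
        by (simp add: right_factor_def V_def right_norm_def[OF q])
    qed
    finally show "M q ({t \<in> X. a \<le> fst t} - Pair a ` S, ?Bar) = right_factor K (heights R \<union> S)" .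
  qed
  \<comment> \<open>For \<open>K = 0\<close> the sum is enlarged to all free heights, so that both
    regions of a flip get the same index set. The additional \<open>S\<close> are nonempty, and
    \<open>right_factor\<close> with first argument 0 vanishes on nonempty finite sets.\<close>
  also have "\<dots> = (\<Sum>S\<in>Pow ?C. prod (qplus q) S *
    (left_factor k (heights L \<union> S) * right_factor K (heights R \<union> S)))"
  proof (rule sum.mono_neutral_left)
    show "\<forall>S\<in>Pow ?C - Pow C. prod (qplus q) S * (left_factor k (heights L \<union> S) * right_factor K (heights R \<union> S)) = 0"
    proof
      fix S assume S: "S \<in> Pow ?C - Pow C"
      hence "K = 0" "S \<noteq> {}"
        by (auto simp: C split: if_splits)
      moreover have "finite (heights R \<union> S)"
        using S finite_free_heights[of N L R B] finite_heights[OF R] finite_subset by auto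
      ultimately show "prod (qplus q) S * (left_factor k (heights L \<union> S) * right_factor K (heights R \<union> S)) = 0"
        by (simp add: right_factor_def)
    qed
  qed (simp_all add: C finite_free_heights)
  finally show ?thesis
    by (simp add: H k_def K_def)
qed

lemma qfact_pos: "0 < qfact q n"
  unfolding qfact_def using qnum_pos[OF q] by (intro prod_pos) auto

lemma left_norm_pos: "0 < left_norm q n"
  unfolding left_norm_def[OF q] using qfact_pos by (intro prod_pos) auto

lemma right_norm_pos: "0 < right_norm q n"
  unfolding right_norm_def[OF q] using qfact_pos by (intro prod_pos) auto

text \<open>\<open>f\<close> and \<open>- f\<close> contribute the same factor, and
  \<open>2 * (qnum q f / 2)\<close> is \<open>qnum q f\<close>. Hence \<open>Y\<close> is the
  positive square root of the symmetric product.\<close>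

lemma prod_qnum_symmetric:
  assumes "finite F" "F = uminus ` F" "0 \<notin> F"
  shows "(\<Prod>y\<in>F. qnum q \<bar>y\<bar>) = (Y F)\<^sup>2"
proof -
  have "(\<Prod>y\<in>F. qnum q \<bar>y\<bar>) = (\<Prod>y\<in>{f \<in> F. 0 < f} \<union> {f \<in> F. f < 0}. qnum q \<bar>y\<bar>)"
    using symmetric_split(2)[OF assms(2,3)] by (rule arg_cong)
  also have "\<dots> = (\<Prod>y | y \<in> F \<and> 0 < y. qnum q \<bar>y\<bar>) * (\<Prod>y\<in>{f \<in> F. f < 0}. qnum q \<bar>y\<bar>)"
    by (rule prod.union_disjoint) (use assms(1) in auto)
  also have "(\<Prod>y\<in>{f \<in> F. f < 0}. qnum q \<bar>y\<bar>) = (\<Prod>y | y \<in> F \<and> 0 < y. qnum q \<bar>y\<bar>)"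
    unfolding symmetric_split(1)[OF assms(2,3)] by (simp add: prod.reindex)
  also have "(\<Prod>y | y \<in> F \<and> 0 < y. qnum q \<bar>y\<bar>) = Y F"
    unfolding Y_def by (intro prod.cong) auto
  finally show ?thesis
    by (simp add: power2_eq_square)
qed

lemma M_flip:
  assumes \<beta>: "\<beta> \<le> 2 * \<alpha> + 2 * \<gamma> + 2" and N: "N = m + n + \<alpha> + \<gamma>"
    and L1: "L\<^sub>1 \<subseteq> labels N" and R1: "R\<^sub>1 \<subseteq> labels N" and degenerate: "2 * n + \<beta> = 0 \<Longrightarrow> R\<^sub>1 = {}"
    and FL: "F\<^sub>L \<subseteq> L\<^sub>1 - R\<^sub>1" "F\<^sub>L = uminus ` F\<^sub>L" "card F\<^sub>L = 2 * m"
    and FR: "F\<^sub>R \<subseteq> R\<^sub>1 - L\<^sub>1" "F\<^sub>R = uminus ` F\<^sub>R" "card F\<^sub>R = 2 * n"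
    and L2: "L\<^sub>2 = (L\<^sub>1 - F\<^sub>L) \<union> F\<^sub>R" and R2: "R\<^sub>2 = (R\<^sub>1 - F\<^sub>R) \<union> F\<^sub>L"
    and ne: "M q (H' m n \<alpha> \<beta> \<gamma> L\<^sub>1 R\<^sub>1 B) \<noteq> 0"
  shows "M q (H' n m \<alpha> \<beta> \<gamma> L\<^sub>2 R\<^sub>2 B) =
    (left_norm q (m + \<alpha> + 1))\<^sup>2 / (left_norm q (n + \<alpha> + 1))\<^sup>2 * (right_norm q (2 * n + \<beta>) / right_norm q (2 * m + \<beta>))
    * (Y (heights F\<^sub>L) / Y (heights F\<^sub>R))
    * (V (heights L\<^sub>2) * V (heights R\<^sub>2) / (V (heights L\<^sub>1) * V (heights R\<^sub>1)))
    * M q (H' m n \<alpha> \<beta> \<gamma> L\<^sub>1 R\<^sub>1 B)"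
    (is "_ = ?\<rho> * _")
proof -
  let ?C = "free_heights N L\<^sub>1 R\<^sub>1 B"
  let ?L1 = "heights L\<^sub>1" and ?R1 = "heights R\<^sub>1" and ?L2 = "heights L\<^sub>2" and ?R2 = "heights R\<^sub>2"
  let ?FL = "heights F\<^sub>L" and ?FR = "heights F\<^sub>R"
  have labels: "F\<^sub>L \<subseteq> labels N" "F\<^sub>R \<subseteq> labels N" "L\<^sub>2 \<subseteq> labels N" "R\<^sub>2 \<subseteq> labels N"
    using L1 R1 FL(1) FR(1) by (auto simp: L2 R2)
  note fin = finite_heights[OF L1] finite_heights[OF R1] finite_heights[OF labels(1)] finite_heights[OF labels(2)]
  have hFL: "?FL \<subseteq> ?L1 - ?R1" "?FL = uminus ` ?FL" "card ?FL = 2 * m"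
    using heights_mono[OF FL(1)] heights_uminus[OF FL(2)] card_heights[OF labels(1)] FL(3) by (auto simp: heights_Diff)
  have hFR: "?FR \<subseteq> ?R1 - ?L1" "?FR = uminus ` ?FR" "card ?FR = 2 * n"
    using heights_mono[OF FR(1)] heights_uminus[OF FR(2)] card_heights[OF labels(2)] FR(3) by (auto simp: heights_Diff)
  have hL2: "?L2 = (?L1 - ?FL) \<union> ?FR" and hR2: "?R2 = (?R1 - ?FR) \<union> ?FL"
    by (simp_all add: L2 R2 heights_Un heights_Diff)
  have M1: "M q (H' m n \<alpha> \<beta> \<gamma> L\<^sub>1 R\<^sub>1 B) = (\<Sum>S\<in>Pow ?C. prod (qplus q) S *
    (left_factor (m + \<alpha> + 1) (?L1 \<union> S) * right_factor (2 * n + \<beta>) (?R1 \<union> S)))"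
    using degenerate by (rule M_H'[OF \<beta> N L1 R1])
  \<comment> \<open>Without a strip on the right, \<open>right_factor\<close> would be wrong for nonempty \<open>R\<^sub>2\<close>.\<close>
  have degenerate2: "R\<^sub>2 = {}" if "2 * m + \<beta> = 0"
  proof -
    obtain S where S: "S \<in> Pow ?C" "right_factor (2 * n + \<beta>) (?R1 \<union> S) \<noteq> 0"
      using ne unfolding M1 by (metis (no_types, lifting) mult_zero_right sum.neutral)
    have "finite S"
      using S(1) finite_free_heights by (meson PowD finite_subset)
    hence "finite (?R1 \<union> S)"
      using fin(2) by simp
    hence "card ?R1 \<le> card (?R1 \<union> S)"
      by (intro card_mono) auto
    also have "\<dots> = card ?FR"
      using S(2) that hFR(3) by (simp add: right_factor_def split: if_splits)
    finally have "?FR = ?R1"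
      using hFR(1) fin(2) by (intro card_seteq) auto
    hence "F\<^sub>R = R\<^sub>1"
      using heights_image[OF labels(2)] heights_image[OF R1] by metis
    moreover have "?FL = {}"
      using hFL(3) fin(3) that by simp
    hence "F\<^sub>L = {}"
      using heights_image[OF labels(1)] by blast
    ultimately show ?thesis
      by (simp add: R2)
  qed
  \<comment> \<open>Flipped dents only change sides, so the union of left and right dents, and with
    it the set of possible crossings, is the same for both regions.\<close>
  have C: "free_heights N L\<^sub>2 R\<^sub>2 B = ?C"
    using hFL(1) hFR(1) by (auto simp: free_heights_def hL2 hR2)
  have "N = n + m + \<alpha> + \<gamma>"
    using N by simp
  hence M2: "M q (H' n m \<alpha> \<beta> \<gamma> L\<^sub>2 R\<^sub>2 B) = (\<Sum>S\<in>Pow ?C. prod (qplus q) S *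
    (left_factor (n + \<alpha> + 1) (?L2 \<union> S) * right_factor (2 * m + \<beta>) (?R2 \<union> S)))"
    using M_H'[where m = n and n = m and B = B, OF \<beta> _ labels(3,4) degenerate2] unfolding C by blast
  have "left_factor (n + \<alpha> + 1) (?L2 \<union> S) * right_factor (2 * m + \<beta>) (?R2 \<union> S)
      = ?\<rho> * (left_factor (m + \<alpha> + 1) (?L1 \<union> S) * right_factor (2 * n + \<beta>) (?R1 \<union> S))"
    if "S \<in> Pow ?C" for S
  proof -
    have finS: "finite S"
      using that finite_free_heights by (meson PowD finite_subset)
    have disj: "S \<inter> (?L1 \<union> ?R1) = {}"
      using that by (auto simp: free_heights_def)
    have zero: "0 \<notin> ?L1 \<union> ?R1 \<union> S"
      using heights_labels(1)[OF L1, of 0] heights_labels(1)[OF R1, of 0] that by (auto simp: free_heights_def)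
    have zeroF: "0 \<notin> ?FL" "0 \<notin> ?FR"
      using zero hFL(1) hFR(1) by auto
    \<comment> \<open>\<open>F\<^sub>L\<close> has m positive and m negative heights,
      \<open>F\<^sub>R\<close> has n of each. With these set aside, the counting conditions of both
      regions read the same: \<alpha> + 1 elements of \<open>A\<close> on either side of 0, and
      \<beta> elements of \<open>A'\<close>. So corresponding summands vanish together.\<close>
    define A where "A = (?L1 - ?FL) \<union> S"
    define A' where "A' = (?R1 - ?FR) \<union> S"
    have finA: "finite A" "finite A'"
      using fin finS by (auto simp: A_def A'_def)
    have un: "?L1 \<union> S = A \<union> ?FL" "?L2 \<union> S = A \<union> ?FR" "?R1 \<union> S = A' \<union> ?FR" "?R2 \<union> S = A' \<union> ?FL"
      using hFL(1) hFR(1) by (auto simp: A_def A'_def hL2 hR2)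
    have dj: "A \<inter> ?FL = {}" "A \<inter> ?FR = {}" "A' \<inter> ?FL = {}" "A' \<inter> ?FR = {}"
      using hFL(1) hFR(1) disj by (auto simp: A_def A'_def)
    have split: "card {t \<in> D \<union> F. P t} = card {t \<in> D. P t} + card {t \<in> F. P t}"
      if "finite D" "finite F" "D \<inter> F = {}" for D F :: "int set" and P
    proof -
      have "{t \<in> D \<union> F. P t} = {t \<in> D. P t} \<union> {t \<in> F. P t}"
        by auto
      thus ?thesis
        using that by (simp add: card_Un_disjoint disjoint_iff)
    qed
    have cL: "card {t \<in> ?FL. 0 < t} = m" "card {t \<in> ?FL. t < 0} = m"
      using card_symmetric[OF fin(3) hFL(2) zeroF(1)] hFL(3) by simp_all
    have cR: "card {t \<in> ?FR. 0 < t} = n" "card {t \<in> ?FR. t < 0} = n"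
      using card_symmetric[OF fin(4) hFR(2) zeroF(2)] hFR(3) by simp_all
    have 1: "left_factor (m + \<alpha> + 1) (?L1 \<union> S) = (if card {t \<in> A. 0 < t} = \<alpha> + 1 \<and> card {t \<in> A. t < 0} = \<alpha> + 1
        then W (?L1 \<union> S) / (left_norm q (m + \<alpha> + 1))\<^sup>2 else 0)"
      unfolding left_factor_def un split[OF finA(1) fin(3) dj(1)] cL by simp
    have 2: "left_factor (n + \<alpha> + 1) (?L2 \<union> S) = (if card {t \<in> A. 0 < t} = \<alpha> + 1 \<and> card {t \<in> A. t < 0} = \<alpha> + 1
        then W (?L2 \<union> S) / (left_norm q (n + \<alpha> + 1))\<^sup>2 else 0)"
      unfolding left_factor_def un split[OF finA(1) fin(4) dj(2)] cR by simp
    have 3: "right_factor (2 * n + \<beta>) (?R1 \<union> S) = (if card A' = \<beta> then V (?R1 \<union> S) / right_norm q (2 * n + \<beta>) else 0)"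
      unfolding right_factor_def un card_Un_disjoint[OF finA(2) fin(4) dj(4)] hFR(3) by simp
    have 4: "right_factor (2 * m + \<beta>) (?R2 \<union> S) = (if card A' = \<beta> then V (?R2 \<union> S) / right_norm q (2 * m + \<beta>) else 0)"
      unfolding right_factor_def un card_Un_disjoint[OF finA(2) fin(3) dj(3)] hFL(3) by simp
    have ratio: "W (?L2 \<union> S) * V (?R2 \<union> S) * (Y ?FR * V ?L1 * V ?R1) = W (?L1 \<union> S) * V (?R1 \<union> S) * (Y ?FL * V ?L2 * V ?R2)"
      using fin(1,2) finS hFL(1,2) hFR(1,2) zero disj hL2 hR2 by (rule flip_ratio)
    have pos: "Y ?FR \<noteq> 0" "V ?L1 \<noteq> 0" "V ?R1 \<noteq> 0"
      using Y_pos V_pos by (metis less_irrefl)+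
    have kl: "left_norm q (m + \<alpha> + 1) \<noteq> 0" "right_norm q (2 * n + \<beta>) \<noteq> 0"
      using left_norm_pos right_norm_pos by (metis less_irrefl)+
    have alg: "w2 / k2\<^sup>2 * (v2 / l2) = k1\<^sup>2 / k2\<^sup>2 * (l1 / l2) * (yl / yr) * (a2 * b2 / (a1 * b1)) * (w1 / k1\<^sup>2 * (v1 / l1))"
      if "w2 * v2 * (yr * a1 * b1) = w1 * v1 * (yl * a2 * b2)" "yr \<noteq> 0" "a1 \<noteq> 0" "b1 \<noteq> 0" "k1 \<noteq> 0" "l1 \<noteq> 0"
      for w1 w2 v1 v2 k1 k2 l1 l2 yl yr a1 a2 b1 b2 :: 'a
    proof -
      have "w2 * v2 = w1 * v1 * (yl * a2 * b2) / (yr * a1 * b1)"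
        using that by (simp add: eq_divide_eq)
      hence "w2 / k2\<^sup>2 * (v2 / l2) = w1 * v1 * (yl * a2 * b2) / (yr * a1 * b1) / (k2\<^sup>2 * l2)"
        by simp
      also have "\<dots> = k1\<^sup>2 / k2\<^sup>2 * (l1 / l2) * (yl / yr) * (a2 * b2 / (a1 * b1)) * (w1 / k1\<^sup>2 * (v1 / l1))"
        using that by (simp add: mult_ac)
      finally show ?thesis .
    qed
    show ?thesis
      unfolding 1 2 3 4 using alg[OF ratio pos kl, of "left_norm q (n + \<alpha> + 1)" "right_norm q (2 * m + \<beta>)"]
      by (cases "card {t \<in> A. 0 < t} = \<alpha> + 1 \<and> card {t \<in> A. t < 0} = \<alpha> + 1"; cases "card A' = \<beta>")
        (simp_all only: if_True if_False mult_zero_left mult_zero_right simp_thms)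
  qed
  hence "prod (qplus q) S * (left_factor (n + \<alpha> + 1) (?L2 \<union> S) * right_factor (2 * m + \<beta>) (?R2 \<union> S))
      = ?\<rho> * (prod (qplus q) S * (left_factor (m + \<alpha> + 1) (?L1 \<union> S) * right_factor (2 * n + \<beta>) (?R1 \<union> S)))"
    if "S \<in> Pow ?C" for S
    using that by (simp only: mult.left_commute)
  thus ?thesis
    unfolding M1 M2 sum_distrib_left by (intro sum.cong refl)
qed

end

text \<open>The difference \<open>q_var - 1\<close> has a positive leading coefficient. This makes
  the results for ordered fields available for the variable itself.\<close>

lemma one_less_q_var: "1 < q_var"
proof -
  have "Fract 1 1 < Fract [:0, 1 :: rat:] 1"
    by (simp add: less_poly_def one_pCons pos_poly_def)
  thus ?thesis
    by (simp add: q_var_def One_fract_def)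
qed

theorem theorem3p2:
  fixes m n \<alpha> \<beta> \<gamma> N :: nat
    and L\<^sub>1 R\<^sub>1 L\<^sub>2 R\<^sub>2 B F\<^sub>L F\<^sub>R :: "rat set"
    and q :: "rat poly fract"
  assumes "q = q_var"
    and "\<beta> \<le> 2*\<alpha> + 2*\<gamma> + 2"
    and "N = m + n + \<alpha> + \<gamma>"
    and "L\<^sub>1 \<subseteq> labels N" and "R\<^sub>1 \<subseteq> labels N" and "B \<subseteq> labels N"
    and "right_dents m \<alpha> R\<^sub>1 \<subseteq> hexagon m n \<alpha> \<beta> \<gamma>"
    and "F\<^sub>L \<subseteq> L\<^sub>1 - R\<^sub>1" and "F\<^sub>L = uminus ` F\<^sub>L" and "card F\<^sub>L = 2*m"
    and "F\<^sub>R \<subseteq> R\<^sub>1 - L\<^sub>1" and "F\<^sub>R = uminus ` F\<^sub>R" and "card F\<^sub>R = 2*n"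
    and "L\<^sub>2 = (L\<^sub>1 - F\<^sub>L) \<union> F\<^sub>R"
    and "R\<^sub>2 = (R\<^sub>1 - F\<^sub>R) \<union> F\<^sub>L"
    and "M q (H' m n \<alpha> \<beta> \<gamma> L\<^sub>1 R\<^sub>1 B) \<noteq> 0"
  shows "\<exists>r. 0 < r \<and>
    r\<^sup>2 = (\<Prod>s\<in>L\<^sub>1. qnum q \<lfloor>2 * \<bar>s\<bar>\<rfloor>) / (\<Prod>s\<in>L\<^sub>2. qnum q \<lfloor>2 * \<bar>s\<bar>\<rfloor>) \<and>
    M q (H' n m \<alpha> \<beta> \<gamma> L\<^sub>2 R\<^sub>2 B) / M q (H' m n \<alpha> \<beta> \<gamma> L\<^sub>1 R\<^sub>1 B) =
      (\<Prod>i=1..m+\<alpha>+1. qfact q (2*i - 2))\<^sup>2 / (\<Prod>i=1..n+\<alpha>+1. qfact q (2*i - 2))\<^sup>2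
      * ((\<Prod>i\<in>{1..<2*n+\<beta>}. qfact q i) / (\<Prod>i\<in>{1..<2*m+\<beta>}. qfact q i))
      * r
      * ((\<Delta>\<^sub>1\<^sub>1 q L\<^sub>2 * \<Delta>\<^sub>1\<^sub>1 q R\<^sub>2) / (\<Delta>\<^sub>1\<^sub>1 q L\<^sub>1 * \<Delta>\<^sub>1\<^sub>1 q R\<^sub>1))"
proof -
  have q: "1 < q"
    using assms(1) one_less_q_var by simp
  note L1 = assms(4) and R1 = assms(5) and FL = assms(8-10) and FR = assms(11-13)
  have labels: "F\<^sub>L \<subseteq> labels N" "F\<^sub>R \<subseteq> labels N" "L\<^sub>2 \<subseteq> labels N" "R\<^sub>2 \<subseteq> labels N"
    using L1 R1 FL(1) FR(1) by (auto simp: assms(14,15))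
  interpret odd_monotone "\<lambda>y. qnum q y / 2"
    by (rule odd_monotone_qnum[OF q])
  \<comment> \<open>With \<open>2 * n + \<beta> = 0\<close> the hexagon ends at the diagonal, so it
    contains no triangle that could be a right dent.\<close>
  have degenerate: "R\<^sub>1 = {}" if "2 * n + \<beta> = 0"
  proof -
    have "y \<notin> heights R\<^sub>1" for y
    proof
      assume y: "y \<in> heights R\<^sub>1"
      hence "(diag m \<alpha>, y) \<in> right_dents m \<alpha> R\<^sub>1"
        using heights_labels(1)[OF R1 y]
        by (auto simp: right_dents_def left_pointing_def diag_def mem_heights_iff)
      hence "(diag m \<alpha>, y) \<in> hexagon m n \<alpha> \<beta> \<gamma>"
        using assms(7) by blast
      thus False
        using that by (simp add: mem_hexagon_iff)
    qed
    hence "heights R\<^sub>1 = {}"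
      by blast
    thus ?thesis
      using heights_image[OF R1] by simp
  qed
  \<comment> \<open>The witness for the square root: the dents common to \<open>L\<^sub>1\<close>
    and \<open>L\<^sub>2\<close> cancel in the quotient, and each symmetric set contributes the
    square of its \<open>Y\<close>.\<close>
  let ?r = "Y (heights F\<^sub>L) / Y (heights F\<^sub>R)"
  have "?r\<^sup>2 = (\<Prod>s\<in>L\<^sub>1. qnum q \<lfloor>2 * \<bar>s\<bar>\<rfloor>) / (\<Prod>s\<in>L\<^sub>2. qnum q \<lfloor>2 * \<bar>s\<bar>\<rfloor>)"
  proof -
    let ?g = "\<lambda>y. qnum q \<bar>y\<bar>"
    have zero: "0 \<notin> heights F\<^sub>L" "0 \<notin> heights F\<^sub>R" "0 \<notin> heights L\<^sub>1"
      using heights_labels(1)[of _ N 0] labels L1 by auto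
    have F: "prod ?g (heights F\<^sub>L) = (Y (heights F\<^sub>L))\<^sup>2" "prod ?g (heights F\<^sub>R) = (Y (heights F\<^sub>R))\<^sup>2"
      using finite_heights[OF labels(1)] finite_heights[OF labels(2)] heights_uminus[OF FL(2)]
        heights_uminus[OF FR(2)] zero by (auto intro: prod_qnum_symmetric[OF q])
    let ?c = "prod ?g (heights (L\<^sub>1 - F\<^sub>L))"
    have "prod ?g (heights L\<^sub>1) = ?c * prod ?g (heights F\<^sub>L)"
      unfolding heights_Diff using FL(1) by (intro prod.subset_diff finite_heights[OF L1] heights_mono) auto
    moreover have "prod ?g (heights L\<^sub>2) = ?c * prod ?g (heights F\<^sub>R)"
      unfolding assms(14) heights_Un
    proof (rule prod.union_disjoint)
      show "finite (heights (L\<^sub>1 - F\<^sub>L))" "finite (heights F\<^sub>R)"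
        using finite_heights[OF L1] finite_heights[OF labels(2)] by (auto simp: heights_Diff)
      show "heights (L\<^sub>1 - F\<^sub>L) \<inter> heights F\<^sub>R = {}"
        using FR(1) by (auto simp: heights_def)
    qed
    moreover have "?c \<noteq> 0"
      using zero finite_heights[OF L1] by (auto simp: heights_Diff qnum_eq_0_iff[OF q])
    ultimately show ?thesis
      by (simp add: prod_labels[OF L1] prod_labels[OF labels(3)] F power_divide)
  qed
  moreover have "0 < ?r"
    using Y_pos by simp
  moreover have "M q (H' n m \<alpha> \<beta> \<gamma> L\<^sub>2 R\<^sub>2 B) / M q (H' m n \<alpha> \<beta> \<gamma> L\<^sub>1 R\<^sub>1 B) =
      (\<Prod>i=1..m+\<alpha>+1. qfact q (2*i - 2))\<^sup>2 / (\<Prod>i=1..n+\<alpha>+1. qfact q (2*i - 2))\<^sup>2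
      * ((\<Prod>i\<in>{1..<2*n+\<beta>}. qfact q i) / (\<Prod>i\<in>{1..<2*m+\<beta>}. qfact q i))
      * ?r
      * ((\<Delta>\<^sub>1\<^sub>1 q L\<^sub>2 * \<Delta>\<^sub>1\<^sub>1 q R\<^sub>2) / (\<Delta>\<^sub>1\<^sub>1 q L\<^sub>1 * \<Delta>\<^sub>1\<^sub>1 q R\<^sub>1))"
    unfolding Delta_heights[OF q L1] Delta_heights[OF q R1] Delta_heights[OF q labels(3)] Delta_heights[OF q labels(4)]
    using M_flip[OF q assms(2,3) L1 R1 degenerate FL FR assms(14-16)] assms(16)
    unfolding left_norm_def[OF q] right_norm_def[OF q] by (simp only: nonzero_mult_div_cancel_right not_False_eq_True)
  ultimately show ?thesis
    by blast
qed

end
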